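(* One can use optimal scalable stencils obtained via polyharmonic kernels $H_{m,d}$ to get optimal convergence rates, namely $m-s-d/2$ for functionals $\lambda$ of scaling order $s$, in $W_2^m(\Omega)$ for $\Omega\subset\mathbb{R}^d$, provided that the underlying sets $X$ allow exactness on polynomials of order $q(m-d/2)=\lfloor m-d/2\rfloor+1$.
   Context: Setting: $m>d/2$; $\Omega\subset\mathbb{R}^d$ is a bounded Lipschitz domain that is scalable, i.e. it contains the origin as an interior point and $h\Omega\subseteq\Omega$ for all $0\le h\le1$; $X=\{x_1,\dots,x_M\}\subset\Omega$ is a finite node set; $W_2^m(\Omega)$ is the usual $L_2$-based Sobolev space of order $m$. The functional $\lambda$ has scaling order $s$, i.e. $\lambda(u(h\,\cdot))=h^s\lambda(u)$ for all $u$ in its domain and $0<h\le1$, and is continuous on $W_2^\mu(\Omega)$ for some $\mu$ with $d/2<\mu\le\lfloor m-d/2\rfloor+1$ and $\mu\le m$. Functionals on spaces over $\Omega$ act on functions on $\mathbb{R}^d$ by restriction. For $a\in\mathbb{R}^M$ put $\lambda_{a,X}(u)=\sum_{j=1}^M a_ju(x_j)$. The set $X$ allows exactness on polynomials of order $q$ if, for some $a$, $\lambda-\lambda_{a,X}=0$ on the space $\mathcal{P}_q^d$ of real $d$-variate polynomials of order at most $q$, i.e. of total degree less than $q$; here, for $q=\lfloor m-d/2\rfloor+1$, some such approximation is assumed to satisfy $\lambda-\lambda_{a,X}\in BL_{m,d}^*$. The scalable stencil with weights $a$ on $X$ has error functionals $\epsilon_h(u)=\lambda(u)-h^{-s}\sum_{j=1}^M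 a_ju(hx_j)$, $0<h\le1$. The polyharmonic kernel is, up to a positive scalar multiple, $H_{m,d}(r)=(-1)^{\lfloor m-d/2\rfloor+1}r^{2m-d}\log r$ if $2m-d$ is an even integer and $H_{m,d}(r)=(-1)^{\lfloor m-d/2\rfloor+1}r^{2m-d}$ otherwise. It is conditionally positive definite of order $\ell=\lfloor m-d/2\rfloor+1$. The Beppo-Levi space $BL_{m,d}$ is the space reproduced by it (its native space): the continuous functions $u:\mathbb{R}^d\to\mathbb{R}$ for which there is $C\ge0$ such that $|\sum_j c_ju(y_j)|\le C(\sum_{j,k}c_jc_kH_{m,d}(\|y_j-y_k\|_2))^{1/2}$ for all finite sets of points $y_j\in\mathbb{R}^d$ and real $c_j$ with $\sum_jc_jp(y_j)=0$ for all $p\in\mathcal{P}_\ell^d$; the smallest such $C$ is the (semi)norm $\|u\|_{BL_{m,d}}$. A linear functional $\epsilon$ is in $BL_{m,d}^*$ if $\|\epsilon\|_{BL_{m,d}^*}=\sup\{|\epsilon(u)|:\|u\|_{BL_{m,d}}\le1\}<\infty$. The optimal scalable stencil obtained via $H_{m,d}$ is the scalable stencil whose weights minimize $\|\lambda-\lambda_{a,X}\|_{BL_{m,d}^*}$ over all $a\in\mathbb{R}^M$ for which $\lambda_{a,X}$ is exact on polynomials of order $\lfloor m-d/2\rfloor+1$. A stencil has convergence rate $k$ in $W_2^m(\Omega)$ if $\|\epsilon_h\|_{W_2^m(\Omega)^*}\le Ch^k$ for $h\to0$ with a constant $C$. The rate $m-s-d/2$ is called optimal because it is the upper bound for the convergence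 rate of nodal approximations $u\mapsto\sum_{j=1}^M a_j(h)u(hx_j)$, with arbitrary weights, to a functional of scaling order $s$ in Sobolev spaces of order $m>d/2$. *)

theory Defs
  imports "HOL-Analysis.Analysis"
begin

subsection \<open>Sobolev spaces of real order on open sets\<close>

definition partial_deriv :: "'n::finite \<Rightarrow> (real^'n \<Rightarrow> real) \<Rightarrow> real^'n \<Rightarrow> real" where
  "partial_deriv i f x = frechet_derivative f (at x) (axis i 1)"

fun Ck :: "nat \<Rightarrow> (real^'n::finite \<Rightarrow> real) \<Rightarrow> bool" where
  "Ck 0 f \<longleftrightarrow> continuous_on UNIV f"
| "Ck (Suc k) f \<longleftrightarrow> (\<forall>x. f differentiable (at x)) \<and> (\<forall>i. Ck k (partial_deriv i f))"

definition test_functions :: "(real^'n::finite) set \<Rightarrow> (real^'n \<Rightarrow> real) set" where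
  "test_functions \<Omega> = {\<phi>. (\<forall>k. Ck k \<phi>) \<and> compact (closure {x. \<phi> x \<noteq> 0}) \<and>
     closure {x. \<phi> x \<noteq> 0} \<subseteq> \<Omega>}"

definition locally_integrable :: "(real^'n::finite) set \<Rightarrow> (real^'n \<Rightarrow> real) \<Rightarrow> bool" where
  "locally_integrable \<Omega> u \<longleftrightarrow> (\<forall>K. compact K \<and> K \<subseteq> \<Omega> \<longrightarrow> integrable (lebesgue_on K) u)"

text \<open>
  Multi-indices are functions from the index type to the naturals. The classical derivative of
  order \<open>\<alpha>\<close> of a test function is an iterated partial derivative along a list of directions in
  which each \<open>i\<close> occurs \<open>\<alpha> i\<close> times; mixed partials commute, so it does not matter which list.
\<close>

definition multi_order :: "('n::finite \<Rightarrow> nat) \<Rightarrow> nat" where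
  "multi_order \<alpha> = (\<Sum>i\<in>UNIV. \<alpha> i)"

definition has_weak_deriv ::
  "(real^'n::finite) set \<Rightarrow> ('n \<Rightarrow> nat) \<Rightarrow> (real^'n \<Rightarrow> real) \<Rightarrow> (real^'n \<Rightarrow> real) \<Rightarrow> bool" where
  "has_weak_deriv \<Omega> \<alpha> u g \<longleftrightarrow> locally_integrable \<Omega> u \<and> locally_integrable \<Omega> g \<and>
     (\<forall>\<phi>\<in>test_functions \<Omega>. \<forall>is. (\<forall>i. count_list is i = \<alpha> i) \<longrightarrow>
        (LINT x|lebesgue_on \<Omega>. u x * foldr partial_deriv is \<phi> x)
          = (- 1) ^ multi_order \<alpha> * (LINT x|lebesgue_on \<Omega>. g x * \<phi> x))"

definition weak_deriv ::
  "(real^'n::finite) set \<Rightarrow> ('n \<Rightarrow> nat) \<Rightarrow> (real^'n \<Rightarrow> real) \<Rightarrow> real^'n \<Rightarrow> real" where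
  "weak_deriv \<Omega> \<alpha> u = (SOME g. has_weak_deriv \<Omega> \<alpha> u g)"

definition L2_sq :: "(real^'n::finite) set \<Rightarrow> (real^'n \<Rightarrow> real) \<Rightarrow> ennreal" where
  "L2_sq \<Omega> g = (\<integral>\<^sup>+x. ennreal ((g x)\<^sup>2) \<partial>lebesgue_on \<Omega>)"

definition slobodeckij_sq :: "(real^'n::finite) set \<Rightarrow> real \<Rightarrow> (real^'n \<Rightarrow> real) \<Rightarrow> ennreal" where
  "slobodeckij_sq \<Omega> \<sigma> g =
     (\<integral>\<^sup>+x. (\<integral>\<^sup>+y. ennreal ((g x - g y)\<^sup>2 / norm (x - y) powr (real CARD('n) + 2 * \<sigma>))
        \<partial>lebesgue_on \<Omega>) \<partial>lebesgue_on \<Omega>)"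

text \<open>
  The space \<open>W\<^sub>2\<^sup>m(\<Omega>)\<close> for real \<open>m \<ge> 0\<close>: weak derivatives up to order \<open>\<lfloor>m\<rfloor>\<close> in \<open>L\<^sub>2(\<Omega>)\<close>
  and, for fractional \<open>m\<close>, finite Slobodeckij seminorms of the derivatives of order \<open>\<lfloor>m\<rfloor>\<close>.
  Functions on \<open>\<Omega>\<close> are represented by functions on the whole space whose values outside
  \<open>\<Omega>\<close> are irrelevant.
\<close>

definition sobolev_sq :: "(real^'n::finite) set \<Rightarrow> real \<Rightarrow> (real^'n \<Rightarrow> real) \<Rightarrow> ennreal" where
  "sobolev_sq \<Omega> m u =
     (\<Sum>\<alpha>\<in>{\<alpha>. multi_order \<alpha> \<le> nat \<lfloor>m\<rfloor>}. L2_sq \<Omega> (weak_deriv \<Omega> \<alpha> u)) +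
     (if frac m = 0 then 0
      else \<Sum>\<alpha>\<in>{\<alpha>. multi_order \<alpha> = nat \<lfloor>m\<rfloor>}. slobodeckij_sq \<Omega> (frac m) (weak_deriv \<Omega> \<alpha> u))"

definition sobolev_space :: "(real^'n::finite) set \<Rightarrow> real \<Rightarrow> (real^'n \<Rightarrow> real) set" where
  "sobolev_space \<Omega> m =
     {u. (\<forall>\<alpha>. multi_order \<alpha> \<le> nat \<lfloor>m\<rfloor> \<longrightarrow> (\<exists>g. has_weak_deriv \<Omega> \<alpha> u g)) \<and>
         sobolev_sq \<Omega> m u < \<infinity>}"

definition sobolev_norm :: "(real^'n::finite) set \<Rightarrow> real \<Rightarrow> (real^'n \<Rightarrow> real) \<Rightarrow> real" where
  "sobolev_norm \<Omega> m u = sqrt (enn2real (sobolev_sq \<Omega> m u))"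

text \<open>
  For \<open>m > d/2\<close> every class in \<open>W\<^sub>2\<^sup>m(\<Omega>)\<close> has a unique continuous representative on \<open>\<Omega>\<close>;
  this is the one on which point evaluations act.
\<close>

definition sobolev_space_cont :: "(real^'n::finite) set \<Rightarrow> real \<Rightarrow> (real^'n \<Rightarrow> real) set" where
  "sobolev_space_cont \<Omega> m = {u \<in> sobolev_space \<Omega> m. continuous_on \<Omega> u}"


subsection \<open>Domains\<close>

text \<open>
  Near each boundary point the domain is the part strictly below the graph of a Lipschitz
  function, after a rotation that takes some unit vector \<open>v\<close> to the vertical direction.
\<close>

definition bounded_lipschitz_domain :: "(real^'n::finite) set \<Rightarrow> bool" where
  "bounded_lipschitz_domain \<Omega> \<longleftrightarrow> open \<Omega> \<and> connected \<Omega> \<and> \<Omega> \<noteq> {} \<and> bounded \<Omega> \<and>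
     (\<forall>p\<in>frontier \<Omega>. \<exists>v r L \<gamma>. norm v = 1 \<and> r > 0 \<and> L-lipschitz_on {y. y \<bullet> v = 0} \<gamma> \<and>
        (\<forall>x\<in>ball p r. x \<in> \<Omega> \<longleftrightarrow> x \<bullet> v < \<gamma> (x - (x \<bullet> v) *\<^sub>R v)))"

definition scalable :: "(real^'n::finite) set \<Rightarrow> bool" where
  "scalable \<Omega> \<longleftrightarrow> 0 \<in> interior \<Omega> \<and> (\<forall>h\<in>{0..1}. (\<lambda>x. h *\<^sub>R x) ` \<Omega> \<subseteq> \<Omega>)"


subsection \<open>Functionals\<close>

definition linear_functional_on ::
  "(real^'n::finite \<Rightarrow> real) set \<Rightarrow> ((real^'n \<Rightarrow> real) \<Rightarrow> real) \<Rightarrow> bool" where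
  "linear_functional_on V \<epsilon> \<longleftrightarrow>
     (\<forall>u\<in>V. \<forall>v\<in>V. \<epsilon> (\<lambda>x. u x + v x) = \<epsilon> u + \<epsilon> v) \<and>
     (\<forall>u\<in>V. \<forall>c. \<epsilon> (\<lambda>x. c * u x) = c * \<epsilon> u)"

text \<open>
  Continuity forces the functional to agree on functions that coincide almost everywhere in \<open>\<Omega>\<close>,
  hence to be well defined on restrictions to \<open>\<Omega>\<close>.
\<close>

definition continuous_functional_on_sobolev ::
  "(real^'n::finite) set \<Rightarrow> real \<Rightarrow> ((real^'n \<Rightarrow> real) \<Rightarrow> real) \<Rightarrow> bool" where
  "continuous_functional_on_sobolev \<Omega> \<mu> \<epsilon> \<longleftrightarrow> linear_functional_on (sobolev_space \<Omega> \<mu>) \<epsilon> \<and>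
     (\<exists>C. \<forall>u\<in>sobolev_space \<Omega> \<mu>. \<bar>\<epsilon> u\<bar> \<le> C * sobolev_norm \<Omega> \<mu> u)"

definition has_scaling_order ::
  "(real^'n::finite \<Rightarrow> real) set \<Rightarrow> ((real^'n \<Rightarrow> real) \<Rightarrow> real) \<Rightarrow> real \<Rightarrow> bool" where
  "has_scaling_order V \<epsilon> s \<longleftrightarrow>
     (\<forall>u\<in>V. \<forall>h\<in>{0<..1}. \<epsilon> (\<lambda>x. u (h *\<^sub>R x)) = h powr s * \<epsilon> u)"

definition dual_norm ::
  "(real^'n::finite \<Rightarrow> real) set \<Rightarrow> ((real^'n \<Rightarrow> real) \<Rightarrow> real) \<Rightarrow>
     ((real^'n \<Rightarrow> real) \<Rightarrow> real) \<Rightarrow> ennreal" where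
  "dual_norm V N \<epsilon> = (SUP u\<in>{u\<in>V. N u \<le> 1}. ennreal \<bar>\<epsilon> u\<bar>)"


subsection \<open>Polynomials, polyharmonic kernels and Beppo-Levi spaces\<close>

text \<open>Polynomials of order at most \<open>q\<close>, that is, of total degree less than \<open>q\<close>.\<close>

definition poly_space :: "nat \<Rightarrow> (real^'n::finite \<Rightarrow> real) set" where
  "poly_space q =
     {p. \<exists>c. p = (\<lambda>x. \<Sum>\<alpha>\<in>{\<alpha>. multi_order \<alpha> < q}. c \<alpha> * (\<Prod>i\<in>UNIV. (x $ i) ^ \<alpha> i))}"

definition polyharmonic_order :: "real \<Rightarrow> nat \<Rightarrow> nat" where
  "polyharmonic_order m d = nat \<lfloor>m - real d / 2\<rfloor> + 1"

text \<open>
  The kernel is only fixed up to a positive scalar multiple, here \<open>\<kappa>\<close>.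
  At \<open>r = 0\<close> the conventions \<open>0 powr a = 0\<close> and \<open>ln 0 = 0\<close> give the continuous extension.
\<close>

definition polyharmonic_kernel :: "real \<Rightarrow> real \<Rightarrow> nat \<Rightarrow> real \<Rightarrow> real" where
  "polyharmonic_kernel \<kappa> m d r = \<kappa> * (- 1) ^ polyharmonic_order m d * r powr (2 * m - real d) *
     (if \<exists>k::int. 2 * m - real d = of_int (2 * k) then ln r else 1)"

definition bl_bound :: "real \<Rightarrow> real \<Rightarrow> (real^'n::finite \<Rightarrow> real) \<Rightarrow> real \<Rightarrow> bool" where
  "bl_bound \<kappa> m u C \<longleftrightarrow> C \<ge> 0 \<and>
     (\<forall>Y c. finite Y \<and> (\<forall>p\<in>poly_space (polyharmonic_order m CARD('n)). (\<Sum>y\<in>Y. c y * p y) = 0) \<longrightarrow>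
        \<bar>\<Sum>y\<in>Y. c y * u y\<bar> \<le>
          C * sqrt (\<Sum>y\<in>Y. \<Sum>z\<in>Y. c y * c z * polyharmonic_kernel \<kappa> m CARD('n) (norm (y - z))))"

definition bl_space :: "real \<Rightarrow> real \<Rightarrow> (real^'n::finite \<Rightarrow> real) set" where
  "bl_space \<kappa> m = {u. continuous_on UNIV u \<and> (\<exists>C. bl_bound \<kappa> m u C)}"

definition bl_norm :: "real \<Rightarrow> real \<Rightarrow> (real^'n::finite \<Rightarrow> real) \<Rightarrow> real" where
  "bl_norm \<kappa> m u = Inf {C. bl_bound \<kappa> m u C}"

definition bl_dual_norm :: "real \<Rightarrow> real \<Rightarrow> ((real^'n::finite \<Rightarrow> real) \<Rightarrow> real) \<Rightarrow> ennreal" where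
  "bl_dual_norm \<kappa> m \<epsilon> = dual_norm (bl_space \<kappa> m) (bl_norm \<kappa> m) \<epsilon>"


subsection \<open>Nodal approximations and scalable stencils\<close>

text \<open>Weights are functions of the node; only their values on \<open>X\<close> matter.\<close>

definition nodal :: "(real^'n::finite) set \<Rightarrow> (real^'n \<Rightarrow> real) \<Rightarrow> (real^'n \<Rightarrow> real) \<Rightarrow> real" where
  "nodal X a u = (\<Sum>x\<in>X. a x * u x)"

definition poly_exact ::
  "((real^'n::finite \<Rightarrow> real) \<Rightarrow> real) \<Rightarrow> (real^'n) set \<Rightarrow> nat \<Rightarrow> (real^'n \<Rightarrow> real) \<Rightarrow> bool" where
  "poly_exact \<Lambda> X q a \<longleftrightarrow> (\<forall>p\<in>poly_space q. \<Lambda> p - nodal X a p = 0)"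

definition bl_optimal_weights ::
  "real \<Rightarrow> real \<Rightarrow> ((real^'n::finite \<Rightarrow> real) \<Rightarrow> real) \<Rightarrow> (real^'n) set \<Rightarrow> (real^'n \<Rightarrow> real) \<Rightarrow> bool" where
  "bl_optimal_weights \<kappa> m \<Lambda> X a \<longleftrightarrow>
     poly_exact \<Lambda> X (polyharmonic_order m CARD('n)) a \<and>
     (\<forall>b. poly_exact \<Lambda> X (polyharmonic_order m CARD('n)) b \<longrightarrow>
        bl_dual_norm \<kappa> m (\<lambda>u. \<Lambda> u - nodal X a u) \<le> bl_dual_norm \<kappa> m (\<lambda>u. \<Lambda> u - nodal X b u))"

definition stencil_error ::
  "((real^'n::finite \<Rightarrow> real) \<Rightarrow> real) \<Rightarrow> real \<Rightarrow> (real^'n) set \<Rightarrow> (real^'n \<Rightarrow> real) \<Rightarrow>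
     real \<Rightarrow> (real^'n \<Rightarrow> real) \<Rightarrow> real" where
  "stencil_error \<Lambda> s X a h u = \<Lambda> u - h powr (- s) * (\<Sum>x\<in>X. a x * u (h *\<^sub>R x))"

definition has_convergence_rate ::
  "(real^'n::finite) set \<Rightarrow> real \<Rightarrow> (real \<Rightarrow> (real^'n \<Rightarrow> real) \<Rightarrow> real) \<Rightarrow> real \<Rightarrow> bool" where
  "has_convergence_rate \<Omega> m \<epsilon> k \<longleftrightarrow>
     (\<exists>C. \<forall>\<^sub>F h in at_right 0.
        dual_norm (sobolev_space_cont \<Omega> m) (sobolev_norm \<Omega> m) (\<epsilon> h) \<le> ennreal (C * h powr k))"

end

theory Submission
  imports Defs
begin

text \<open>
  Any weights that are exact on polynomials of order \<open>q = \<lfloor>m - d / 2\<rfloor> + 1\<close> give the rate; optimality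
  only matters for the existence of a minimizer.

  Choose balls with \<open>\<Omega> \<subseteq> ball 0 R\<close> and \<open>ball 0 R\<^sub>0 \<subseteq> \<Omega>\<close>. For \<open>h * R \<le> R\<^sub>0\<close> the function \<open>u(h x)\<close> is defined
  on all of \<open>ball 0 R\<close>, so that interior estimates suffice and no extension operator is needed.
  Subtract from \<open>u(h x)\<close> the polynomial of order \<open>q\<close> that matches the means over \<open>ball 0 R\<close> of its
  derivatives of order less than \<open>q\<close>. By the Poincare inequality the derivatives of order less than
  \<open>q\<close> of the difference are controlled by those of order at least \<open>q\<close>. For \<open>k \<ge> q\<close> we have
  \<open>m - k < d / 2\<close>, and comparing the means over concentric balls of halved radii yields
  \<open>L\<^sup>2\<close> norm of \<open>D\<^sup>k u\<close> over the ball of radius \<open>r\<close> \<open>\<le> C r\<^sup>m\<^sup>-\<^sup>k\<close>. After scaling, the difference has norm at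
  most \<open>C h\<^sup>m\<^sup>-\<^sup>d\<^sup>/\<^sup>2\<close> in the Sobolev space of order \<open>m\<close>. The polynomial is annihilated by exactness, the
  functional and the point evaluations are bounded on the difference, and the scaling order of the
  functional contributes the factor \<open>h\<^sup>-\<^sup>s\<close>. The Lipschitz property enters only in the embedding of the
  Sobolev space of order \<open>m\<close> on \<open>\<Omega>\<close> into the one of order \<open>\<mu>\<close>: close points of \<open>\<Omega>\<close> are joined by three
  segments in \<open>\<Omega>\<close>, of length comparable to their distance, which bounds the difference seminorm by
  the gradient.
\<close>

subsection \<open>Test functions and the fundamental lemma\<close>

text \<open>The obstacle is the range of orders \<open>k\<close> with \<open>q \<le> k < m\<close>.
  Polynomials of order \<open>q\<close> leave \<open>D^k u\<close> untouched there, and dilation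
  alone gives only \<open>h^(k - d/2)\<close>. The missing factor \<open>h^(m - k)\<close> is
  supplied by the growth bound: with \<open>m - k\<close> further derivatives available,
  \<open>D^k u\<close> has little \<open>L2\<close> mass on small balls. Such a gain stops at
  \<open>d/2\<close>, because a nonzero constant already has norm of order \<open>r^(d/2)\<close>;
  this is why \<open>q\<close> has to exceed \<open>m - d/2\<close>. The same growth bounds also
  control the point evaluations, in the manner of Morrey and Campanato, so one estimate serves both
  parts of the error functional. All constants must be fixed before \<open>u\<close> and
  \<open>h\<close>, hence the many statements with the constant quantified outermost. Weak
  derivatives are arbitrary choices, integrated against the completed measure; they are replaced by
  families of Borel functions, to which Fubini's theorem and substitutions apply directly.\<close>

lemma partial_derivI:
  assumes "(f has_derivative D) (at x)"
  shows "partial_deriv i f x = D (axis i 1)"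
  using frechet_derivative_at[OF assms] by (simp add: partial_deriv_def)

definition bump_exp :: "real poly \<Rightarrow> real \<Rightarrow> real" where
  "bump_exp p t = (if t > 0 then poly p (1 / t) * exp (- (1 / t)) else 0)"

lemma poly_times_exp_neg_tendsto_0:
  "((\<lambda>x::real. poly p x * exp (- x)) \<longlongrightarrow> 0) at_top"
proof -
  have "((\<lambda>x::real. \<Sum>i\<le>degree p. coeff p i * (x ^ i / exp x)) \<longlongrightarrow> (\<Sum>i\<le>degree p. coeff p i * 0)) at_top"
    by (intro tendsto_sum tendsto_mult tendsto_const tendsto_power_div_exp_0)
  moreover have "(\<Sum>i\<le>degree p. coeff p i * (x ^ i / exp x)) = poly p x * exp (- x)" for x
    by (simp add: poly_altdef sum_distrib_right exp_minus divide_inverse mult.assoc)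
  ultimately show ?thesis by simp
qed

text \<open>With \<open>s = 1 / t\<close> the operator \<open>d/dt\<close> becomes
  \<open>- s^2 d/ds\<close>, and it sends \<open>p(s) exp(-s)\<close> to
  \<open>s^2 (p - p')(s) exp(-s)\<close>; this is the polynomial on the right. At \<open>0\<close>
  the exponential beats every power of \<open>1 / t\<close>.\<close>

lemma bump_exp_has_derivative:
  "(bump_exp p has_real_derivative bump_exp (monom 1 2 * (p - pderiv p)) t) (at t)"
proof -
  consider "t > 0" | "t < 0" | "t = 0" by linarith
  then show ?thesis
  proof cases
    case 1
    have d: "((\<lambda>t. poly p (1 / t)) has_real_derivative poly (pderiv p) (1 / t) * (- (1 / t\<^sup>2))) (at t)"
      by (rule DERIV_chain2[OF poly_DERIV])
        (use 1 in \<open>auto intro!: derivative_eq_intros simp: power2_eq_square\<close>)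
    have e: "((\<lambda>t. exp (- (1 / t))) has_real_derivative exp (- (1 / t)) * (1 / t\<^sup>2)) (at t)"
      using 1 by (auto intro!: derivative_eq_intros simp: power2_eq_square)
    have "((\<lambda>t. poly p (1 / t) * exp (- (1 / t))) has_real_derivative
        poly (monom 1 2 * (p - pderiv p)) (1 / t) * exp (- (1 / t))) (at t)"
      by (rule DERIV_cong[OF DERIV_mult[OF d e]]) (simp add: poly_monom algebra_simps power_one_over)
    then have "(bump_exp p has_real_derivative
        poly (monom 1 2 * (p - pderiv p)) (1 / t) * exp (- (1 / t))) (at t)"
      by (rule has_field_derivative_transform_within_open[where S = "{0<..}"])
        (use 1 in \<open>auto simp: bump_exp_def\<close>)
    then show ?thesis using 1 by (simp add: bump_exp_def)
  next
    case 2
    have "((\<lambda>t. 0) has_real_derivative 0) (at t)" by simp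
    then have "(bump_exp p has_real_derivative 0) (at t)"
      by (rule has_field_derivative_transform_within_open[where S = "{..<0}"])
        (use 2 in \<open>auto simp: bump_exp_def\<close>)
    then show ?thesis using 2 by (simp add: bump_exp_def)
  next
    case 3
    \<comment> \<open>The factor \<open>pCons 0 p\<close> carries the extra \<open>1 / h\<close> of
      the difference quotient at \<open>0\<close>.\<close>
    have "((\<lambda>x. poly (pCons 0 p) x * exp (- x)) \<longlongrightarrow> 0) at_top"
      by (rule poly_times_exp_neg_tendsto_0)
    then have "((\<lambda>h. poly (pCons 0 p) (inverse h) * exp (- (inverse h))) \<longlongrightarrow> 0) (at_right 0)"
      by (rule filterlim_compose[OF _ filterlim_inverse_at_top_right])
    then have r: "((\<lambda>h. (bump_exp p h - bump_exp p 0) / h) \<longlongrightarrow> 0) (at_right 0)"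
    proof (rule Lim_transform_eventually)
      show "\<forall>\<^sub>F h in at_right 0. poly (pCons 0 p) (inverse h) * exp (- inverse h)
          = (bump_exp p h - bump_exp p 0) / h"
        using eventually_at_right_less[of "0::real"]
        by (rule eventually_mono) (simp add: bump_exp_def divide_inverse)
    qed
    have l: "((\<lambda>h. (bump_exp p h - bump_exp p 0) / h) \<longlongrightarrow> 0) (at_left 0)"
    proof (rule Lim_transform_eventually[OF tendsto_const])
      have "\<forall>\<^sub>F h::real in at_left 0. h \<in> {-1<..<0}" by (rule eventually_at_left_real) simp
      then show "\<forall>\<^sub>F h in at_left 0. 0 = (bump_exp p h - bump_exp p 0) / h"
        by (rule eventually_mono) (simp add: bump_exp_def)
    qed
    show ?thesis
      using filterlim_split_at[OF l r] by (simp add: DERIV_def 3 bump_exp_def)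
  qed
qed

lemma bump_exp_1: "bump_exp 1 t = (if t > 0 then exp (- (1 / t)) else 0)"
  by (simp add: bump_exp_def)

text \<open>
  The bumps are products of one-dimensional functions \<open>exp (- 1 / t)\<close>; this algebra is closed under
  partial derivatives, which gives their smoothness.
\<close>

inductive_set smooth_algebra :: "(real^'n::finite \<Rightarrow> real) set" where
  const: "(\<lambda>x. c) \<in> smooth_algebra"
| bump: "(\<lambda>x. bump_exp p (c * (x $ i) + b)) \<in> smooth_algebra"
| add: "f \<in> smooth_algebra \<Longrightarrow> g \<in> smooth_algebra \<Longrightarrow> (\<lambda>x. f x + g x) \<in> smooth_algebra"
| mult: "f \<in> smooth_algebra \<Longrightarrow> g \<in> smooth_algebra \<Longrightarrow> (\<lambda>x. f x * g x) \<in> smooth_algebra"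

lemma smooth_algebra_closed:
  fixes f :: "real^'n::finite \<Rightarrow> real"
  assumes "f \<in> smooth_algebra"
  shows "(\<forall>x. f differentiable (at x)) \<and> (\<forall>i. partial_deriv i f \<in> smooth_algebra)"
  using assms
proof induction
  case (const c)
  have "partial_deriv i (\<lambda>x::real^'n. c) = (\<lambda>x. 0)" for i
    by (rule ext, subst partial_derivI[OF has_derivative_const]) simp
  then show ?case by (auto intro: smooth_algebra.const)
next
  case (bump p c j b)
  define p' where "p' = monom 1 2 * (p - pderiv p)"
  have d: "((\<lambda>x::real^'n. bump_exp p (c * (x $ j) + b)) has_derivative
      (\<lambda>v. c * (v $ j) * bump_exp p' (c * (x $ j) + b))) (at x)" for x
  proof -
    have l: "((\<lambda>x::real^'n. c * (x $ j) + b) has_derivative (\<lambda>v. c * (v $ j))) (at x)"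
      by (auto intro!: has_derivative_add_const has_derivative_mult_right
          bounded_linear_imp_has_derivative bounded_linear_const_mult bounded_linear_vec_nth)
    have "(bump_exp p has_derivative (*) (bump_exp p' (c * (x $ j) + b))) (at (c * (x $ j) + b))"
      using bump_exp_has_derivative[of p "c * (x $ j) + b"] by (simp add: p'_def has_field_derivative_def)
    from has_derivative_compose[OF l this] show ?thesis by (simp add: mult_ac)
  qed
  have "partial_deriv i (\<lambda>x::real^'n. bump_exp p (c * (x $ j) + b))
      = (\<lambda>x. c * (axis i 1 $ j) * bump_exp p' (c * (x $ j) + b))" for i
    by (rule ext, rule partial_derivI[OF d])
  moreover have "(\<lambda>x. c * (axis i 1 $ j) * bump_exp p' (c * (x $ j) + b)) \<in> smooth_algebra" for i::'n
    by (intro smooth_algebra.mult smooth_algebra.const smooth_algebra.bump)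
  ultimately show ?case using d by (auto simp: differentiable_def)
next
  case (add f g)
  have "partial_deriv i (\<lambda>x. f x + g x) = (\<lambda>x. partial_deriv i f x + partial_deriv i g x)" for i
  proof
    fix x
    have "((\<lambda>x. f x + g x) has_derivative (\<lambda>v. frechet_derivative f (at x) v + frechet_derivative g (at x) v)) (at x)"
      using add by (intro has_derivative_add) (auto simp: frechet_derivative_works[symmetric])
    from partial_derivI[OF this]
    show "partial_deriv i (\<lambda>x. f x + g x) x = partial_deriv i f x + partial_deriv i g x"
      by (simp add: partial_deriv_def)
  qed
  with add show ?case by (auto intro: smooth_algebra.add)
next
  case (mult f g)
  have "partial_deriv i (\<lambda>x. f x * g x) = (\<lambda>x. f x * partial_deriv i g x + partial_deriv i f x * g x)" for i
  proof
    fix x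
    have "((\<lambda>x. f x * g x) has_derivative (\<lambda>v. f x * frechet_derivative g (at x) v + frechet_derivative f (at x) v * g x)) (at x)"
      using mult by (intro has_derivative_mult) (auto simp: frechet_derivative_works[symmetric])
    from partial_derivI[OF this]
    show "partial_deriv i (\<lambda>x. f x * g x) x = f x * partial_deriv i g x + partial_deriv i f x * g x"
      by (simp add: partial_deriv_def)
  qed
  with mult show ?case by (auto intro!: smooth_algebra.add smooth_algebra.mult)
qed

lemma smooth_algebra_Ck: "f \<in> smooth_algebra \<Longrightarrow> Ck k f"
proof (induction k arbitrary: f)
  case 0
  then show ?case
    using smooth_algebra_closed[OF 0]
    by (auto intro!: continuous_at_imp_continuous_on differentiable_imp_continuous_within)
next
  case (Suc k)
  then show ?case using smooth_algebra_closed[of f] by auto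
qed

lemma smooth_algebra_prod: "finite I \<Longrightarrow> (\<And>i. i \<in> I \<Longrightarrow> f i \<in> smooth_algebra) \<Longrightarrow> (\<lambda>x. \<Prod>i\<in>I. f i x) \<in> smooth_algebra"
  by (induction I rule: finite_induct) (auto intro: smooth_algebra.intros)

text \<open>The outer factor \<open>a\<close> is there for the induction: a partial derivative of
  \<open>f (b + c x)\<close> produces a factor \<open>c\<close>, which is absorbed into it.\<close>

lemma Ck_affine:
  fixes f :: "real^'n::finite \<Rightarrow> real"
  assumes "Ck k f"
  shows "Ck k (\<lambda>x. a * f (b + c *\<^sub>R x))"
  using assms
proof (induction k arbitrary: f a)
  case 0
  have "continuous_on (UNIV::(real^'n) set) (\<lambda>x. f (b + c *\<^sub>R x))"
    by (rule continuous_on_compose2[of UNIV f]) (use 0 in \<open>auto intro!: continuous_intros\<close>)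
  then show ?case by (auto intro!: continuous_intros)
next
  case (Suc k)
  have d: "((\<lambda>x. a * f (b + c *\<^sub>R x)) has_derivative (\<lambda>v. a * (c * frechet_derivative f (at (b + c *\<^sub>R x)) v))) (at x)" for x
  proof -
    have f: "(f has_derivative frechet_derivative f (at (b + c *\<^sub>R x))) (at (b + c *\<^sub>R x))"
      using Suc.prems by (auto simp: frechet_derivative_works[symmetric])
    interpret l: bounded_linear "frechet_derivative f (at (b + c *\<^sub>R x))"
      using f by (rule has_derivative_bounded_linear)
    have g: "((\<lambda>x. b + c *\<^sub>R x) has_derivative (\<lambda>v. c *\<^sub>R v)) (at x)"
      by (auto intro!: derivative_eq_intros)
    show ?thesis
      using has_derivative_mult_right[OF has_derivative_compose[where g = f, OF g f], of a] by (simp add: l.scaleR)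
  qed
  have p: "partial_deriv i (\<lambda>x. a * f (b + c *\<^sub>R x)) = (\<lambda>x. a * c * partial_deriv i f (b + c *\<^sub>R x))" for i
    by (rule ext, subst partial_derivI[OF d]) (simp add: partial_deriv_def)
  show ?case
    using Suc d by (auto simp: differentiable_def p)
qed

lemma partial_deriv_affine:
  fixes f :: "real^'n::finite \<Rightarrow> real"
  assumes "f differentiable (at (b + c *\<^sub>R x))"
  shows "partial_deriv i (\<lambda>x. f (b + c *\<^sub>R x)) x = c * partial_deriv i f (b + c *\<^sub>R x)"
proof -
  have f: "(f has_derivative frechet_derivative f (at (b + c *\<^sub>R x))) (at (b + c *\<^sub>R x))"
    using assms by (auto simp: frechet_derivative_works[symmetric])
  interpret l: bounded_linear "frechet_derivative f (at (b + c *\<^sub>R x))"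
    using f by (rule has_derivative_bounded_linear)
  have "((\<lambda>x. f (b + c *\<^sub>R x)) has_derivative (\<lambda>v. (c * frechet_derivative f (at (b + c *\<^sub>R x)) v))) (at x)"
  proof -
    have g: "((\<lambda>x. b + c *\<^sub>R x) has_derivative (\<lambda>v. c *\<^sub>R v)) (at x)"
      by (auto intro!: derivative_eq_intros)
    show ?thesis
      using has_derivative_compose[where g = f, OF g f] by (simp add: l.scaleR)
  qed
  from partial_derivI[OF this] show ?thesis by (simp add: partial_deriv_def)
qed

section \<open>Elementary properties of test functions\<close>

context
  fixes S :: "(real^'n::finite) set" and \<phi>
  assumes \<phi>: "\<phi> \<in> test_functions S"
begin

lemma test_Ck: "Ck k \<phi>" and test_compact: "compact (closure {x. \<phi> x \<noteq> 0})"
  and test_subset: "closure {x. \<phi> x \<noteq> 0} \<subseteq> S"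
  using \<phi> by (auto simp: test_functions_def)

lemma test_differentiable: "\<phi> differentiable (at x)"
  using test_Ck[of 1] by auto

lemma test_has_derivative: "(\<phi> has_derivative frechet_derivative \<phi> (at x)) (at x)"
  using test_differentiable by (simp add: frechet_derivative_works[symmetric])

lemma test_continuous: "continuous_on A \<phi>"
  using test_Ck[of 0] continuous_on_subset by auto

lemma test_zero: "x \<notin> S \<Longrightarrow> \<phi> x = 0"
  using test_subset closure_subset[of "{x. \<phi> x \<noteq> 0}"] by blast

lemma test_measurable: "\<phi> \<in> borel_measurable borel"
  using test_continuous[of UNIV] by (rule borel_measurable_continuous_onI)

lemma test_bounded: "\<exists>B\<ge>0. \<forall>x. \<bar>\<phi> x\<bar> \<le> B"
proof -
  have "compact (\<phi> ` closure {x. \<phi> x \<noteq> 0})"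
    by (rule compact_continuous_image[OF test_continuous test_compact])
  then obtain B where B: "\<And>x. x \<in> closure {x. \<phi> x \<noteq> 0} \<Longrightarrow> norm (\<phi> x) \<le> B"
    by (metis compact_imp_bounded bounded_iff imageI)
  have "\<bar>\<phi> x\<bar> \<le> max B 0" for x
    using B[of x] closure_subset[of "{x. \<phi> x \<noteq> 0}"] by (cases "\<phi> x = 0") (auto simp: max_def subset_iff)
  then show ?thesis by (intro exI[of _ "max B 0"]) auto
qed

lemma test_partial: "partial_deriv i \<phi> \<in> test_functions S"
proof -
  have z: "partial_deriv i \<phi> x = 0" if "x \<notin> closure {x. \<phi> x \<noteq> 0}" for x
  proof -
    have "(\<phi> has_derivative (\<lambda>v. 0)) (at x)"
    proof (rule has_derivative_transform_within_open[OF has_derivative_const])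
      show "open (- closure {x. \<phi> x \<noteq> 0})" by auto
      show "x \<in> - closure {x. \<phi> x \<noteq> 0}" using that by auto
      show "0 = \<phi> y" if "y \<in> - closure {x. \<phi> x \<noteq> 0}" for y
        using that closure_subset[of "{x. \<phi> x \<noteq> 0}"] by auto
    qed
    from partial_derivI[OF this] show ?thesis .
  qed
  have "closure {x. partial_deriv i \<phi> x \<noteq> 0} \<subseteq> closure {x. \<phi> x \<noteq> 0}"
    by (rule closure_minimal) (use z in auto)
  moreover from this have "compact (closure {x. partial_deriv i \<phi> x \<noteq> 0})"
    using test_compact by (metis closed_closure compact_Int_closed inf.absorb_iff2)
  moreover have "Ck k (partial_deriv i \<phi>)" for k
    using test_Ck[of "Suc k"] by auto
  ultimately show ?thesis using test_subset by (auto simp: test_functions_def)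
qed

lemma frechet_derivative_sum_partial:
  "frechet_derivative \<phi> (at x) w = (\<Sum>i\<in>UNIV. w $ i * partial_deriv i \<phi> x)"
proof -
  interpret l: bounded_linear "frechet_derivative \<phi> (at x)"
    using test_has_derivative by (rule has_derivative_bounded_linear)
  have "frechet_derivative \<phi> (at x) w = frechet_derivative \<phi> (at x) (\<Sum>i\<in>UNIV. w $ i *\<^sub>R axis i 1)"
    by (subst basis_expansion[symmetric]) (simp add: scalar_mult_eq_scaleR)
  then show ?thesis by (simp add: l.sum l.scaleR partial_deriv_def)
qed

text \<open>The condition concerns the preimage of the closed support alone, not that of
  \<open>S\<close>. One statement thereby serves translations, where \<open>T\<close> need not be a
  translate of \<open>S\<close>, as well as dilations.\<close>

lemma test_affine:
  assumes "c \<noteq> 0" and T: "\<And>x. b + c *\<^sub>R x \<in> closure {x. \<phi> x \<noteq> 0} \<Longrightarrow> x \<in> T"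
  shows "(\<lambda>x. \<phi> (b + c *\<^sub>R x)) \<in> test_functions T"
proof -
  let ?K = "closure {x. \<phi> x \<noteq> 0}"
  have eq: "{x. b + c *\<^sub>R x \<in> ?K} = (\<lambda>y. - ((1 / c) *\<^sub>R b) + (1 / c) *\<^sub>R y) ` ?K" (is "?L = ?R")
  proof
    show "?R \<subseteq> ?L" using \<open>c \<noteq> 0\<close> by (auto simp: algebra_simps)
    show "?L \<subseteq> ?R"
    proof
      fix x assume "x \<in> ?L"
      moreover have "x = - ((1 / c) *\<^sub>R b) + (1 / c) *\<^sub>R (b + c *\<^sub>R x)"
        using \<open>c \<noteq> 0\<close> by (simp add: algebra_simps)
      ultimately show "x \<in> ?R" by blast
    qed
  qed
  have c: "compact {x. b + c *\<^sub>R x \<in> ?K}"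
    unfolding eq by (intro compact_continuous_image test_compact continuous_intros)
  have s: "closure {x. \<phi> (b + c *\<^sub>R x) \<noteq> 0} \<subseteq> {x. b + c *\<^sub>R x \<in> ?K}"
    by (rule closure_minimal) (use closure_subset[of "{x. \<phi> x \<noteq> 0}"] compact_imp_closed[OF c] in auto)
  then have "compact (closure {x. \<phi> (b + c *\<^sub>R x) \<noteq> 0})"
    using c by (metis closed_closure compact_Int_closed inf.absorb_iff2)
  with s T Ck_affine[OF test_Ck, of _ 1 b c] show ?thesis
    by (auto simp: test_functions_def)
qed

end

lemma test_functions_mono: "S \<subseteq> T \<Longrightarrow> test_functions S \<subseteq> test_functions T"
  by (auto simp: test_functions_def)

lemma exp_neg_inverse_tendsto_1:
  fixes t :: real
  assumes "t > 0"
  shows "(\<lambda>n. bump_exp 1 (real (Suc n) * t)) \<longlonglongrightarrow> 1"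
proof -
  have "(\<lambda>n. inverse (real (Suc n))) \<longlonglongrightarrow> 0" by (rule LIMSEQ_inverse_real_of_nat)
  then have "(\<lambda>n. exp (- (inverse (real (Suc n)) * (1 / t)))) \<longlonglongrightarrow> exp (- (0 * (1 / t)))"
    by (intro tendsto_intros)
  moreover have "bump_exp 1 (real (Suc n) * t) = exp (- (inverse (real (Suc n)) * (1 / t)))" for n
    using assms by (simp add: bump_exp_1 divide_inverse del: of_nat_Suc)
  ultimately show ?thesis by simp
qed

lemma bump_exp_1_bounds: "0 \<le> bump_exp 1 t" "bump_exp 1 t \<le> 1"
  by (auto simp: bump_exp_1)

text \<open>The functions are products of \<open>exp (- 1 / (n (x_i - a_i)))\<close> and
  \<open>exp (- 1 / (n (b_i - x_i)))\<close> over the coordinates, with \<open>n = k + 1\<close>.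
  They vanish outside the open box, and inside it every factor tends to \<open>1\<close> as
  \<open>n\<close> grows.\<close>

lemma box_test_functions:
  fixes a b :: "real^'n::finite"
  assumes "cbox a b \<subseteq> S"
  obtains \<phi> :: "nat \<Rightarrow> real^'n \<Rightarrow> real" where
    "\<And>k. \<phi> k \<in> test_functions S" "\<And>k x. 0 \<le> \<phi> k x" "\<And>k x. \<phi> k x \<le> 1"
    "\<And>x. (\<lambda>k. \<phi> k x) \<longlonglongrightarrow> indicator (box a b) x"
proof
  let ?\<phi> = "\<lambda>k x. \<Prod>i\<in>UNIV. bump_exp 1 (real (Suc k) * (x $ i - a $ i)) * bump_exp 1 (real (Suc k) * (b $ i - x $ i))"
  show "0 \<le> ?\<phi> k x" for k x
    by (intro prod_nonneg mult_nonneg_nonneg bump_exp_1_bounds ballI)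
  show "?\<phi> k x \<le> 1" for k x
    by (intro prod_le_1 conjI mult_nonneg_nonneg mult_le_one bump_exp_1_bounds ballI)
  have z: "x \<in> box a b" if "?\<phi> k x \<noteq> 0" for k x
  proof -
    have "\<forall>i. bump_exp 1 (real (Suc k) * (x $ i - a $ i)) \<noteq> 0 \<and> bump_exp 1 (real (Suc k) * (b $ i - x $ i)) \<noteq> 0"
      using that by (metis (no_types, lifting) UNIV_I finite mult_eq_0_iff prod_zero)
    then show ?thesis
      by (auto simp: mem_box_cart bump_exp_1 zero_less_mult_iff split: if_splits)
  qed
  show "?\<phi> k \<in> test_functions S" for k
  proof -
    have "(\<lambda>x::real^'n. bump_exp 1 (c * (x $ i - d))) \<in> smooth_algebra" for c d i
      using smooth_algebra.bump[of 1 c i "- (c * d)"] by (simp add: algebra_simps)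
    moreover have "(\<lambda>x::real^'n. bump_exp 1 (c * (d - x $ i))) \<in> smooth_algebra" for c d i
      using smooth_algebra.bump[of 1 "- c" i "c * d"] by (simp add: algebra_simps)
    ultimately have "?\<phi> k \<in> smooth_algebra"
      by (intro smooth_algebra_prod smooth_algebra.mult) auto
    moreover have "closure {x. ?\<phi> k x \<noteq> 0} \<subseteq> cbox a b"
    proof (rule closure_minimal)
      show "{x. ?\<phi> k x \<noteq> 0} \<subseteq> cbox a b"
      proof
        fix x assume "x \<in> {x. ?\<phi> k x \<noteq> 0}"
        then have "?\<phi> k x \<noteq> 0" by (rule CollectD)
        then have "x \<in> box a b" by (rule z)
        then show "x \<in> cbox a b" using box_subset_cbox[of a b] by (rule rev_subsetD)
      qed
    qed (rule closed_cbox)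
    moreover from this have "compact (closure {x. ?\<phi> k x \<noteq> 0})"
      unfolding compact_eq_bounded_closed using bounded_subset[OF bounded_cbox] by blast
    ultimately show ?thesis
      using assms smooth_algebra_Ck by (auto simp: test_functions_def)
  qed
  show "(\<lambda>k. ?\<phi> k x) \<longlonglongrightarrow> indicator (box a b) x" for x
  proof (cases "x \<in> box a b")
    case True
    then have "(\<lambda>k. ?\<phi> k x) \<longlonglongrightarrow> (\<Prod>i\<in>(UNIV::'n set). 1 * 1)"
      by (intro tendsto_prod tendsto_mult exp_neg_inverse_tendsto_1) (auto simp: mem_box_cart)
    with True show ?thesis by simp
  next
    case False
    then have z0: "?\<phi> k x = 0" for k using z by blast
    show ?thesis unfolding z0 using False by simp
  qed
qed

text \<open>The boxes form an intersection-stable generator of the Borel sets, and the sets over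
  which \<open>f\<close> integrates to zero form a Dynkin system; complements are where the
  vanishing of the integral over the whole space enters.\<close>

lemma AE_zero_if_box_integrals_zero:
  fixes f :: "'a::euclidean_space \<Rightarrow> real"
  assumes f: "integrable lborel f" and "(LINT x|lborel. f x) = 0"
    and box: "\<And>a b. (LINT x:box a b|lborel. f x) = 0"
  shows "AE x in lborel. f x = 0"
proof (rule sigma_finite_measure.density_zero[OF sigma_finite_lborel f])
  have si: "set_integrable lborel A f" if "A \<in> sets borel" for A
    using integrable_mult_indicator[OF _ f, of A] that by (auto simp: set_integrable_def)
  let ?E = "range (\<lambda>(a, b). box a b::'a set)"
  have E: "Int_stable ?E" "?E \<subseteq> Pow UNIV"
    by (auto simp: Int_stable_def box_Int_box)
  fix A :: "'a set" assume "A \<in> sets lborel"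
  then have "A \<in> sigma_sets UNIV ?E" by (simp add: borel_eq_box)
  with E show "set_lebesgue_integral lborel A f = 0"
  proof (induct rule: sigma_sets_induct_disjoint)
    case (basic A)
    then show ?case using box by auto
  next
    case empty
    then show ?case by (simp add: set_lebesgue_integral_def)
  next
    case (compl A)
    then have A: "A \<in> sets borel" by (simp add: borel_eq_box)
    have "set_lebesgue_integral lborel (A \<union> (UNIV - A)) f =
        set_lebesgue_integral lborel A f + set_lebesgue_integral lborel (UNIV - A) f"
      using A by (intro set_integral_Un si) auto
    then show ?case using compl assms(2) by (simp add: set_lebesgue_integral_def)
  next
    case (union A)
    then have A: "A i \<in> sets borel" for i by (auto simp: borel_eq_box)
    have "set_lebesgue_integral lborel (\<Union>i. A i) f = (\<Sum>i. set_lebesgue_integral lborel (A i) f)"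
      using union(1) A by (intro lebesgue_integral_countable_add si)
        (auto simp: disjoint_family_on_def)
    then show ?case using union by simp
  qed
qed

text \<open>By dominated convergence the test functions of a box may be replaced by its indicator.
  The integrals over boxes then determine \<open>f\<close> on each closed box of a countable cover
  of \<open>S\<close>.\<close>

lemma fundamental_lemma:
  fixes f :: "real^'n::finite \<Rightarrow> real"
  assumes "open S" and f: "\<And>a b. cbox a b \<subseteq> S \<Longrightarrow> set_integrable lborel (cbox a b) f"
    and test: "\<And>\<phi>. \<phi> \<in> test_functions S \<Longrightarrow> (LINT x|lborel. f x * \<phi> x) = 0"
  shows "AE x in lborel. x \<in> S \<longrightarrow> f x = 0"
proof -
  have box0: "(LINT x:box a b|lborel. f x) = 0" if ab: "cbox a b \<subseteq> S" for a b
  proof -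
    have fS: "integrable lborel (\<lambda>x. indicator (cbox a b) x * f x)"
      using f[OF ab] by (simp add: set_integrable_def)
    obtain \<phi> :: "nat \<Rightarrow> real^'n \<Rightarrow> real" where \<phi>: "\<And>k. \<phi> k \<in> test_functions (cbox a b)" "\<And>k x. 0 \<le> \<phi> k x" "\<And>k x. \<phi> k x \<le> 1"
      "\<And>x. (\<lambda>k. \<phi> k x) \<longlonglongrightarrow> indicator (box a b) x"
      using box_test_functions[OF order_refl] by blast
    note [measurable] = borel_measurable_integrable[OF fS] test_measurable[OF \<phi>(1)]
    have eq: "indicator (cbox a b) x * f x * \<phi> k x = f x * \<phi> k x" for x k
      using test_zero[OF \<phi>(1)] by (auto simp: indicator_def)
    have "(\<lambda>k. LINT x|lborel. indicator (cbox a b) x * f x * \<phi> k x) \<longlonglongrightarrow> (LINT x|lborel. indicator (cbox a b) x * f x * indicator (box a b) x)"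
    proof (rule integral_dominated_convergence[where w = "\<lambda>x. \<bar>indicator (cbox a b) x * f x\<bar>"])
      show "AE x in lborel. (\<lambda>k. indicator (cbox a b) x * f x * \<phi> k x) \<longlonglongrightarrow> indicator (cbox a b) x * f x * indicator (box a b) x"
        using \<phi>(4) by (intro AE_I2 tendsto_intros)
      show "AE x in lborel. norm (indicator (cbox a b) x * f x * \<phi> k x) \<le> \<bar>indicator (cbox a b) x * f x\<bar>" for k
        using \<phi>(2,3)[of k] by (intro AE_I2) (simp add: abs_mult mult_left_le)
    qed (use fS in auto)
    moreover have "(LINT x|lborel. indicator (cbox a b) x * f x * \<phi> k x) = 0" for k
      unfolding eq using \<phi>(1)[of k] test_functions_mono[OF ab] by (intro test) blast
    ultimately have "(LINT x|lborel. indicator (cbox a b) x * f x * indicator (box a b) x) = 0"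
      by (simp add: LIMSEQ_const_iff)
    moreover have "indicator (cbox a b) x * f x * indicator (box a b) x = indicator (box a b) x *\<^sub>R f x" for x
      using box_subset_cbox[of a b] by (auto simp: indicator_def)
    ultimately show ?thesis by (simp add: set_lebesgue_integral_def)
  qed
  obtain \<D> where \<D>: "countable \<D>" "\<D> \<subseteq> Pow S" "\<And>X. X \<in> \<D> \<Longrightarrow> \<exists>a b. X = cbox a b" "\<Union>\<D> = S"
    using open_countable_Union_open_cbox[OF \<open>open S\<close>] by metis
  have "AE x in lborel. x \<in> X \<longrightarrow> f x = 0" if X: "X \<in> \<D>" for X
  proof -
    obtain a b where ab: "X = cbox a b" "cbox a b \<subseteq> S" using X \<D> by (metis PowD subsetD)
    let ?g = "\<lambda>x. indicator (box a b) x * f x"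
    have "set_integrable lborel (box a b) f"
      by (rule set_integrable_subset[OF f[OF ab(2)]]) (use box_subset_cbox[of a b] in auto)
    then have g: "integrable lborel ?g" by (simp add: set_integrable_def)
    \<comment> \<open>Two boxes meet in a box, and this one has its closed version inside
      \<open>cbox a b\<close>, hence inside \<open>S\<close>.\<close>
    have "(LINT x:box c d|lborel. ?g x) = 0" for c d
    proof -
      let ?l = "(\<chi> i. max (c $ i) (a $ i)) :: real^'n" and ?u = "(\<chi> i. min (d $ i) (b $ i)) :: real^'n"
      have "cbox ?l ?u \<subseteq> S"
        using ab by (auto simp: mem_box_cart subset_iff)
      then have "(LINT x:box ?l ?u|lborel. f x) = 0" by (rule box0)
      moreover have "(LINT x:box ?l ?u|lborel. f x) = (LINT x:box c d|lborel. ?g x)"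
        unfolding set_lebesgue_integral_def
        by (rule Bochner_Integration.integral_cong) (auto simp: indicator_def mem_box_cart)
      ultimately show ?thesis by simp
    qed
    moreover have "(LINT x|lborel. ?g x) = 0" using box0[OF ab(2)] by (simp add: set_lebesgue_integral_def)
    ultimately have "AE x in lborel. ?g x = 0"
      using g by (intro AE_zero_if_box_integrals_zero)
    \<comment> \<open>The cover consists of closed boxes while the integrals are over open ones; the
      difference is a null set.\<close>
    moreover have "AE x in lborel. x \<notin> cbox a b - box a b"
    proof (rule AE_not_in)
      have "cbox a b - box a b \<in> null_sets lebesgue"
        using negligible_frontier_interval[of a b] by (simp add: negligible_iff_null_sets frontier_cbox)
      then show "cbox a b - box a b \<in> null_sets lborel"
        by (auto simp: null_sets_def)
    qed
    ultimately show ?thesis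
      by eventually_elim (auto simp: ab indicator_def split: if_splits)
  qed
  then have "AE x in lborel. \<forall>X\<in>\<D>. x \<in> X \<longrightarrow> f x = 0"
    by (subst AE_ball_countable[OF \<D>(1)]) blast
  then show ?thesis
    by eventually_elim (use \<D>(4) in auto)
qed

section \<open>Lebesgue integrals under translation and dilation, and integrals of
  derivatives\<close>

lemma lborel_integral_translate:
  fixes f :: "'a::euclidean_space \<Rightarrow> real"
  assumes f: "f \<in> borel_measurable borel"
  shows "(LINT x|lborel. f (c + x)) = (LINT x|lborel. f x)"
  using integral_distr[of "(+) c" "lborel::'a measure" borel f] f lborel_distr_plus[of c]
  by simp

lemma lborel_nn_integral_translate:
  fixes f :: "'a::euclidean_space \<Rightarrow> ennreal"
  assumes f: "f \<in> borel_measurable borel"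
  shows "(\<integral>\<^sup>+x. f (c + x) \<partial>lborel) = (\<integral>\<^sup>+x. f x \<partial>lborel)"
  using nn_integral_distr[of "(+) c" "lborel::'a measure" borel f] f lborel_distr_plus[of c]
  by simp

lemma lborel_integrable_translate:
  fixes f :: "'a::euclidean_space \<Rightarrow> real"
  assumes f: "integrable lborel f"
  shows "integrable lborel (\<lambda>x. f (c + x))"
  using integrable_distr[of "(+) c" "lborel::'a measure" borel f] f lborel_distr_plus[of c]
  by simp

lemma lborel_nn_integral_scale:
  fixes f :: "'a::euclidean_space \<Rightarrow> ennreal"
  assumes f[measurable]: "f \<in> borel_measurable borel" and c: "c \<noteq> 0"
  shows "(\<integral>\<^sup>+x. f (c *\<^sub>R x) \<partial>lborel) = ennreal (1 / \<bar>c\<bar> ^ DIM('a)) * (\<integral>\<^sup>+x. f x \<partial>lborel)"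
proof -
  have "(\<integral>\<^sup>+x. f x \<partial>lborel) = (\<integral>\<^sup>+x. f x \<partial>density (distr lborel borel (\<lambda>x. 0 + c *\<^sub>R x)) (\<lambda>_. \<bar>c\<bar> ^ DIM('a)))"
    by (subst lborel_affine[OF c, of 0]) simp
  also have "\<dots> = ennreal (\<bar>c\<bar> ^ DIM('a)) * (\<integral>\<^sup>+x. f (c *\<^sub>R x) \<partial>lborel)"
    by (simp add: nn_integral_density nn_integral_distr nn_integral_cmult)
  finally have "ennreal (1 / \<bar>c\<bar> ^ DIM('a)) * (\<integral>\<^sup>+x. f x \<partial>lborel)
      = ennreal (1 / \<bar>c\<bar> ^ DIM('a)) * ennreal (\<bar>c\<bar> ^ DIM('a)) * (\<integral>\<^sup>+x. f (c *\<^sub>R x) \<partial>lborel)"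
    by (simp add: mult.assoc)
  then show ?thesis using c by (simp add: ennreal_mult[symmetric])
qed

lemma lborel_integral_scale:
  fixes f :: "'a::euclidean_space \<Rightarrow> real"
  assumes f[measurable]: "f \<in> borel_measurable borel" and c: "c \<noteq> 0"
  shows "(LINT x|lborel. f (c *\<^sub>R x)) = (1 / \<bar>c\<bar> ^ DIM('a)) * (LINT x|lborel. f x)"
proof -
  have "(LINT x|lborel. f x) = (LINT x|density (distr lborel borel (\<lambda>x. 0 + c *\<^sub>R x)) (\<lambda>_. ennreal (\<bar>c\<bar> ^ DIM('a))). f x)"
    by (subst lborel_affine[OF c, of 0]) simp
  also have "\<dots> = (\<bar>c\<bar> ^ DIM('a)) * (LINT x|lborel. f (c *\<^sub>R x))"
    by (subst integral_real_density) (auto simp: integral_distr)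
  finally show ?thesis using c by simp
qed

text \<open>By translation invariance the difference quotients in direction \<open>i\<close> have
  integral zero; they converge to the partial derivative and are dominated by the mean value
  theorem.\<close>

lemma integral_partial_deriv_zero:
  fixes F :: "real^'n::finite \<Rightarrow> real"
  assumes diff: "\<And>x. F differentiable (at x)" and cont: "continuous_on UNIV (partial_deriv i F)"
    and K: "compact K" and zero: "\<And>x. x \<notin> K \<Longrightarrow> F x = 0"
  shows "(LINT x|lborel. partial_deriv i F x) = 0"
proof -
  have FD: "(F has_derivative frechet_derivative F (at x)) (at x)" for x
    using diff by (simp add: frechet_derivative_works[symmetric])
  have Fc: "continuous_on UNIV F"
    using diff by (auto intro!: continuous_at_imp_continuous_on differentiable_imp_continuous_within)
  have [measurable]: "F \<in> borel_measurable borel" "partial_deriv i F \<in> borel_measurable borel"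
    using Fc cont by (auto intro: borel_measurable_continuous_onI)
  define e where "e = (axis i 1 :: real^'n)"
  have ne: "norm e = 1" by (simp add: e_def)
  define t where "t k = inverse (real (Suc k))" for k
  have t: "0 < t k" "t k \<le> 1" for k by (auto simp: t_def field_simps)
  have line: "((\<lambda>s. F (x + s *\<^sub>R e)) has_real_derivative partial_deriv i F (x + s *\<^sub>R e)) (at s)" for x s
  proof -
    interpret l: bounded_linear "frechet_derivative F (at (x + s *\<^sub>R e))"
      using FD by (rule has_derivative_bounded_linear)
    have "((\<lambda>s. x + s *\<^sub>R e) has_derivative (\<lambda>h. h *\<^sub>R e)) (at s)"
      by (auto intro!: derivative_eq_intros)
    from has_derivative_compose[OF this FD]
    have "((\<lambda>s. F (x + s *\<^sub>R e)) has_derivative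
        (\<lambda>h. frechet_derivative F (at (x + s *\<^sub>R e)) (h *\<^sub>R e))) (at s)" .
    moreover have "(\<lambda>h. frechet_derivative F (at (x + s *\<^sub>R e)) (h *\<^sub>R e)) = (*) (partial_deriv i F (x + s *\<^sub>R e))"
      by (rule ext) (simp add: l.scaleR partial_deriv_def flip: e_def)
    ultimately show ?thesis by (simp add: has_field_derivative_def)
  qed
  obtain R where R: "\<And>x. x \<in> K \<Longrightarrow> norm x \<le> R" using compact_imp_bounded[OF K] by (auto simp: bounded_iff)
  \<comment> \<open>The steps \<open>t k\<close> are at most \<open>1\<close>, so the difference
    quotients vanish beyond radius \<open>R + 1\<close>, and up to there the mean value theorem
    evaluates the derivative within radius \<open>R + 2\<close>.\<close>
  let ?B = "cball (0::real^'n) (R + 1)"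
  have "compact (partial_deriv i F ` cball 0 (R + 2))"
    by (rule compact_continuous_image) (auto intro: continuous_on_subset[OF cont])
  then obtain C where C: "\<And>x. norm x \<le> R + 2 \<Longrightarrow> \<bar>partial_deriv i F x\<bar> \<le> C"
    by (metis compact_imp_bounded bounded_iff imageI mem_cball_0 real_norm_def)
  define q where "q k x = (F (t k *\<^sub>R e + x) - F x) / t k" for k x
  have [measurable]: "q k \<in> borel_measurable borel" for k unfolding q_def by measurable
  have "(\<lambda>k. LINT x|lborel. q k x) \<longlonglongrightarrow> (LINT x|lborel. partial_deriv i F x)"
  proof (rule integral_dominated_convergence[where w = "\<lambda>x. indicator ?B x * C"])
    show "integrable lborel (\<lambda>x. indicator ?B x * C)"
      using emeasure_lborel_cball_finite[of "0::real^'n" "R + 1"]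
      by (intro integrable_mult_left integrable_real_indicator) auto
    show "AE x in lborel. (\<lambda>k. q k x) \<longlonglongrightarrow> partial_deriv i F x"
    proof (rule AE_I2)
      fix x
      have "((\<lambda>h. (F (x + h *\<^sub>R e) - F x) / h) \<longlongrightarrow> partial_deriv i F x) (at 0)"
        using line[of x 0] by (simp add: DERIV_def)
      moreover have "filterlim t (at 0) sequentially"
        unfolding t_def using LIMSEQ_inverse_real_of_nat
        by (auto simp: filterlim_at intro!: always_eventually)
      ultimately have "(\<lambda>k. (F (x + t k *\<^sub>R e) - F x) / t k) \<longlonglongrightarrow> partial_deriv i F x"
        by (rule filterlim_compose)
      then show "(\<lambda>k. q k x) \<longlonglongrightarrow> partial_deriv i F x" by (simp add: q_def add.commute)
    qed
    show "AE x in lborel. norm (q k x) \<le> indicator ?B x * C" for k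
    proof (rule AE_I2)
      fix x
      show "norm (q k x) \<le> indicator ?B x * C"
      proof (cases "norm x \<le> R + 1")
        case True
        obtain z where z: "0 < z" "z < t k" "F (x + t k *\<^sub>R e) - F (x + 0 *\<^sub>R e) = (t k - 0) * partial_deriv i F (x + z *\<^sub>R e)"
          using MVT2[OF t(1)[of k] line[of x]] by blast
        have "norm (x + z *\<^sub>R e) \<le> R + 2"
          using norm_triangle_ineq[of x "z *\<^sub>R e"] True z t(2)[of k] ne by simp
        then have "\<bar>partial_deriv i F (x + z *\<^sub>R e)\<bar> \<le> C" by (rule C)
        moreover have "q k x = partial_deriv i F (x + z *\<^sub>R e)"
          using z t(1)[of k] by (simp add: q_def add.commute)
        ultimately show ?thesis using True by simp
      next
        case False
        have "norm (t k *\<^sub>R e + x) > R"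
          using norm_triangle_ineq2[of x "- (t k *\<^sub>R e)"] False t[of k] ne by (simp add: add.commute)
        then have "t k *\<^sub>R e + x \<notin> K" "x \<notin> K" using R False by force+
        then show ?thesis using False zero by (simp add: q_def)
      qed
    qed
  qed auto
  moreover have "(LINT x|lborel. q k x) = 0" for k
  proof -
    have FI: "integrable lborel F"
    proof -
      have "compact (F ` K)" by (rule compact_continuous_image[OF continuous_on_subset[OF Fc] K]) auto
      then obtain D where D: "\<And>x. x \<in> K \<Longrightarrow> \<bar>F x\<bar> \<le> D"
        by (metis compact_imp_bounded bounded_iff imageI real_norm_def)
      show ?thesis
      proof (rule Bochner_Integration.integrable_bound[of _ "\<lambda>x. indicator K x * D"])
        show "integrable lborel (\<lambda>x. indicator K x * D)"
          using borel_compact[OF K] emeasure_bounded_finite[OF compact_imp_bounded[OF K]] by (intro integrable_mult_left integrable_real_indicator) auto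
        show "AE x in lborel. norm (F x) \<le> norm (indicator K x * D)"
          using D zero by (intro AE_I2) (force simp: indicator_def)
      qed auto
    qed
    have "(LINT x|lborel. q k x) = ((LINT x|lborel. F (t k *\<^sub>R e + x)) - (LINT x|lborel. F x)) / t k"
      unfolding q_def using FI lborel_integrable_translate[OF FI] by simp
    then show ?thesis by (simp add: lborel_integral_translate)
  qed
  ultimately show ?thesis by (simp add: LIMSEQ_const_iff)
qed

subsection \<open>Weak partial derivatives\<close>

text \<open>Both functions are Borel on the whole space and integrable over \<open>S\<close>, so
  that Fubini's theorem and substitutions need no passage to representatives. Test functions vanish
  off \<open>S\<close>, so the integrals over the whole space only see the values on
  \<open>S\<close>.\<close>

definition wpart :: "(real^'n::finite) set \<Rightarrow> 'n \<Rightarrow> (real^'n \<Rightarrow> real) \<Rightarrow> (real^'n \<Rightarrow> real) \<Rightarrow> bool" where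
  "wpart S i g g' \<longleftrightarrow> g \<in> borel_measurable borel \<and> g' \<in> borel_measurable borel \<and>
     set_integrable lborel S g \<and> set_integrable lborel S g' \<and>
     (\<forall>\<phi>\<in>test_functions S.
        (LINT x|lborel. g x * partial_deriv i \<phi> x) = - (LINT x|lborel. g' x * \<phi> x))"

lemma integrable_mult_test:
  fixes g :: "real^'n::finite \<Rightarrow> real"
  assumes g: "set_integrable lborel S g" and \<phi>: "\<phi> \<in> test_functions S"
  shows "integrable lborel (\<lambda>x. g x * \<phi> x)"
proof -
  obtain B where B: "B \<ge> 0" "\<And>x. \<bar>\<phi> x\<bar> \<le> B" using test_bounded[OF \<phi>] by auto
  have gS: "integrable lborel (\<lambda>x. indicator S x * g x)" using g by (simp add: set_integrable_def)
  note [measurable] = borel_measurable_integrable[OF gS] test_measurable[OF \<phi>]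
  have "integrable lborel (\<lambda>x. indicator S x * g x * \<phi> x)"
  proof (rule Bochner_Integration.integrable_bound)
    show "integrable lborel (\<lambda>x. B * (indicator S x * g x))" using gS by simp
    show "AE x in lborel. norm (indicator S x * g x * \<phi> x) \<le> norm (B * (indicator S x * g x))"
      using B by (intro AE_I2) (auto simp: abs_mult mult.commute intro!: mult_right_mono)
  qed auto
  moreover have "indicator S x * g x * \<phi> x = g x * \<phi> x" for x
    using test_zero[OF \<phi>] by (auto simp: indicator_def)
  ultimately show ?thesis by simp
qed

text \<open>Supplies the joint integrability for exchanging the segment parameter \<open>t\<close>
  with \<open>x\<close>: the slices all have the same \<open>L1\<close> norm by translation
  invariance, and \<open>t\<close> runs over a unit interval.\<close>

lemma integrable_translation_product:
  fixes F :: "real^'n::finite \<Rightarrow> real"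
  assumes F: "integrable lborel F" "F \<in> borel_measurable borel"
    and b: "case_prod b \<in> borel_measurable (borel \<Otimes>\<^sub>M borel)" "\<And>t x. \<bar>b t x\<bar> \<le> C"
  shows "integrable (lborel \<Otimes>\<^sub>M lborel) (\<lambda>(t::real, x). indicator {0..1} t * (F (t *\<^sub>R w + x) * b t x))"
proof -
  note [measurable] = F(2) b(1)
  have "C \<ge> 0" using b(2)[of undefined undefined] by linarith
  have bt: "b t \<in> borel_measurable borel" for t
    using measurable_Pair2[OF b(1), of t] by simp
  have H1: "integrable (lborel \<Otimes>\<^sub>M lborel) (\<lambda>p::real \<times> (real^'n). indicator {0..1} (fst p) * F (fst p *\<^sub>R w + snd p))"
  proof (rule lborel_pair.Fubini_integrable)
    have "(LINT y|lborel. norm (indicator {0..1} (fst (x, y)) * F (fst (x, y) *\<^sub>R w + snd (x, y))))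
        = indicator {0..1} x * (LINT y|lborel. \<bar>F y\<bar>)" for x
      using lborel_integral_translate[of "\<lambda>y. \<bar>F y\<bar>" "x *\<^sub>R w"] by (simp add: abs_mult)
    moreover have "integrable lborel (\<lambda>x::real. indicator {0..1} x * (LINT y|lborel. \<bar>F y\<bar>))"
      by (intro integrable_mult_left integrable_real_indicator) auto
    ultimately show "integrable lborel (\<lambda>x. LINT y|lborel. norm (indicator {0..1} (fst (x, y)) * F (fst (x, y) *\<^sub>R w + snd (x, y))))"
      by simp
    show "AE x in lborel. integrable lborel (\<lambda>y. indicator {0..1} (fst (x, y)) * F (fst (x, y) *\<^sub>R w + snd (x, y)))"
      using lborel_integrable_translate[OF F(1)] by simp
  qed measurable
  show ?thesis
  proof (rule Bochner_Integration.integrable_bound)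
    show "integrable (lborel \<Otimes>\<^sub>M lborel) (\<lambda>p::real \<times> (real^'n). C * (indicator {0..1} (fst p) * F (fst p *\<^sub>R w + snd p)))"
      using H1 by simp
    show "AE p in lborel \<Otimes>\<^sub>M lborel. norm (case p of (t::real, x) \<Rightarrow> indicator {0..1} t * (F (t *\<^sub>R w + x) * b t x))
        \<le> norm (C * (indicator {0..1} (fst p) * F (fst p *\<^sub>R w + snd p)))"
      using b(2) \<open>C \<ge> 0\<close>
      by (intro AE_I2) (auto simp: abs_mult mult.commute indicator_def intro!: mult_right_mono)
  qed measurable
qed

text \<open>The complement is the Minkowski difference of a closed set and a compact segment, hence
  closed.\<close>

lemma open_segment_translates:
  fixes S :: "'a::euclidean_space set"
  assumes "open S"
  shows "open {x. \<forall>t\<in>{0..1}. x + t *\<^sub>R w \<in> S}"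
proof -
  have "{x. \<forall>t\<in>{0..1}. x + t *\<^sub>R w \<in> S} = - ((\<lambda>(z, t). z - t *\<^sub>R w) ` ((- S) \<times> {0..1}))"
    by (force simp: image_iff)
  moreover have "(\<lambda>(z, t). z - t *\<^sub>R w) ` ((- S) \<times> {0..1}) = (\<Union>x\<in>- S. \<Union>y\<in>(\<lambda>t. t *\<^sub>R w) ` {0..1::real}. {x - y})"
    by auto
  moreover have "closed (\<Union>x\<in>- S. \<Union>y\<in>(\<lambda>t. t *\<^sub>R w) ` {0..1::real}. {x - y})"
    using assms by (intro closed_compact_differences compact_continuous_image continuous_intros) auto
  ultimately show ?thesis by (simp add: open_closed)
qed

text \<open>This is the fundamental theorem of calculus along the segment \<open>w\<close>, first in
  integrated form: tested against \<open>\<phi>\<close>, each translate of the weak derivative is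
  moved onto \<open>\<phi>\<close>, where the classical one-dimensional theorem applies. Since
  \<open>A\<close> is open, the fundamental lemma turns this into an identity almost everywhere on
  \<open>A\<close>.\<close>

lemma wpart_line_integral:
  fixes S :: "(real^'n::finite) set" and w :: "real^'n" and G :: "'n \<Rightarrow> real^'n \<Rightarrow> real"
  assumes S: "open S" and G: "\<And>i. wpart S i g (G i)"
  defines "A \<equiv> {x. \<forall>t\<in>{0..1}. x + t *\<^sub>R w \<in> S}"
    and "GG \<equiv> \<lambda>y. indicator S y * (\<Sum>i\<in>UNIV. w $ i * G i y)"
  shows "AE x in lborel. x \<in> A \<longrightarrow> g (x + w) - g x = (LINT t:{0..1}|lborel. GG (t *\<^sub>R w + x))"
proof -
  have S'[measurable]: "S \<in> sets borel" using S by auto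
  have [measurable]: "g \<in> borel_measurable borel" "G i \<in> borel_measurable borel" for i
    using G by (auto simp: wpart_def)
  define gS where "gS x = indicator S x * g x" for x
  \<comment> \<open>Any direction serves here: the index type is nonempty, and every
    \<open>wpart\<close> statement contains the integrability of \<open>g\<close>.\<close>
  have gS: "integrable lborel gS" using G[of undefined] by (simp add: wpart_def set_integrable_def gS_def[abs_def])
  have [measurable]: "gS \<in> borel_measurable borel" unfolding gS_def by measurable
  have GG: "integrable lborel GG"
  proof -
    have "integrable lborel (\<lambda>y. \<Sum>i\<in>UNIV. w $ i * (indicator S y * G i y))"
      using G by (intro Bochner_Integration.integrable_sum integrable_mult_right) (simp add: wpart_def set_integrable_def)
    then show ?thesis by (simp add: GG_def sum_distrib_left mult.left_commute)
  qed
  have GGm[measurable]: "GG \<in> borel_measurable borel" unfolding GG_def by measurable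
  define T where "T x = (LINT t:{0..1}|lborel. GG (t *\<^sub>R w + x))" for x
  have TH: "integrable (lborel \<Otimes>\<^sub>M lborel) (\<lambda>(t::real, x). indicator {0..1} t * (GG (t *\<^sub>R w + x) * 1))"
    by (rule integrable_translation_product[OF GG, where C = 1]) auto
  have T: "integrable lborel T"
    using lborel_pair.integrable_snd[OF TH] by (simp add: T_def[abs_def] set_lebesgue_integral_def)
  have [measurable]: "T \<in> borel_measurable borel" using T by auto
  define f where "f x = gS (w + x) - gS x - T x" for x
  have f: "integrable lborel f"
    unfolding f_def using gS T lborel_integrable_translate[OF gS] by (intro Bochner_Integration.integrable_diff)
  have A: "open A" unfolding A_def by (rule open_segment_translates[OF S])
  have "AE x in lborel. x \<in> A \<longrightarrow> f x = 0"
  proof (rule fundamental_lemma[OF A])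
    show "set_integrable lborel (cbox a b) f" for a b
      using integrable_mult_indicator[OF _ f, of "cbox a b"] by (simp add: set_integrable_def)
    fix \<phi> assume \<phi>: "\<phi> \<in> test_functions A"
    note [measurable] = test_measurable[OF \<phi>] test_measurable[OF test_partial[OF \<phi>]]
    have subA: "\<And>x. x \<in> closure {x. \<phi> x \<noteq> 0} \<Longrightarrow> x \<in> A" using test_subset[OF \<phi>] by auto
    \<comment> \<open>The translate by \<open>t *\<^sub>R w\<close> is again a test function on
      \<open>S\<close> because the support lies in \<open>A\<close>, whose points keep the whole
      segment inside \<open>S\<close>.\<close>
    have shift: "(\<lambda>x. \<phi> (- (t *\<^sub>R w) + 1 *\<^sub>R x)) \<in> test_functions S" if "t \<in> {0..1}" for t
    proof (rule test_affine[OF \<phi>])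
      fix x assume "- (t *\<^sub>R w) + 1 *\<^sub>R x \<in> closure {x. \<phi> x \<noteq> 0}"
      then have "- (t *\<^sub>R w) + x \<in> A" using subA by simp
      then show "x \<in> S" using that by (auto simp: A_def dest: bspec[of _ _ t])
    qed simp
    define D where "D x = (\<Sum>i\<in>UNIV. w $ i * partial_deriv i \<phi> x)" for x
    have Dm[measurable]: "D \<in> borel_measurable borel" unfolding D_def by measurable
    have Dc: "continuous_on UNIV D" unfolding D_def
      by (intro continuous_intros test_continuous[OF test_partial[OF \<phi>]])
    have "\<exists>C. \<forall>x. \<bar>D x\<bar> \<le> C"
    proof -
      have "\<forall>i. \<exists>C. \<forall>x. \<bar>partial_deriv i \<phi> x\<bar> \<le> C" using test_bounded[OF test_partial[OF \<phi>]] by meson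
      then obtain C where C: "\<And>i x. \<bar>partial_deriv i \<phi> x\<bar> \<le> C i" by metis
      have "\<bar>D x\<bar> \<le> (\<Sum>i\<in>UNIV. \<bar>w $ i\<bar> * C i)" for x
        unfolding D_def by (intro order_trans[OF sum_abs] sum_mono) (simp add: abs_mult mult_left_mono C)
      then show ?thesis by blast
    qed
    then obtain C where C: "\<And>x. \<bar>D x\<bar> \<le> C" by blast
    obtain C' where C': "\<And>x. \<bar>\<phi> x\<bar> \<le> C'" using test_bounded[OF \<phi>] by blast
    have slice: "(LINT x|lborel. GG (t *\<^sub>R w + x) * \<phi> x) = - (LINT y|lborel. gS y * D (- (t *\<^sub>R w) + y))"
      if t: "t \<in> {0..1}" for t
    proof -
      let ?\<psi> = "\<lambda>x. \<phi> (- (t *\<^sub>R w) + x)"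
      have \<psi>: "?\<psi> \<in> test_functions S" using shift[OF t] by simp
      have d\<psi>: "partial_deriv i ?\<psi> y = partial_deriv i \<phi> (- (t *\<^sub>R w) + y)" for i y
        using partial_deriv_affine[where f = \<phi> and b = "- (t *\<^sub>R w)" and c = 1 and x = y and i = i, OF test_differentiable[OF \<phi>]] by simp
      have "(LINT x|lborel. GG (t *\<^sub>R w + x) * \<phi> x) = (LINT x|lborel. GG (t *\<^sub>R w + x) * ?\<psi> (t *\<^sub>R w + x))" by simp
      also have "\<dots> = (LINT y|lborel. GG y * ?\<psi> y)"
        by (rule lborel_integral_translate) measurable
      also have "\<dots> = (LINT y|lborel. (\<Sum>i\<in>UNIV. w $ i * (G i y * ?\<psi> y)))"
        using test_zero[OF \<psi>]
        by (intro Bochner_Integration.integral_cong refl) (auto simp: GG_def indicator_def sum_distrib_right mult.assoc)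
      also have "\<dots> = (\<Sum>i\<in>UNIV. w $ i * (LINT y|lborel. G i y * ?\<psi> y))"
        using G \<psi> by (subst Bochner_Integration.integral_sum)
          (auto intro!: integrable_mult_right integrable_mult_test simp: wpart_def)
      also have "\<dots> = (\<Sum>i\<in>UNIV. - (w $ i * (LINT y|lborel. g y * partial_deriv i ?\<psi> y)))"
        using G \<psi> by (intro sum.cong refl) (auto simp: wpart_def)
      also have "\<dots> = - (\<Sum>i\<in>UNIV. w $ i * (LINT y|lborel. g y * partial_deriv i ?\<psi> y))"
        by (simp add: sum_negf)
      also have "(\<Sum>i\<in>UNIV. w $ i * (LINT y|lborel. g y * partial_deriv i ?\<psi> y)) = (LINT y|lborel. (\<Sum>i\<in>UNIV. w $ i * (g y * partial_deriv i ?\<psi> y)))"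
        using G[unfolded wpart_def] test_partial[OF \<psi>] by (subst Bochner_Integration.integral_sum)
          (auto intro!: integrable_mult_right integrable_mult_test[where S = S])
      also have "\<dots> = (LINT y|lborel. gS y * D (- (t *\<^sub>R w) + y))"
        using test_zero[OF test_partial[OF \<psi>]] unfolding d\<psi>
        by (intro Bochner_Integration.integral_cong refl)
          (auto simp: gS_def D_def indicator_def sum_distrib_left mult_ac)
      finally show ?thesis .
    qed
    have H1: "integrable (lborel \<Otimes>\<^sub>M lborel) (\<lambda>(t::real, x). indicator {0..1} t * (GG (t *\<^sub>R w + x) * \<phi> x))"
      by (rule integrable_translation_product[OF GG GGm _ C']) measurable
    \<comment> \<open>The zero shift \<open>t *\<^sub>R 0\<close> fits this integrand to the same
      lemma; the translation now sits in the bounded factor \<open>D\<close>.\<close>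
    have H2: "integrable (lborel \<Otimes>\<^sub>M lborel) (\<lambda>(t::real, x). indicator {0..1} t * (gS (t *\<^sub>R 0 + x) * D (- (t *\<^sub>R w) + x)))"
      by (rule integrable_translation_product[OF gS _ _ C]) measurable
    have "(LINT x|lborel. T x * \<phi> x) = (LINT x|lborel. LINT t|lborel. indicator {0..1} t * (GG (t *\<^sub>R w + x) * \<phi> x))"
      by (simp add: T_def set_lebesgue_integral_def mult.assoc[symmetric])
    also have "\<dots> = (LINT t|lborel. LINT x|lborel. indicator {0..1} t * (GG (t *\<^sub>R w + x) * \<phi> x))"
      by (rule lborel_pair.Fubini_integral[OF H1])
    also have "\<dots> = (LINT t|lborel. - (LINT y|lborel. indicator {0..1} t * (gS (t *\<^sub>R 0 + y) * D (- (t *\<^sub>R w) + y))))"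
      by (intro Bochner_Integration.integral_cong refl) (simp add: indicator_def slice)
    also have "\<dots> = - (LINT y|lborel. LINT t|lborel. indicator {0..1} t * (gS (t *\<^sub>R 0 + y) * D (- (t *\<^sub>R w) + y)))"
      using lborel_pair.Fubini_integral[OF H2] by simp
    also have "\<dots> = - (LINT y|lborel. gS y * (\<phi> y - \<phi> (- w + y)))"
    proof -
      have "(LINT t|lborel. indicator {0..1} t * (gS (t *\<^sub>R 0 + y) * D (- (t *\<^sub>R w) + y))) = gS y * (\<phi> y - \<phi> (- w + y))" for y
      proof -
        have line: "((\<lambda>t. - \<phi> (- (t *\<^sub>R w) + y)) has_real_derivative D (- (t *\<^sub>R w) + y)) (at t)" for t
        proof -
          let ?L = "frechet_derivative \<phi> (at (- (t *\<^sub>R w) + y))"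
          have L: "(\<phi> has_derivative ?L) (at (- (t *\<^sub>R w) + y))"
            by (rule test_has_derivative[OF \<phi>])
          interpret l: bounded_linear ?L using L by (rule has_derivative_bounded_linear)
          have "((\<lambda>t. - (t *\<^sub>R w) + y) has_derivative (\<lambda>h. - (h *\<^sub>R w))) (at t)"
            by (auto intro!: derivative_eq_intros)
          from has_derivative_minus[OF has_derivative_compose[OF this L]]
          have "((\<lambda>t. - \<phi> (- (t *\<^sub>R w) + y)) has_derivative (\<lambda>h. - ?L (- (h *\<^sub>R w)))) (at t)" .
          moreover have "(\<lambda>h. - ?L (- (h *\<^sub>R w))) = (*) (D (- (t *\<^sub>R w) + y))"
            by (rule ext) (simp add: l.scaleR l.neg frechet_derivative_sum_partial[OF \<phi>] D_def sum_negf sum_distrib_left mult_ac)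
          ultimately show ?thesis by (simp add: has_field_derivative_def)
        qed
        have cont: "isCont (\<lambda>t. D (- (t *\<^sub>R w) + y)) t" for t
        proof -
          have "continuous_on UNIV (\<lambda>t. D (- (t *\<^sub>R w) + y))"
            by (rule continuous_on_compose2[OF Dc]) (auto intro!: continuous_intros)
          then show ?thesis by (simp add: continuous_on_eq_continuous_at)
        qed
        have "(LINT t|lborel. D (- (t *\<^sub>R w) + y) * indicator {0..1} t) = - \<phi> (- (1 *\<^sub>R w) + y) - - \<phi> (- (0 *\<^sub>R w) + y)"
          by (rule integral_FTC_Icc_real[OF _ line cont]) simp
        then have "(LINT t|lborel. gS y * (D (- (t *\<^sub>R w) + y) * indicator {0..1} t)) = gS y * (\<phi> y - \<phi> (- w + y))"
          by simp
        then show ?thesis by (simp add: mult_ac)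
      qed
      then show ?thesis by simp
    qed
    also have "\<dots> = (LINT y|lborel. gS y * \<phi> (- w + y)) - (LINT y|lborel. gS y * \<phi> y)"
    proof -
      have sA: "set_integrable lborel UNIV gS" using gS by (simp add: set_integrable_def)
      have "(\<lambda>x. \<phi> (- w + 1 *\<^sub>R x)) \<in> test_functions UNIV" "\<phi> \<in> test_functions UNIV"
        using shift[of 1] \<phi> test_functions_mono[of _ UNIV] by auto
      then show ?thesis
        using integrable_mult_test[OF sA] by (simp add: right_diff_distrib)
    qed
    also have "(LINT y|lborel. gS y * \<phi> (- w + y)) = (LINT x|lborel. gS (w + x) * \<phi> x)"
      using lborel_integral_translate[of "\<lambda>y. gS y * \<phi> (- w + y)" w] by simp
    finally have eq: "(LINT x|lborel. T x * \<phi> x) = (LINT x|lborel. gS (w + x) * \<phi> x) - (LINT x|lborel. gS x * \<phi> x)" .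
    have int: "integrable lborel (\<lambda>x. h x * \<phi> x)" if "integrable lborel h" for h
      using that \<phi> test_functions_mono[of A UNIV] by (intro integrable_mult_test[of UNIV]) (auto simp: set_integrable_def)
    have "(LINT x|lborel. f x * \<phi> x) = (LINT x|lborel. gS (w + x) * \<phi> x - gS x * \<phi> x - T x * \<phi> x)"
      by (simp add: f_def left_diff_distrib)
    also have "\<dots> = (LINT x|lborel. gS (w + x) * \<phi> x) - (LINT x|lborel. gS x * \<phi> x) - (LINT x|lborel. T x * \<phi> x)"
      using int[OF lborel_integrable_translate[OF gS]] int[OF gS] int[OF T] by simp
    finally show "(LINT x|lborel. f x * \<phi> x) = 0" using eq by simp
  qed
  then show ?thesis
  proof eventually_elim
    case (elim x)
    show ?case
    proof
      assume x: "x \<in> A"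
      then have "x \<in> S" "x + w \<in> S" by (auto simp: A_def dest: bspec[of _ _ 0] bspec[of _ _ 1])
      with elim x show "g (x + w) - g x = (LINT t:{0..1}|lborel. GG (t *\<^sub>R w + x))"
        by (simp add: f_def gS_def T_def add.commute)
    qed
  qed
qed

text \<open>Cauchy-Schwarz on the unit interval, obtained from the nonnegativity of the variance.
  With the right-hand side in the extended reals, the case of infinite value is trivial and
  finiteness gives the integrability used in the other case.\<close>

lemma integral_square_le_nn_integral:
  fixes h :: "real \<Rightarrow> real"
  assumes [measurable]: "h \<in> borel_measurable borel"
  shows "ennreal ((LINT t:{0..1}|lborel. h t)\<^sup>2) \<le> (\<integral>\<^sup>+t\<in>{0..1}. ennreal ((h t)\<^sup>2) \<partial>lborel)"
proof (cases "(\<integral>\<^sup>+t\<in>{0..1}. ennreal ((h t)\<^sup>2) \<partial>lborel) = \<infinity>")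
  case False
  define M where "M = restrict_space lborel {0..1::real}"
  have eM: "emeasure M (space M) = 1" "measure M (space M) = 1"
    by (auto simp: M_def emeasure_restrict_space measure_def space_restrict_space)
  have [measurable]: "h \<in> borel_measurable M" unfolding M_def by (rule measurable_restrict_space1) simp
  have "(\<integral>\<^sup>+t. ennreal ((h t)\<^sup>2) \<partial>M) = (\<integral>\<^sup>+t\<in>{0..1}. ennreal ((h t)\<^sup>2) \<partial>lborel)"
    unfolding M_def by (subst nn_integral_restrict_space) auto
  then have fin: "(\<integral>\<^sup>+t. ennreal ((h t)\<^sup>2) \<partial>M) < \<infinity>" using False by (simp add: less_top)
  then have h2: "integrable M (\<lambda>t. (h t)\<^sup>2)"
    by (intro integrableI_bounded) auto
  interpret M: finite_measure M by (rule finite_measureI) (simp add: eM)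
  have h1: "integrable M h"
  proof (rule Bochner_Integration.integrable_bound)
    show "integrable M (\<lambda>t. 1 + (h t)\<^sup>2)" using h2 by simp
    show "AE t in M. norm (h t) \<le> norm (1 + (h t)\<^sup>2)"
    proof (rule AE_I2)
      fix t
      have "0 \<le> (\<bar>h t\<bar> - 1)\<^sup>2" by simp
      then show "norm (h t) \<le> norm (1 + (h t)\<^sup>2)" by (simp add: power2_eq_square algebra_simps)
    qed
  qed auto
  define a where "a = (LINT t|M. h t)"
  have "0 \<le> (LINT t|M. (h t - a)\<^sup>2)" by simp
  also have "\<dots> = (LINT t|M. (h t)\<^sup>2 - 2 * a * h t + a\<^sup>2)"
    by (simp add: power2_eq_square algebra_simps)
  also have "\<dots> = (LINT t|M. (h t)\<^sup>2) - a\<^sup>2"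
    using h1 h2 by (simp add: a_def[symmetric] eM power2_eq_square)
  finally have "a\<^sup>2 \<le> (LINT t|M. (h t)\<^sup>2)" by simp
  then have "ennreal (a\<^sup>2) \<le> ennreal (LINT t|M. (h t)\<^sup>2)" by (rule ennreal_leI)
  also have "\<dots> = (\<integral>\<^sup>+t. ennreal ((h t)\<^sup>2) \<partial>M)"
    using h2 by (intro nn_integral_eq_integral[symmetric]) auto
  also have "a = (LINT t:{0..1}|lborel. h t)"
    unfolding a_def M_def set_lebesgue_integral_def by (subst integral_restrict_space) auto
  finally show ?thesis
    unfolding M_def by (subst (asm) nn_integral_restrict_space) auto
qed auto

text \<open>The line integral is squared with Cauchy-Schwarz in \<open>t\<close> and then in the
  coordinates; after exchanging the integrals, translation invariance in \<open>x\<close> makes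
  every slice cost the same.\<close>

lemma wpart_translation_estimate:
  fixes S :: "(real^'n::finite) set"
  assumes S: "open S" and G: "\<And>i. wpart S i g (G i)"
  shows "(\<integral>\<^sup>+x\<in>{x. \<forall>t\<in>{0..1}. x + t *\<^sub>R w \<in> S}. ennreal ((g (x + w) - g x)\<^sup>2) \<partial>lborel)
    \<le> ennreal ((norm w)\<^sup>2) * (\<Sum>i\<in>UNIV. \<integral>\<^sup>+x\<in>S. ennreal ((G i x)\<^sup>2) \<partial>lborel)"
proof -
  have S'[measurable]: "S \<in> sets borel" using S by auto
  have [measurable]: "g \<in> borel_measurable borel" "G i \<in> borel_measurable borel" for i
    using G by (auto simp: wpart_def)
  define GG where "GG = (\<lambda>y. indicator S y * (\<Sum>i\<in>UNIV. w $ i * G i y))"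
  have [measurable]: "GG \<in> borel_measurable borel" unfolding GG_def by measurable
  have "(\<integral>\<^sup>+x\<in>{x. \<forall>t\<in>{0..1}. x + t *\<^sub>R w \<in> S}. ennreal ((g (x + w) - g x)\<^sup>2) \<partial>lborel)
      \<le> (\<integral>\<^sup>+x. ennreal ((LINT t:{0..1}|lborel. GG (t *\<^sub>R w + x))\<^sup>2) \<partial>lborel)"
  proof (rule nn_integral_mono_AE)
    have "AE x in lborel. x \<in> {x. \<forall>t\<in>{0..1}. x + t *\<^sub>R w \<in> S} \<longrightarrow>
        g (x + w) - g x = (LINT t:{0..1}|lborel. GG (t *\<^sub>R w + x))"
      unfolding GG_def by (rule wpart_line_integral[OF S G])
    then show "AE x in lborel. ennreal ((g (x + w) - g x)\<^sup>2) * indicator {x. \<forall>t\<in>{0..1}. x + t *\<^sub>R w \<in> S} x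
        \<le> ennreal ((LINT t:{0..1}|lborel. GG (t *\<^sub>R w + x))\<^sup>2)"
    proof eventually_elim
      case (elim x)
      then show ?case
        by (cases "x \<in> {x. \<forall>t\<in>{0..1}. x + t *\<^sub>R w \<in> S}") (simp_all only: indicator_simps mult_zero_right mult_1_right simp_thms zero_le)
    qed
  qed
  also have "\<dots> \<le> (\<integral>\<^sup>+x. (\<integral>\<^sup>+t\<in>{0..1}. ennreal ((GG (t *\<^sub>R w + x))\<^sup>2) \<partial>lborel) \<partial>lborel)"
    by (intro nn_integral_mono integral_square_le_nn_integral) measurable
  also have "\<dots> = (\<integral>\<^sup>+t. (\<integral>\<^sup>+x. ennreal ((GG (t *\<^sub>R w + x))\<^sup>2) * indicator {0..1} t \<partial>lborel) \<partial>lborel)"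
    by (rule lborel_pair.Fubini') measurable
  also have "\<dots> = (\<integral>\<^sup>+t. (\<integral>\<^sup>+x. ennreal ((GG x)\<^sup>2) \<partial>lborel) * indicator {0..1} (t::real) \<partial>lborel)"
    using lborel_nn_integral_translate[of "\<lambda>x. ennreal ((GG x)\<^sup>2)"]
    by (simp add: nn_integral_multc)
  also have "\<dots> = (\<integral>\<^sup>+x. ennreal ((GG x)\<^sup>2) \<partial>lborel)"
    by (simp add: nn_integral_cmult)
  also have "\<dots> \<le> (\<integral>\<^sup>+x. (\<Sum>i\<in>UNIV. ennreal ((norm w)\<^sup>2) * (ennreal ((G i x)\<^sup>2) * indicator S x)) \<partial>lborel)"
  proof (rule nn_integral_mono)
    fix x
    show "ennreal ((GG x)\<^sup>2) \<le> (\<Sum>i\<in>UNIV. ennreal ((norm w)\<^sup>2) * (ennreal ((G i x)\<^sup>2) * indicator S x))"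
    proof (cases "x \<in> S")
      case True
      have "(GG x)\<^sup>2 \<le> (\<Sum>i\<in>UNIV. (w $ i)\<^sup>2) * (\<Sum>i\<in>UNIV. (G i x)\<^sup>2)"
        using True Cauchy_Schwarz_ineq_sum[of "\<lambda>i. w $ i" "\<lambda>i. G i x" UNIV] by (simp add: GG_def)
      also have "(\<Sum>i\<in>UNIV. (w $ i)\<^sup>2) = (norm w)\<^sup>2"
        by (simp add: norm_vec_def L2_set_def sum_nonneg)
      finally have "ennreal ((GG x)\<^sup>2) \<le> ennreal (\<Sum>i\<in>UNIV. (norm w)\<^sup>2 * (G i x)\<^sup>2)"
        by (intro ennreal_leI) (simp add: sum_distrib_left)
      then show ?thesis using True by (simp add: sum_ennreal[symmetric] ennreal_mult)
    qed (simp add: GG_def)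
  qed
  also have "\<dots> = ennreal ((norm w)\<^sup>2) * (\<Sum>i\<in>UNIV. \<integral>\<^sup>+x\<in>S. ennreal ((G i x)\<^sup>2) \<partial>lborel)"
    by (subst nn_integral_sum) (auto simp: nn_integral_cmult sum_distrib_left)
  finally show ?thesis .
qed

subsection \<open>Slobodeckij seminorms\<close>

definition l2sq :: "(real^'n::finite) set \<Rightarrow> (real^'n \<Rightarrow> real) \<Rightarrow> ennreal" where
  "l2sq S g = (\<integral>\<^sup>+x\<in>S. ennreal ((g x)\<^sup>2) \<partial>lborel)"

text \<open>Squared differences weighted by a kernel in \<open>y - x\<close>. The singular kernel
  gives the Slobodeckij seminorm, the constant \<open>1\<close> the oscillation about the mean, and
  truncations of the singular kernel its near part.\<close>

definition dbl :: "(real^'n::finite) set \<Rightarrow> (real^'n \<Rightarrow> ennreal) \<Rightarrow> (real^'n \<Rightarrow> real) \<Rightarrow> ennreal" where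
  "dbl S K g = (\<integral>\<^sup>+x\<in>S. (\<integral>\<^sup>+y\<in>S. ennreal ((g x - g y)\<^sup>2) * K (y - x) \<partial>lborel) \<partial>lborel)"

definition slob :: "(real^'n::finite) set \<Rightarrow> real \<Rightarrow> (real^'n \<Rightarrow> real) \<Rightarrow> ennreal" where
  "slob S \<sigma> g = dbl S (\<lambda>z. ennreal (1 / norm z powr (real CARD('n) + 2 * \<sigma>))) g"

definition segment_in :: "'a::real_vector set \<Rightarrow> 'a \<Rightarrow> 'a \<Rightarrow> bool" where
  "segment_in S x w \<longleftrightarrow> (\<forall>t\<in>{0..1}. x + t *\<^sub>R w \<in> S)"

text \<open>The detour from \<open>x\<close> to \<open>x + z\<close> has length comparable to
  \<open>norm z\<close>, so it costs only a constant in the translation estimate. Finitely many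
  vectors \<open>w\<close> suffice near a compact boundary and keep sums over \<open>W\<close>
  finite; for convex sets \<open>W = {0}\<close> means that the chord itself is used.\<close>

definition chained :: "'a::real_normed_vector set \<Rightarrow> real \<Rightarrow> 'a set \<Rightarrow> bool" where
  "chained S \<delta> W \<longleftrightarrow> (\<forall>x\<in>S. \<forall>z. x + z \<in> S \<and> norm z < \<delta> \<longrightarrow>
     (\<exists>w\<in>W. segment_in S x (- (norm z *\<^sub>R w)) \<and> segment_in S (- (norm z *\<^sub>R w) + x) z \<and>
        segment_in S (z + x) (- (norm z *\<^sub>R w))))"

lemma dbl_mono: "(\<And>z. K z \<le> K' z) \<Longrightarrow> S \<subseteq> T \<Longrightarrow> dbl S K g \<le> dbl T K' g"
  unfolding dbl_def by (intro nn_integral_mono mult_mono) (auto simp: indicator_def)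

lemma l2sq_mono: "S \<subseteq> T \<Longrightarrow> l2sq S g \<le> l2sq T g"
  unfolding l2sq_def by (intro nn_integral_mono mult_mono) (auto simp: indicator_def)

lemma slob_mono: "S \<subseteq> T \<Longrightarrow> slob S \<sigma> g \<le> slob T \<sigma> g"
  unfolding slob_def by (rule dbl_mono) auto

lemma measurable_segment_in[measurable]:
  fixes S :: "(real^'n::finite) set"
  assumes "open S"
  shows "{x. segment_in S x w} \<in> sets borel"
  using open_segment_translates[OF assms, of w] by (simp add: segment_in_def)

lemma sum_three_squares_le:
  fixes a b c d :: real
  shows "(a - d)\<^sup>2 \<le> 3 * ((b - a)\<^sup>2 + (c - b)\<^sup>2 + (c - d)\<^sup>2)"
proof -
  define p q r where "p = b - a" "q = c - b" "r = c - d"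
  have "0 \<le> (p - q)\<^sup>2 + (p + r)\<^sup>2 + (q + r)\<^sup>2" by simp
  moreover have "(a - d)\<^sup>2 = (r - p - q)\<^sup>2" by (simp add: p_q_r_def)
  ultimately show ?thesis unfolding p_q_r_def[symmetric]
    by (simp add: power2_eq_square algebra_simps)
qed

text \<open>
  Along a chain \<open>x\<close>, \<open>x - |z| w\<close>, \<open>x + z - |z| w\<close>, \<open>x + z\<close> of segments in \<open>S\<close> the translation estimate applies to
  each of the three differences.
\<close>

lemma dbl_le_gradient:
  fixes S :: "(real^'n::finite) set"
  assumes S: "open S" and G: "\<And>i. wpart S i g (G i)" and W: "finite W" "chained S \<delta> W"
    and K[measurable]: "K \<in> borel_measurable borel" and K0: "\<And>z. norm z \<ge> \<delta> \<Longrightarrow> K z = 0"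
  shows "dbl S K g \<le> (\<Sum>w\<in>W. ennreal (3 * (1 + 2 * (norm w)\<^sup>2))) *
    (\<integral>\<^sup>+z. K z * ennreal ((norm z)\<^sup>2) \<partial>lborel) * (\<Sum>i\<in>UNIV. l2sq S (G i))"
proof -
  have [measurable]: "S \<in> sets borel" using S by auto
  have [measurable]: "g \<in> borel_measurable borel" using G by (auto simp: wpart_def)
  define E where "E = (\<Sum>i\<in>UNIV. l2sq S (G i))"
  define D where "D w x = ennreal ((g (x + w) - g x)\<^sup>2) * indicator {x. segment_in S x w} x" for w x
  have [measurable]: "D w \<in> borel_measurable borel" for w
    unfolding D_def using measurable_segment_in[OF S] by measurable
  have D: "(\<integral>\<^sup>+x. D w (v + x) \<partial>lborel) \<le> ennreal ((norm w)\<^sup>2) * E" for w v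
  proof -
    have "(\<integral>\<^sup>+x. D w (v + x) \<partial>lborel) = (\<integral>\<^sup>+x. D w x \<partial>lborel)"
      by (rule lborel_nn_integral_translate) measurable
    also have "\<dots> \<le> ennreal ((norm w)\<^sup>2) * E"
      using wpart_translation_estimate[OF S G, of w] by (simp only: D_def E_def l2sq_def segment_in_def)
    finally show ?thesis .
  qed
  have inner: "(\<integral>\<^sup>+x. ennreal ((g x - g (x + z))\<^sup>2) * K z * indicator S (x + z) * indicator S x \<partial>lborel)
      \<le> K z * ((\<Sum>w\<in>W. ennreal (3 * (1 + 2 * (norm w)\<^sup>2))) * ennreal ((norm z)\<^sup>2) * E)" for z
  proof (cases "norm z < \<delta>")
    case True
    let ?u = "\<lambda>w. - (norm z *\<^sub>R w)"
    let ?F = "\<lambda>w x. ennreal 3 * (D (?u w) (0 + x) + D z (?u w + x) + D (?u w) (z + x))"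
    have "(\<integral>\<^sup>+x. ennreal ((g x - g (x + z))\<^sup>2) * K z * indicator S (x + z) * indicator S x \<partial>lborel)
        \<le> (\<integral>\<^sup>+x. K z * (\<Sum>w\<in>W. ?F w x) \<partial>lborel)"
    proof (rule nn_integral_mono)
      fix x
      show "ennreal ((g x - g (x + z))\<^sup>2) * K z * indicator S (x + z) * indicator S x \<le> K z * (\<Sum>w\<in>W. ?F w x)"
      proof (cases "x \<in> S \<and> x + z \<in> S")
        case x: True
        with W True obtain w where w: "w \<in> W" "segment_in S x (?u w)" "segment_in S (?u w + x) z"
            "segment_in S (z + x) (?u w)"
          unfolding chained_def by blast
        have "(g x - g (x + z))\<^sup>2 \<le> 3 * ((g (x + ?u w) - g x)\<^sup>2 + (g (x + ?u w + z) - g (x + ?u w))\<^sup>2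
            + (g (x + ?u w + z) - g (x + z))\<^sup>2)" by (rule sum_three_squares_le)
        then have "ennreal ((g x - g (x + z))\<^sup>2) \<le> ennreal (3 * ((g (x + ?u w) - g x)\<^sup>2 + (g (x + ?u w + z) - g (x + ?u w))\<^sup>2
            + (g (x + ?u w + z) - g (x + z))\<^sup>2))" by (rule ennreal_leI)
        also have "\<dots> = ?F w x"
          using w by (simp add: D_def ennreal_mult algebra_simps)
        \<comment> \<open>The vector \<open>w\<close> depends on \<open>x\<close> and
          \<open>z\<close>. Summing over all of \<open>W\<close> removes the dependence before the
          integration in \<open>x\<close>.\<close>
        also have "?F w x \<le> (\<Sum>w\<in>W. ?F w x)"
          by (rule member_le_sum[OF w(1) _ W(1)]) auto
        finally have "ennreal ((g x - g (x + z))\<^sup>2) \<le> (\<Sum>w\<in>W. ?F w x)" .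
        then show ?thesis using x by (simp add: mult.commute mult_left_mono)
      qed auto
    qed
    also have "\<dots> = K z * (\<Sum>w\<in>W. ennreal 3 * ((\<integral>\<^sup>+x. D (?u w) (0 + x) \<partial>lborel) + (\<integral>\<^sup>+x. D z (?u w + x) \<partial>lborel)
        + (\<integral>\<^sup>+x. D (?u w) (z + x) \<partial>lborel)))"
      by (simp add: nn_integral_cmult nn_integral_sum nn_integral_add)
    also have "\<dots> \<le> K z * (\<Sum>w\<in>W. ennreal 3 * (ennreal ((norm (?u w))\<^sup>2) * E + ennreal ((norm z)\<^sup>2) * E + ennreal ((norm (?u w))\<^sup>2) * E))"
      by (intro mult_left_mono sum_mono add_mono D) auto
    also have "\<dots> = K z * (\<Sum>w\<in>W. ennreal (3 * (1 + 2 * (norm w)\<^sup>2)) * (ennreal ((norm z)\<^sup>2) * E))"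
    proof -
      have "ennreal 3 * (ennreal ((norm (?u w))\<^sup>2) * E + ennreal ((norm z)\<^sup>2) * E + ennreal ((norm (?u w))\<^sup>2) * E)
          = ennreal (3 * (1 + 2 * (norm w)\<^sup>2)) * (ennreal ((norm z)\<^sup>2) * E)" for w :: "real^'n"
      proof -
        have "ennreal 3 * (ennreal ((norm (?u w))\<^sup>2) * E + ennreal ((norm z)\<^sup>2) * E + ennreal ((norm (?u w))\<^sup>2) * E)
          = ennreal (3 * ((norm (?u w))\<^sup>2 + (norm z)\<^sup>2 + (norm (?u w))\<^sup>2)) * E"
        proof -
          have "ennreal (3 * (p + q + p)) = ennreal 3 * (ennreal p + ennreal q + ennreal p)" if "p \<ge> 0" "q \<ge> 0" for p q
            using that by (simp only: ennreal_mult ennreal_plus add_nonneg_nonneg zero_le_numeral)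
          from this[of "(norm (?u w))\<^sup>2" "(norm z)\<^sup>2"] show ?thesis
            by (simp only: distrib_right mult.assoc zero_le_power2)
        qed
        also have "3 * ((norm (?u w))\<^sup>2 + (norm z)\<^sup>2 + (norm (?u w))\<^sup>2) = 3 * (1 + 2 * (norm w)\<^sup>2) * (norm z)\<^sup>2"
          by (simp add: power_mult_distrib algebra_simps)
        finally show ?thesis by (simp add: ennreal_mult mult.assoc)
      qed
      then show ?thesis by (simp only:)
    qed
    finally show ?thesis by (simp only: sum_distrib_right mult.assoc)
  qed (simp add: K0)
  have "dbl S K g = (\<integral>\<^sup>+x. (\<integral>\<^sup>+y. ennreal ((g x - g y)\<^sup>2) * K (y - x) * indicator S y * indicator S x \<partial>lborel) \<partial>lborel)"
    unfolding dbl_def by (subst nn_integral_multc) auto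
  \<comment> \<open>With \<open>y = x + z\<close> the kernel depends on \<open>z\<close> alone. Once
    the integrals are exchanged, the inner one compares \<open>g\<close> with a translate by a fixed
    vector.\<close>
  also have "\<dots> = (\<integral>\<^sup>+x. (\<integral>\<^sup>+z. ennreal ((g x - g (x + z))\<^sup>2) * K z * indicator S (x + z) * indicator S x \<partial>lborel) \<partial>lborel)"
  proof (rule nn_integral_cong)
    fix x
    show "(\<integral>\<^sup>+y. ennreal ((g x - g y)\<^sup>2) * K (y - x) * indicator S y * indicator S x \<partial>lborel)
        = (\<integral>\<^sup>+z. ennreal ((g x - g (x + z))\<^sup>2) * K z * indicator S (x + z) * indicator S x \<partial>lborel)"
      using lborel_nn_integral_translate[of "\<lambda>y. ennreal ((g x - g y)\<^sup>2) * K (y - x) * indicator S y * indicator S x" x]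
      by simp
  qed
  also have "\<dots> = (\<integral>\<^sup>+z. (\<integral>\<^sup>+x. ennreal ((g x - g (x + z))\<^sup>2) * K z * indicator S (x + z) * indicator S x \<partial>lborel) \<partial>lborel)"
    by (rule lborel_pair.Fubini') measurable
  also have "\<dots> \<le> (\<integral>\<^sup>+z. K z * ((\<Sum>w\<in>W. ennreal (3 * (1 + 2 * (norm w)\<^sup>2))) * ennreal ((norm z)\<^sup>2) * E) \<partial>lborel)"
    by (intro nn_integral_mono inner)
  also have "\<dots> = (\<integral>\<^sup>+z. (\<Sum>w\<in>W. ennreal (3 * (1 + 2 * (norm w)\<^sup>2))) * (K z * ennreal ((norm z)\<^sup>2)) * E \<partial>lborel)"
    by (simp add: mult_ac)
  also have "\<dots> = (\<Sum>w\<in>W. ennreal (3 * (1 + 2 * (norm w)\<^sup>2))) * (\<integral>\<^sup>+z. K z * ennreal ((norm z)\<^sup>2) \<partial>lborel) * E"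
    by (simp add: nn_integral_multc nn_integral_cmult)
  finally show ?thesis by (simp add: E_def)
qed

lemma chained_convex:
  fixes S :: "'a::real_normed_vector set"
  assumes "convex S"
  shows "chained S \<delta> {0}"
proof -
  have "x + t *\<^sub>R z \<in> S" if "x \<in> S" "x + z \<in> S" "t \<in> {0..1}" for x z t
    using convexD_alt[OF assms that(1,2), of t] that(3) by (simp add: algebra_simps)
  then show ?thesis by (auto simp: chained_def segment_in_def algebra_simps)
qed

text \<open>The ball is split into dyadic shells. The shell of radius about
  \<open>\<delta> / 2^j\<close> contributes a multiple of \<open>2^(- j (a + d))\<close>, and these
  terms form a convergent geometric series because \<open>a + d > 0\<close>.\<close>

lemma nn_integral_norm_powr_ball_finite:
  fixes a :: real
  assumes a: "a + real CARD('n::finite) > 0" and \<delta>: "\<delta> > 0"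
  shows "(\<integral>\<^sup>+z::real^'n\<in>ball 0 \<delta>. ennreal (norm z powr a) \<partial>lborel) < \<infinity>"
proof -
  define v where "v = unit_ball_vol (real CARD('n))"
  have v: "v \<ge> 0" by (simp add: v_def)
  \<comment> \<open>In a shell \<open>norm z\<close> lies between \<open>r k / 2\<close> and
    \<open>r k\<close>. For \<open>a \<ge> 0\<close> the power is at most its value at
    \<open>r k\<close>; for negative \<open>a\<close> it may be larger by the factor
    \<open>2 powr (- a)\<close>.\<close>
  define c where "c = max 1 (2 powr (- a))"
  have c: "c \<ge> 1" "c \<ge> 2 powr (- a)" by (auto simp: c_def)
  define r where "r j = \<delta> / 2 ^ j" for j :: nat
  have r: "r j > 0" for j using \<delta> by (simp add: r_def)
  have term_le: "f k \<le> (\<Sum>j. f j)" for f :: "nat \<Rightarrow> ennreal" and k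
    using sum_le_suminf[of f "{k}"] by simp
  have le: "ennreal (norm z powr a) * indicator (ball 0 \<delta>) z \<le> (\<Sum>j. ennreal (c * r j powr a) * indicator (ball (0::real^'n) (r j)) z)" for z
  proof (cases "z \<noteq> 0 \<and> norm z < \<delta>")
    case True
    have "(\<lambda>j. \<delta> * (1 / 2) ^ j) \<longlonglongrightarrow> \<delta> * 0"
      by (intro tendsto_mult tendsto_const LIMSEQ_realpow_zero) auto
    then have "\<forall>\<^sub>F j in sequentially. \<delta> * (1 / 2) ^ j < norm z"
      using True by (intro order_tendstoD) auto
    then obtain j where "\<delta> * (1 / 2) ^ j < norm z"
      using eventually_happens'[OF sequentially_bot] by blast
    then have "r j < norm z" by (simp add: r_def power_one_over)
    then have ex: "\<exists>j. r j \<le> norm z" using less_imp_le by blast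
    define j where "j = (LEAST j. r j \<le> norm z)"
    have j: "r j \<le> norm z" unfolding j_def using ex by (rule LeastI_ex)
    have "j \<noteq> 0"
    proof
      assume "j = 0"
      with j True show False by (simp add: r_def)
    qed
    then obtain k where k: "j = Suc k" by (cases j) auto
    have "\<not> r k \<le> norm z" using not_less_Least[of k "\<lambda>j. r j \<le> norm z"] k by (simp add: j_def[symmetric])
    then have z: "norm z < r k" "r k \<le> 2 * norm z" using j k by (auto simp: r_def)
    have "norm z powr a \<le> c * r k powr a"
    proof (cases "a \<ge> 0")
      case True
      have "norm z powr a \<le> r k powr a" using z True by (intro powr_mono2) auto
      also have "\<dots> \<le> c * r k powr a" using mult_right_mono[OF c(1), of "r k powr a"] by simp
      finally show ?thesis .
    next
      case False
      have "norm z powr a = 2 powr (- a) * (2 * norm z) powr a"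
        by (simp add: powr_mult powr_minus)
      also have "\<dots> \<le> 2 powr (- a) * r k powr a"
        using z False r[of k] by (intro mult_left_mono powr_mono2') auto
      also have "\<dots> \<le> c * r k powr a" using c by (intro mult_right_mono) auto
      finally show ?thesis .
    qed
    then have "ennreal (norm z powr a) * indicator (ball 0 \<delta>) z \<le> ennreal (c * r k powr a) * indicator (ball 0 (r k)) z"
      using z True by (simp add: ennreal_leI)
    also have "\<dots> \<le> (\<Sum>j. ennreal (c * r j powr a) * indicator (ball 0 (r j)) z)"
      by (rule term_le)
    finally show ?thesis .
  qed (auto simp: indicator_def)
  have "(\<integral>\<^sup>+z::real^'n\<in>ball 0 \<delta>. ennreal (norm z powr a) \<partial>lborel)
      \<le> (\<integral>\<^sup>+z. (\<Sum>j. ennreal (c * r j powr a) * indicator (ball (0::real^'n) (r j)) z) \<partial>lborel)"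
    by (rule nn_integral_mono) (rule le)
  also have "\<dots> = (\<Sum>j. ennreal (c * r j powr a) * emeasure lborel (ball (0::real^'n) (r j)))"
  proof -
    have "(\<integral>\<^sup>+z. (\<Sum>j. ennreal (c * r j powr a) * indicator (ball (0::real^'n) (r j)) z) \<partial>lborel)
      = (\<Sum>j. \<integral>\<^sup>+z. ennreal (c * r j powr a) * indicator (ball (0::real^'n) (r j)) z \<partial>lborel)"
      by (rule nn_integral_suminf, intro borel_measurable_times_ennreal borel_measurable_const
          borel_measurable_indicator) simp
    also have "\<dots> = (\<Sum>j. ennreal (c * r j powr a) * emeasure lborel (ball (0::real^'n) (r j)))"
      by (intro suminf_cong nn_integral_cmult_indicator) simp
    finally show ?thesis .
  qed
  also have "\<dots> = (\<Sum>j. ennreal (c * v * \<delta> powr (a + real CARD('n)) * (2 powr (- (a + real CARD('n)))) ^ j))"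
  proof (rule suminf_cong)
    fix j
    have "r j powr a * r j ^ CARD('n) = r j powr (a + real CARD('n))"
      using r[of j] by (simp add: powr_add powr_realpow)
    also have "\<dots> = \<delta> powr (a + real CARD('n)) * (2 powr (- (a + real CARD('n)))) ^ j"
    proof -
      have "((1 / 2) ^ j) powr b = (2 powr (- b)) ^ j" for b :: real
        by (induction j) (simp_all add: powr_mult powr_minus_divide powr_divide)
      moreover have "r j = \<delta> * (1 / 2) ^ j" by (simp add: r_def power_one_over)
      ultimately show ?thesis using \<delta> by (simp only: powr_mult less_imp_le zero_le_power zero_le_divide_1_iff zero_le_numeral)
    qed
    finally have "c * r j powr a * (v * r j ^ CARD('n)) = c * v * \<delta> powr (a + real CARD('n)) * (2 powr (- (a + real CARD('n)))) ^ j"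
      by (simp add: mult_ac)
    then show "ennreal (c * r j powr a) * emeasure lborel (ball (0::real^'n) (r j))
        = ennreal (c * v * \<delta> powr (a + real CARD('n)) * (2 powr (- (a + real CARD('n)))) ^ j)"
      using r[of j] c v by (simp add: emeasure_ball v_def[symmetric] ennreal_mult[symmetric])
  qed
  also have "\<dots> < \<infinity>"
  proof -
    have "summable (\<lambda>j. c * v * \<delta> powr (a + real CARD('n)) * (2 powr (- (a + real CARD('n)))) ^ j)"
    proof (intro summable_mult summable_geometric)
      show "norm (2 powr (- (a + real CARD('n)))) < 1"
        using a powr_less_mono[of "- (a + real CARD('n))" 0 2] by simp
    qed
    then show ?thesis using c v by (subst suminf_ennreal2) auto
  qed
  finally show ?thesis .
qed

subsection \<open>Poincare inequalities on balls\<close>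

definition avg :: "(real^'n::finite) set \<Rightarrow> (real^'n \<Rightarrow> real) \<Rightarrow> real" where
  "avg S g = (LINT x:S|lborel. g x) / measure lborel S"

definition osc :: "(real^'n::finite) set \<Rightarrow> (real^'n \<Rightarrow> real) \<Rightarrow> ennreal" where
  "osc S g = l2sq S (\<lambda>x. g x - avg S g)"

lemma l2sq_finiteD:
  assumes S[measurable]: "S \<in> sets borel" and fin: "emeasure lborel S < \<infinity>"
    and g[measurable]: "g \<in> borel_measurable borel" and l2: "l2sq S g < \<infinity>"
  shows "set_integrable lborel S g" "set_integrable lborel S (\<lambda>x. (g x)\<^sup>2)"
    "l2sq S g = ennreal (LINT x:S|lborel. (g x)\<^sup>2)"
proof -
  have eq: "l2sq S g = (\<integral>\<^sup>+x. ennreal (indicator S x * (g x)\<^sup>2) \<partial>lborel)"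
    unfolding l2sq_def by (intro nn_integral_cong) (simp add: indicator_def)
  have i2: "integrable lborel (\<lambda>x. indicator S x * (g x)\<^sup>2)"
    by (rule integrableI_nonneg) (use l2 eq in \<open>auto simp: indicator_def\<close>)
  then show s2: "set_integrable lborel S (\<lambda>x. (g x)\<^sup>2)" by (simp add: set_integrable_def)
  have iS: "integrable lborel (indicator S :: _ \<Rightarrow> real)"
    using fin by (intro integrable_real_indicator) auto
  have "integrable lborel (\<lambda>x. indicator S x * g x)"
  proof (rule Bochner_Integration.integrable_bound)
    show "integrable lborel (\<lambda>x. indicator S x + indicator S x * (g x)\<^sup>2)" using i2 iS by simp
    show "AE x in lborel. norm (indicator S x * g x) \<le> norm (indicator S x + indicator S x * (g x)\<^sup>2)"
    proof (rule AE_I2)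
      fix x
      have "0 \<le> (\<bar>g x\<bar> - 1)\<^sup>2" by simp
      then have "\<bar>g x\<bar> \<le> 1 + (g x)\<^sup>2" by (simp add: power2_eq_square algebra_simps)
      then show "norm (indicator S x * g x) \<le> norm (indicator S x + indicator S x * (g x)\<^sup>2)"
        by (simp add: indicator_def)
    qed
  qed measurable
  then show "set_integrable lborel S g" by (simp add: set_integrable_def)
  show "l2sq S g = ennreal (LINT x:S|lborel. (g x)\<^sup>2)"
    unfolding eq set_lebesgue_integral_def using i2
    by (subst nn_integral_eq_integral) auto
qed

lemma l2sq_const:
  assumes [measurable]: "S \<in> sets borel"
  shows "l2sq S (\<lambda>_. c) = ennreal (c\<^sup>2) * emeasure lborel S"
  unfolding l2sq_def by (subst nn_integral_cmult_indicator) auto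

lemma set_integral_square_diff:
  assumes S[measurable]: "S \<in> sets borel" and fin: "emeasure lborel S < \<infinity>"
    and g: "set_integrable lborel S g" "set_integrable lborel S (\<lambda>x. (g x)\<^sup>2)"
  shows "set_integrable lborel S (\<lambda>x. (a - g x)\<^sup>2)"
    "(LINT x:S|lborel. (a - g x)\<^sup>2) = a\<^sup>2 * measure lborel S - 2 * a * (LINT x:S|lborel. g x) + (LINT x:S|lborel. (g x)\<^sup>2)"
proof -
  have eq: "indicator S x * (a - g x)\<^sup>2 = a\<^sup>2 * indicator S x - 2 * a * (indicator S x * g x) + indicator S x * (g x)\<^sup>2" for x
    by (simp add: power2_eq_square algebra_simps)
  have iS: "integrable lborel (indicator S :: _ \<Rightarrow> real)"
    using fin by (intro integrable_real_indicator) auto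
  show "set_integrable lborel S (\<lambda>x. (a - g x)\<^sup>2)"
    using g iS by (simp add: set_integrable_def eq)
  show "(LINT x:S|lborel. (a - g x)\<^sup>2) = a\<^sup>2 * measure lborel S - 2 * a * (LINT x:S|lborel. g x) + (LINT x:S|lborel. (g x)\<^sup>2)"
    using g iS by (simp add: set_integrable_def set_lebesgue_integral_def eq)
qed

lemma avg_square_le:
  assumes S[measurable]: "S \<in> sets borel" and fin: "emeasure lborel S < \<infinity>" "0 < measure lborel S"
    and g: "set_integrable lborel S g" "set_integrable lborel S (\<lambda>x. (g x)\<^sup>2)"
  shows "(avg S g)\<^sup>2 * measure lborel S \<le> (LINT x:S|lborel. (g x)\<^sup>2)"
proof -
  let ?a = "avg S g"
  have "0 \<le> (LINT x:S|lborel. (?a - g x)\<^sup>2)"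
    unfolding set_lebesgue_integral_def by (intro integral_nonneg_AE) auto
  also have "\<dots> = ?a\<^sup>2 * measure lborel S - 2 * ?a * (LINT x:S|lborel. g x) + (LINT x:S|lborel. (g x)\<^sup>2)"
    by (rule set_integral_square_diff[OF S fin(1) g])
  also have "(LINT x:S|lborel. g x) = ?a * measure lborel S" using fin(2) by (simp add: avg_def)
  finally show ?thesis by (simp add: power2_eq_square algebra_simps)
qed

lemma avg_l2sq_le:
  assumes S[measurable]: "S \<in> sets borel" and fin: "emeasure lborel S < \<infinity>" "0 < measure lborel S"
    and g[measurable]: "g \<in> borel_measurable borel"
  shows "ennreal ((avg S g)\<^sup>2 * measure lborel S) \<le> l2sq S g"
proof (cases "l2sq S g < \<infinity>")
  case True
  note * = l2sq_finiteD[OF S fin(1) g True]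
  show ?thesis unfolding *(3) by (intro ennreal_leI avg_square_le[OF S fin *(1,2)])
qed (auto simp: not_less top_unique)

text \<open>For fixed \<open>x\<close> the deviation \<open>g x - avg S g\<close> is the mean of
  \<open>g x - g y\<close> over \<open>y\<close>, so Jensen's inequality bounds its square by the
  mean of the squares.\<close>

lemma osc_le_dbl:
  assumes S[measurable]: "S \<in> sets borel" and fin: "emeasure lborel S < \<infinity>" "0 < measure lborel S"
    and g[measurable]: "g \<in> borel_measurable borel" and l2: "l2sq S g < \<infinity>"
  shows "osc S g \<le> ennreal (1 / measure lborel S) * dbl S (\<lambda>_. 1) g"
proof -
  let ?v = "measure lborel S" and ?a = "avg S g"
  note * = l2sq_finiteD[OF S fin(1) g l2]
  have "ennreal ((g x - ?a)\<^sup>2) \<le> ennreal (1 / ?v) * (\<integral>\<^sup>+y\<in>S. ennreal ((g x - g y)\<^sup>2) * 1 \<partial>lborel)" for x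
  proof -
    note d = set_integral_square_diff[OF S fin(1) *(1,2), of "g x"]
    have "(LINT y:S|lborel. g y) = ?a * ?v" using fin(2) by (simp add: avg_def)
    then have "?v * (g x - ?a)\<^sup>2 \<le> (LINT y:S|lborel. (g x - g y)\<^sup>2)"
      using avg_square_le[OF S fin *(1,2)] unfolding d(2) by (simp add: power2_eq_square algebra_simps)
    then have "(g x - ?a)\<^sup>2 \<le> 1 / ?v * (LINT y:S|lborel. (g x - g y)\<^sup>2)"
      using fin(2) by (simp add: field_simps)
    then have "ennreal ((g x - ?a)\<^sup>2) \<le> ennreal (1 / ?v) * ennreal (LINT y:S|lborel. (g x - g y)\<^sup>2)"
      using fin(2) by (subst ennreal_mult'[symmetric]) (auto intro: ennreal_leI)
    also have "ennreal (LINT y:S|lborel. (g x - g y)\<^sup>2) = (\<integral>\<^sup>+y. ennreal (indicator S y * (g x - g y)\<^sup>2) \<partial>lborel)"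
      using d(1) unfolding set_lebesgue_integral_def set_integrable_def
      by (subst nn_integral_eq_integral) auto
    also have "\<dots> = (\<integral>\<^sup>+y\<in>S. ennreal ((g x - g y)\<^sup>2) * 1 \<partial>lborel)"
      by (intro nn_integral_cong) (simp add: indicator_def)
    finally show ?thesis .
  qed
  then have "osc S g
      \<le> (\<integral>\<^sup>+x\<in>S. ennreal (1 / ?v) * (\<integral>\<^sup>+y\<in>S. ennreal ((g x - g y)\<^sup>2) * 1 \<partial>lborel) \<partial>lborel)"
    unfolding osc_def l2sq_def by (intro nn_integral_mono mult_right_mono) auto
  also have "\<dots> = ennreal (1 / ?v) * dbl S (\<lambda>_. 1) g"
    unfolding dbl_def mult.assoc by (rule nn_integral_cmult) measurable
  finally show ?thesis .
qed

lemma measure_ball: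
  fixes x0 :: "real^'n::finite"
  assumes "\<rho> > 0"
  shows "measure lborel (ball x0 \<rho>) = unit_ball_vol (real CARD('n)) * \<rho> ^ CARD('n)"
    "0 < measure lborel (ball x0 \<rho>)" "emeasure lborel (ball x0 \<rho>) < \<infinity>"
    "emeasure lborel (ball x0 \<rho>) = ennreal (unit_ball_vol (real CARD('n)) * \<rho> ^ CARD('n))"
  using assms emeasure_lborel_ball_finite[of x0 \<rho>] by (auto simp: content_ball emeasure_ball)

text \<open>Differences of two points of the ball lie in the ball of radius
  \<open>2 * \<rho>\<close> about \<open>0\<close>, so the kernel \<open>1\<close> may be cut off
  there and the gradient estimate applied with \<open>W = {0}\<close>. The constant is
  \<open>3\<close> from the three squares, times \<open>(2 * \<rho>)^2\<close>, times the volume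
  ratio \<open>2 ^ CARD('n)\<close>.\<close>

lemma poincare_ball:
  fixes x0 :: "real^'n::finite"
  assumes \<rho>: "\<rho> > 0" and G: "\<And>i. wpart (ball x0 \<rho>) i g (G i)" and l2: "l2sq (ball x0 \<rho>) g < \<infinity>"
  shows "osc (ball x0 \<rho>) g
    \<le> ennreal (12 * 2 ^ CARD('n) * \<rho>\<^sup>2) * (\<Sum>i\<in>UNIV. l2sq (ball x0 \<rho>) (G i))"
proof -
  let ?B = "ball x0 \<rho>" and ?v = "unit_ball_vol (real CARD('n))" and ?E = "\<Sum>i\<in>UNIV. l2sq (ball x0 \<rho>) (G i)"
  have v: "?v > 0" by simp
  then have v0: "?v \<noteq> 0" by linarith
  have [measurable]: "?B \<in> sets borel" by simp
  have g[measurable]: "g \<in> borel_measurable borel" using G by (auto simp: wpart_def)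
  have "(\<integral>\<^sup>+z. indicator (ball 0 (2 * \<rho>)) z * ennreal ((norm z)\<^sup>2) \<partial>(lborel :: (real^'n) measure))
      \<le> (\<integral>\<^sup>+z. ennreal ((2 * \<rho>)\<^sup>2) * indicator (ball 0 (2 * \<rho>)) z \<partial>(lborel :: (real^'n) measure))"
  proof (rule nn_integral_mono)
    fix z :: "real^'n"
    show "indicator (ball 0 (2 * \<rho>)) z * ennreal ((norm z)\<^sup>2) \<le> ennreal ((2 * \<rho>)\<^sup>2) * indicator (ball 0 (2 * \<rho>)) z"
      using power_mono[of "norm z" "2 * \<rho>" 2] by (cases "norm z < 2 * \<rho>") (simp_all add: ennreal_leI)
  qed
  also have "\<dots> = ennreal ((2 * \<rho>)\<^sup>2) * emeasure lborel (ball (0::real^'n) (2 * \<rho>))"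
    by (rule nn_integral_cmult_indicator) simp
  also have "\<dots> = ennreal ((2 * \<rho>)\<^sup>2 * (?v * (2 * \<rho>) ^ CARD('n)))"
    using \<rho> v by (simp add: emeasure_ball ennreal_mult)
  finally have I: "(\<integral>\<^sup>+z. indicator (ball 0 (2 * \<rho>)) z * ennreal ((norm z)\<^sup>2) \<partial>(lborel :: (real^'n) measure))
      \<le> ennreal ((2 * \<rho>)\<^sup>2 * (?v * (2 * \<rho>) ^ CARD('n)))" .
  have "dbl ?B (\<lambda>_. 1) g \<le> dbl ?B (indicator (ball 0 (2 * \<rho>))) g"
  proof -
    have "norm (y - x) < 2 * \<rho>" if "x \<in> ?B" "y \<in> ?B" for x y
      using that norm_triangle_ineq4[of "y - x0" "x - x0"] by (auto simp: dist_norm norm_minus_commute)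
    then show ?thesis
      unfolding dbl_def by (intro nn_integral_mono) (auto simp: indicator_def intro!: nn_integral_mono)
  qed
  also have "\<dots> \<le> (\<Sum>w\<in>{0}. ennreal (3 * (1 + 2 * (norm (w::real^'n))\<^sup>2))) *
      (\<integral>\<^sup>+z. indicator (ball 0 (2 * \<rho>)) z * ennreal ((norm z)\<^sup>2) \<partial>(lborel :: (real^'n) measure)) * ?E"
    by (rule dbl_le_gradient[where \<delta> = "2 * \<rho>", OF open_ball G _ chained_convex[OF convex_ball]])
      (auto intro: borel_measurable_indicator simp: indicator_simps)
  also have "\<dots> \<le> ennreal 3 * ennreal ((2 * \<rho>)\<^sup>2 * (?v * (2 * \<rho>) ^ CARD('n))) * ?E"
    by (intro mult_mono I) auto
  also have "\<dots> = ennreal (3 * ((2 * \<rho>)\<^sup>2 * (?v * (2 * \<rho>) ^ CARD('n)))) * ?E"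
    using \<rho> v by (subst ennreal_mult) auto
  finally have D: "dbl ?B (\<lambda>_. 1) g \<le> ennreal (3 * ((2 * \<rho>)\<^sup>2 * (?v * (2 * \<rho>) ^ CARD('n)))) * ?E" .
  have "osc ?B g \<le> ennreal (1 / measure lborel ?B) * dbl ?B (\<lambda>_. 1) g"
    by (rule osc_le_dbl[OF _ measure_ball(3,2)[OF \<rho>] g l2]) simp
  also have "\<dots> \<le> ennreal (1 / measure lborel ?B) * (ennreal (3 * ((2 * \<rho>)\<^sup>2 * (?v * (2 * \<rho>) ^ CARD('n)))) * ?E)"
    by (intro mult_left_mono D) auto
  also have "\<dots> = ennreal (1 / measure lborel ?B * (3 * ((2 * \<rho>)\<^sup>2 * (?v * (2 * \<rho>) ^ CARD('n))))) * ?E"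
    using \<rho> v by (subst ennreal_mult) (auto simp: mult.assoc)
  also have "1 / measure lborel ?B * (3 * ((2 * \<rho>)\<^sup>2 * (?v * (2 * \<rho>) ^ CARD('n)))) = 12 * 2 ^ CARD('n) * \<rho>\<^sup>2"
    using \<rho> v v0 by (simp add: measure_ball(1) power_mult_distrib)
  finally show ?thesis .
qed

text \<open>Off the diagonal, distances in the ball are at most \<open>2 * \<rho>\<close>, so the
  Slobodeckij kernel is at least \<open>(2 * \<rho>) powr (- (d + 2 * \<sigma>))\<close>; on the
  diagonal the difference of values vanishes. Dividing by the volume of the ball leaves
  \<open>\<rho> powr (2 * \<sigma>)\<close>.\<close>

lemma fractional_poincare_ball:
  fixes x0 :: "real^'n::finite"
  assumes \<rho>: "\<rho> > 0" and g[measurable]: "g \<in> borel_measurable borel" and l2: "l2sq (ball x0 \<rho>) g < \<infinity>"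
    and \<sigma>: "\<sigma> > 0"
  shows "osc (ball x0 \<rho>) g
    \<le> ennreal (2 powr (real CARD('n) + 2 * \<sigma>) / unit_ball_vol (real CARD('n)) * \<rho> powr (2 * \<sigma>)) * slob (ball x0 \<rho>) \<sigma> g"
proof -
  let ?B = "ball x0 \<rho>" and ?v = "unit_ball_vol (real CARD('n))" and ?e = "real CARD('n) + 2 * \<sigma>"
  have v: "?v > 0" by simp
  then have v0: "?v \<noteq> 0" by linarith
  have [measurable]: "?B \<in> sets borel" by simp
  have pt: "ennreal ((g x - g y)\<^sup>2) * 1 * indicator ?B y \<le> ennreal ((2 * \<rho>) powr ?e) * (ennreal ((g x - g y)\<^sup>2) * ennreal (1 / norm (y - x) powr ?e) * indicator ?B y)"
    if "x \<in> ?B" for x y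
  proof (cases "y \<in> ?B \<and> y \<noteq> x")
    case True
    have "norm (y - x) \<le> 2 * \<rho>"
      using True that norm_triangle_ineq4[of "y - x0" "x - x0"] by (auto simp: dist_norm norm_minus_commute)
    then have "norm (y - x) powr ?e \<le> (2 * \<rho>) powr ?e"
      using \<sigma> by (intro powr_mono2) auto
    then have "1 \<le> (2 * \<rho>) powr ?e * (1 / norm (y - x) powr ?e)" using True by simp
    then have "(g x - g y)\<^sup>2 * 1 \<le> (g x - g y)\<^sup>2 * ((2 * \<rho>) powr ?e * (1 / norm (y - x) powr ?e))"
      by (intro mult_left_mono) auto
    then have "ennreal ((g x - g y)\<^sup>2) \<le> ennreal ((2 * \<rho>) powr ?e * ((g x - g y)\<^sup>2 * (1 / norm (y - x) powr ?e)))"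
      by (intro ennreal_leI) (simp add: mult_ac)
    also have "\<dots> = ennreal ((2 * \<rho>) powr ?e) * (ennreal ((g x - g y)\<^sup>2) * ennreal (1 / norm (y - x) powr ?e))"
      by (subst ennreal_mult, simp, simp, subst ennreal_mult) simp_all
    finally show ?thesis using True by simp
  qed auto
  have "dbl ?B (\<lambda>_. 1) g \<le> (\<integral>\<^sup>+x\<in>?B. ennreal ((2 * \<rho>) powr ?e) * (\<integral>\<^sup>+y\<in>?B. ennreal ((g x - g y)\<^sup>2) * ennreal (1 / norm (y - x) powr ?e) \<partial>lborel) \<partial>lborel)"
    unfolding dbl_def
  proof (rule nn_integral_mono)
    fix x
    show "(\<integral>\<^sup>+y\<in>?B. ennreal ((g x - g y)\<^sup>2) * 1 \<partial>lborel) * indicator ?B x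
       \<le> ennreal ((2 * \<rho>) powr ?e) * (\<integral>\<^sup>+y\<in>?B. ennreal ((g x - g y)\<^sup>2) * ennreal (1 / norm (y - x) powr ?e) \<partial>lborel) * indicator ?B x"
    proof (cases "x \<in> ?B")
      case True
      have "(\<integral>\<^sup>+y\<in>?B. ennreal ((g x - g y)\<^sup>2) * 1 \<partial>lborel) \<le>
         (\<integral>\<^sup>+y. ennreal ((2 * \<rho>) powr ?e) * (ennreal ((g x - g y)\<^sup>2) * ennreal (1 / norm (y - x) powr ?e) * indicator ?B y) \<partial>lborel)"
        by (rule nn_integral_mono) (rule pt[OF True])
      also have "\<dots> = ennreal ((2 * \<rho>) powr ?e) * (\<integral>\<^sup>+y\<in>?B. ennreal ((g x - g y)\<^sup>2) * ennreal (1 / norm (y - x) powr ?e) \<partial>lborel)"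
        by (rule nn_integral_cmult) measurable
      finally show ?thesis using True by simp
    qed simp
  qed
  also have "\<dots> = ennreal ((2 * \<rho>) powr ?e) * slob ?B \<sigma> g"
    unfolding slob_def dbl_def mult.assoc by (rule nn_integral_cmult) measurable
  finally have D: "dbl ?B (\<lambda>_. 1) g \<le> ennreal ((2 * \<rho>) powr ?e) * slob ?B \<sigma> g" .
  have "osc ?B g \<le> ennreal (1 / measure lborel ?B) * dbl ?B (\<lambda>_. 1) g"
    by (rule osc_le_dbl[OF _ measure_ball(3,2)[OF \<rho>] g l2]) simp
  also have "\<dots> \<le> ennreal (1 / measure lborel ?B) * (ennreal ((2 * \<rho>) powr ?e) * slob ?B \<sigma> g)"
    by (intro mult_left_mono D) auto
  also have "\<dots> = ennreal (1 / measure lborel ?B * (2 * \<rho>) powr ?e) * slob ?B \<sigma> g"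
    by (subst ennreal_mult) (auto simp: mult.assoc)
  also have "1 / measure lborel ?B * (2 * \<rho>) powr ?e = 2 powr ?e / ?v * \<rho> powr (2 * \<sigma>)"
    using \<rho> v v0 by (simp add: measure_ball(1) powr_mult powr_add powr_realpow)
  finally show ?thesis .
qed

section \<open>Comparison of difference seminorms for different kernels and orders\<close>

lemma dbl_const_le:
  assumes S[measurable]: "S \<in> sets borel" and g[measurable]: "g \<in> borel_measurable borel"
  shows "dbl S (\<lambda>_. c) g \<le> 4 * c * emeasure lborel S * l2sq S g"
proof -
  have sq: "ennreal ((g x - g y)\<^sup>2) \<le> 2 * ennreal ((g x)\<^sup>2) + 2 * ennreal ((g y)\<^sup>2)" for x y
  proof -
    have "(g x - g y)\<^sup>2 \<le> 2 * (g x)\<^sup>2 + 2 * (g y)\<^sup>2"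
      using zero_le_power2[of "g x + g y"] by (simp add: power2_eq_square algebra_simps)
    then have "ennreal ((g x - g y)\<^sup>2) \<le> ennreal (2 * (g x)\<^sup>2 + 2 * (g y)\<^sup>2)" by (rule ennreal_leI)
    then show ?thesis by (simp add: ennreal_mult)
  qed
  have inner: "(\<integral>\<^sup>+y\<in>S. ennreal ((g x - g y)\<^sup>2) * c \<partial>lborel) \<le> 2 * c * (ennreal ((g x)\<^sup>2) * emeasure lborel S + l2sq S g)" for x
  proof -
    have "(\<integral>\<^sup>+y\<in>S. ennreal ((g x - g y)\<^sup>2) * c \<partial>lborel)
        \<le> (\<integral>\<^sup>+y. 2 * c * (ennreal ((g x)\<^sup>2) * indicator S y + ennreal ((g y)\<^sup>2) * indicator S y) \<partial>lborel)"
    proof (rule nn_integral_mono)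
      fix y
      have "ennreal ((g x - g y)\<^sup>2) * c * indicator S y \<le> (2 * ennreal ((g x)\<^sup>2) + 2 * ennreal ((g y)\<^sup>2)) * c * indicator S y"
        by (intro mult_right_mono sq) auto
      then show "ennreal ((g x - g y)\<^sup>2) * c * indicator S y \<le> 2 * c * (ennreal ((g x)\<^sup>2) * indicator S y + ennreal ((g y)\<^sup>2) * indicator S y)"
        by (simp add: distrib_left distrib_right mult_ac)
    qed
    also have "\<dots> = 2 * c * (ennreal ((g x)\<^sup>2) * emeasure lborel S + l2sq S g)"
      unfolding l2sq_def by (simp add: nn_integral_cmult nn_integral_add)
    finally show ?thesis .
  qed
  have "dbl S (\<lambda>_. c) g \<le> (\<integral>\<^sup>+x. 2 * c * (ennreal ((g x)\<^sup>2) * emeasure lborel S + l2sq S g) * indicator S x \<partial>lborel)"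
    unfolding dbl_def by (intro nn_integral_mono mult_right_mono inner) auto
  also have "\<dots> = (\<integral>\<^sup>+x. 2 * c * (emeasure lborel S * (ennreal ((g x)\<^sup>2) * indicator S x) + l2sq S g * indicator S x) \<partial>lborel)"
    by (intro nn_integral_cong) (simp add: indicator_def mult.commute)
  also have "\<dots> = 2 * c * (emeasure lborel S * l2sq S g + l2sq S g * emeasure lborel S)"
    by (simp add: nn_integral_cmult nn_integral_add l2sq_def)
  also have "\<dots> = 4 * c * emeasure lborel S * l2sq S g"
  proof -
    have "4 * c * emeasure lborel S * l2sq S g = (2 * 2) * c * emeasure lborel S * l2sq S g" by simp
    also have "\<dots> = 2 * c * (2 * (emeasure lborel S * l2sq S g))" by (simp only: mult_ac)
    also have "2 * (emeasure lborel S * l2sq S g) = emeasure lborel S * l2sq S g + l2sq S g * emeasure lborel S"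
      by (simp add: mult_2 mult.commute)
    finally show ?thesis by simp
  qed
  finally show ?thesis .
qed

lemma ball_in_borel[measurable]: "ball a r \<in> sets borel"
  by simp

text \<open>The kernel is split at \<open>norm z = \<delta>\<close>. The near part, weighted by
  \<open>(norm z)^2\<close>, is integrable because \<open>2 - 2 * \<sigma> > 0\<close>, so the
  gradient controls it along chains; the far part is bounded and costs a multiple of the
  \<open>L2\<close> norm.\<close>

lemma slob_le_gradient:
  fixes S :: "(real^'n::finite) set"
  assumes S: "open S" "emeasure lborel S < \<infinity>" and W: "finite W" "chained S \<delta> W"
    and \<delta>: "\<delta> > 0" and \<sigma>: "0 < \<sigma>" "\<sigma> < 1"
  obtains C where "C \<ge> 0"
    "\<And>g G. (\<And>i. wpart S i g (G i)) \<Longrightarrow> slob S \<sigma> g \<le> ennreal C * (l2sq S g + (\<Sum>i\<in>UNIV. l2sq S (G i)))"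
proof -
  let ?e = "real CARD('n) + 2 * \<sigma>"
  have [measurable]: "S \<in> sets borel" using S by auto
  define K where "K z = ennreal (1 / norm z powr ?e) * indicator (ball 0 \<delta>) z" for z :: "real^'n"
  have Km[measurable]: "K \<in> borel_measurable borel" unfolding K_def by measurable
  define c where "c = ennreal (1 / \<delta> powr ?e)"
  define A where "A = (\<Sum>w\<in>W. ennreal (3 * (1 + 2 * (norm w)\<^sup>2))) * (\<integral>\<^sup>+z. K z * ennreal ((norm z)\<^sup>2) \<partial>lborel)"
  define B where "B = 4 * c * emeasure lborel S"
  have "(\<integral>\<^sup>+z. K z * ennreal ((norm z)\<^sup>2) \<partial>lborel) \<le> (\<integral>\<^sup>+z::real^'n\<in>ball 0 \<delta>. ennreal (norm z powr (2 - ?e)) \<partial>lborel)"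
  proof (rule nn_integral_mono)
    fix z :: "real^'n"
    show "K z * ennreal ((norm z)\<^sup>2) \<le> ennreal (norm z powr (2 - ?e)) * indicator (ball 0 \<delta>) z"
    proof (cases "z = 0")
      case False
      then have "1 / norm z powr ?e * (norm z)\<^sup>2 = norm z powr (2 - ?e)"
        by (simp add: powr_diff powr_numeral)
      then have "ennreal (1 / norm z powr ?e) * ennreal ((norm z)\<^sup>2) = ennreal (norm z powr (2 - ?e))"
        by (subst ennreal_mult[symmetric]) auto
      then show ?thesis by (simp add: K_def indicator_def)
    qed simp
  qed
  also have "\<dots> < \<infinity>" using \<sigma> by (intro nn_integral_norm_powr_ball_finite \<delta>) auto
  finally have "(\<integral>\<^sup>+z. K z * ennreal ((norm z)\<^sup>2) \<partial>lborel) < \<infinity>" .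
  moreover have "(\<Sum>w\<in>W. ennreal (3 * (1 + 2 * (norm w)\<^sup>2))) = ennreal (\<Sum>w\<in>W. 3 * (1 + 2 * (norm w)\<^sup>2))"
    by (rule sum_ennreal) simp
  ultimately have A: "A < \<infinity>" unfolding A_def by (simp add: ennreal_mult_less_top)
  have B: "B < \<infinity>" unfolding B_def c_def using S(2) by (auto simp: ennreal_mult_less_top)
  have main: "slob S \<sigma> g \<le> (A + B) * (l2sq S g + (\<Sum>i\<in>UNIV. l2sq S (G i)))"
    if G: "\<And>i. wpart S i g (G i)" for g G
  proof -
    have g[measurable]: "g \<in> borel_measurable borel" using G by (auto simp: wpart_def)
    have "slob S \<sigma> g \<le> dbl S (\<lambda>z. K z + c) g"
      unfolding slob_def
    proof (rule dbl_mono)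
      fix z :: "real^'n"
      show "ennreal (1 / norm z powr ?e) \<le> K z + c"
      proof (cases "norm z < \<delta>")
        case False
        then have "\<delta> powr ?e \<le> norm z powr ?e" using \<delta> \<sigma> by (intro powr_mono2) auto
        then have "1 / norm z powr ?e \<le> 1 / \<delta> powr ?e" using \<delta> False by (intro divide_left_mono mult_pos_pos) auto
        then show ?thesis using False by (simp add: K_def c_def ennreal_leI)
      qed (simp add: K_def)
    qed simp
    also have "\<dots> = dbl S K g + dbl S (\<lambda>_. c) g"
    proof -
      have "(\<integral>\<^sup>+y\<in>S. ennreal ((g x - g y)\<^sup>2) * (K (y - x) + c) \<partial>lborel)
          = (\<integral>\<^sup>+y\<in>S. ennreal ((g x - g y)\<^sup>2) * K (y - x) \<partial>lborel) + (\<integral>\<^sup>+y\<in>S. ennreal ((g x - g y)\<^sup>2) * c \<partial>lborel)" for x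
        unfolding distrib_left distrib_right by (rule nn_integral_add) measurable
      then show ?thesis
        unfolding dbl_def distrib_right by (simp only: distrib_right) (rule nn_integral_add; measurable)
    qed
    also have "\<dots> \<le> A * (\<Sum>i\<in>UNIV. l2sq S (G i)) + B * l2sq S g"
    proof (rule add_mono)
      show "dbl S K g \<le> A * (\<Sum>i\<in>UNIV. l2sq S (G i))"
        unfolding A_def by (rule dbl_le_gradient[OF S(1) G W]) (auto simp: K_def)
      show "dbl S (\<lambda>_. c) g \<le> B * l2sq S g"
        unfolding B_def by (rule dbl_const_le) auto
    qed
    also have "\<dots> \<le> (A + B) * (\<Sum>i\<in>UNIV. l2sq S (G i)) + (A + B) * l2sq S g"
      by (intro add_mono mult_right_mono) auto
    finally show ?thesis by (simp add: distrib_left add.commute)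
  qed
  show thesis
  proof (rule that[of "enn2real (A + B)"])
    have "ennreal (enn2real (A + B)) = A + B" using A B by (intro ennreal_enn2real) auto
    then show "slob S \<sigma> g \<le> ennreal (enn2real (A + B)) * (l2sq S g + (\<Sum>i\<in>UNIV. l2sq S (G i)))"
      if "\<And>i. wpart S i g (G i)" for g G using main[OF that] by simp
  qed simp
qed

text \<open>The quotient of the two kernels is
  \<open>norm (y - x) powr (2 * (\<sigma> - \<sigma>'))\<close>, which is bounded on a set of
  bounded diameter.\<close>

lemma slob_le_slob:
  fixes S :: "(real^'n::finite) set"
  assumes S[measurable]: "S \<in> sets borel" and g[measurable]: "g \<in> borel_measurable borel"
    and D: "\<And>x y. x \<in> S \<Longrightarrow> y \<in> S \<Longrightarrow> norm (y - x) \<le> D" and \<sigma>: "\<sigma>' \<le> \<sigma>"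
  shows "slob S \<sigma>' g \<le> ennreal (D powr (2 * (\<sigma> - \<sigma>'))) * slob S \<sigma> g"
proof -
  let ?e = "real CARD('n) + 2 * \<sigma>" and ?e' = "real CARD('n) + 2 * \<sigma>'" and ?D = "ennreal (D powr (2 * (\<sigma> - \<sigma>')))"
  have K: "ennreal (1 / norm (y - x) powr ?e') \<le> ?D * ennreal (1 / norm (y - x) powr ?e)" if "x \<in> S" "y \<in> S" for x y
  proof (cases "x = y")
    case False
    have "norm (y - x) powr (2 * (\<sigma> - \<sigma>')) \<le> D powr (2 * (\<sigma> - \<sigma>'))"
      using D[OF that] \<sigma> by (intro powr_mono2) auto
    moreover have "1 / norm (y - x) powr ?e' = norm (y - x) powr (2 * (\<sigma> - \<sigma>')) * (1 / norm (y - x) powr ?e)"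
      using False by (simp add: powr_diff[symmetric] powr_minus_divide[symmetric] powr_add[symmetric] algebra_simps divide_inverse powr_minus[symmetric])
    ultimately have "1 / norm (y - x) powr ?e' \<le> D powr (2 * (\<sigma> - \<sigma>')) * (1 / norm (y - x) powr ?e)"
      by (simp only:) (intro mult_right_mono, auto)
    then show ?thesis by (subst ennreal_mult[symmetric]) (auto intro: ennreal_leI)
  qed simp
  have "slob S \<sigma>' g \<le> (\<integral>\<^sup>+x\<in>S. ?D * (\<integral>\<^sup>+y\<in>S. ennreal ((g x - g y)\<^sup>2) * ennreal (1 / norm (y - x) powr ?e) \<partial>lborel) \<partial>lborel)"
    unfolding slob_def dbl_def
  proof (rule nn_integral_mono)
    fix x
    show "(\<integral>\<^sup>+y\<in>S. ennreal ((g x - g y)\<^sup>2) * ennreal (1 / norm (y - x) powr ?e') \<partial>lborel) * indicator S x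
       \<le> ?D * (\<integral>\<^sup>+y\<in>S. ennreal ((g x - g y)\<^sup>2) * ennreal (1 / norm (y - x) powr ?e) \<partial>lborel) * indicator S x"
    proof (cases "x \<in> S")
      case True
      have "(\<integral>\<^sup>+y\<in>S. ennreal ((g x - g y)\<^sup>2) * ennreal (1 / norm (y - x) powr ?e') \<partial>lborel)
          \<le> (\<integral>\<^sup>+y. ?D * (ennreal ((g x - g y)\<^sup>2) * ennreal (1 / norm (y - x) powr ?e) * indicator S y) \<partial>lborel)"
      proof (rule nn_integral_mono)
        fix y
        show "ennreal ((g x - g y)\<^sup>2) * ennreal (1 / norm (y - x) powr ?e') * indicator S y
          \<le> ?D * (ennreal ((g x - g y)\<^sup>2) * ennreal (1 / norm (y - x) powr ?e) * indicator S y)"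
        proof (cases "y \<in> S")
          case y: True
          have "ennreal ((g x - g y)\<^sup>2) * ennreal (1 / norm (y - x) powr ?e') \<le> ennreal ((g x - g y)\<^sup>2) * (?D * ennreal (1 / norm (y - x) powr ?e))"
            by (intro mult_left_mono K True y) auto
          then show ?thesis using y by (simp add: mult.left_commute)
        qed simp
      qed
      also have "\<dots> = ?D * (\<integral>\<^sup>+y\<in>S. ennreal ((g x - g y)\<^sup>2) * ennreal (1 / norm (y - x) powr ?e) \<partial>lborel)"
        by (rule nn_integral_cmult) measurable
      finally show ?thesis using True by simp
    qed simp
  qed
  also have "\<dots> = ?D * slob S \<sigma> g"
    unfolding slob_def dbl_def mult.assoc by (rule nn_integral_cmult) measurable
  finally show ?thesis .
qed

section \<open>Seminorms under dilation\<close>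

lemma l2sq_scale:
  fixes g :: "real^'n::finite \<Rightarrow> real"
  assumes h: "h > 0" and g[measurable]: "g \<in> borel_measurable borel"
  shows "l2sq (ball 0 R) (\<lambda>x. c * g (h *\<^sub>R x)) = ennreal (c\<^sup>2 / h ^ CARD('n)) * l2sq (ball 0 (h * R)) g"
proof -
  have ind: "indicator (ball 0 R) x = indicator (ball 0 (h * R)) (h *\<^sub>R x)" for x :: "real^'n"
    using h by (simp add: indicator_def)
  have "l2sq (ball 0 R) (\<lambda>x. c * g (h *\<^sub>R x)) = (\<integral>\<^sup>+x. (\<lambda>y. ennreal (c\<^sup>2) * (ennreal ((g y)\<^sup>2) * indicator (ball 0 (h * R)) y)) (h *\<^sub>R x) \<partial>lborel)"
    unfolding l2sq_def ind by (intro nn_integral_cong) (simp add: power_mult_distrib ennreal_mult mult.assoc)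
  also have "\<dots> = ennreal (1 / h ^ CARD('n)) * (ennreal (c\<^sup>2) * l2sq (ball 0 (h * R)) g)"
    using h by (subst lborel_nn_integral_scale) (auto simp: l2sq_def nn_integral_cmult)
  also have "\<dots> = ennreal (c\<^sup>2 / h ^ CARD('n)) * l2sq (ball 0 (h * R)) g"
  proof -
    have "c\<^sup>2 / h ^ CARD('n) = 1 / h ^ CARD('n) * c\<^sup>2" by simp
    then show ?thesis using h by (simp only: ennreal_mult mult.assoc zero_le_power2 zero_le_divide_1_iff zero_le_power less_imp_le)
  qed
  finally show ?thesis .
qed

text \<open>The factor collects \<open>c^2\<close> from the squared difference,
  \<open>h powr (d + 2 * \<sigma>)\<close> from the kernel, and \<open>1 / h^d\<close> from each of
  the two substitutions.\<close>

lemma slob_scale: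
  fixes g :: "real^'n::finite \<Rightarrow> real"
  assumes h: "h > 0" and g[measurable]: "g \<in> borel_measurable borel"
  shows "slob (ball 0 R) \<sigma> (\<lambda>x. c * g (h *\<^sub>R x)) =
    ennreal (c\<^sup>2 * h powr (real CARD('n) + 2 * \<sigma>) / (h ^ CARD('n))\<^sup>2) * slob (ball 0 (h * R)) \<sigma> g"
proof -
  let ?e = "real CARD('n) + 2 * \<sigma>" and ?k = "ennreal (c\<^sup>2 * h powr (real CARD('n) + 2 * \<sigma>))"
  have ind: "indicator (ball 0 R) x = indicator (ball 0 (h * R)) (h *\<^sub>R x)" for x :: "real^'n"
    using h by (simp add: indicator_def)
  define F where "F x y = ennreal ((g x - g y)\<^sup>2) * ennreal (1 / norm (y - x) powr ?e) * indicator (ball 0 (h * R)) y" for x y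
  have Fm[measurable]: "case_prod F \<in> borel_measurable (borel \<Otimes>\<^sub>M borel)" unfolding F_def by measurable
  have Fx[measurable]: "F x \<in> borel_measurable borel" for x unfolding F_def by measurable
  have pt: "ennreal ((c * g (h *\<^sub>R x) - c * g (h *\<^sub>R y))\<^sup>2) * ennreal (1 / norm (y - x) powr ?e) * indicator (ball 0 R) y
      = ?k * F (h *\<^sub>R x) (h *\<^sub>R y)" for x y
  proof -
    have n: "norm (h *\<^sub>R y - h *\<^sub>R x) = h * norm (y - x)"
      using h by (simp add: scaleR_diff_right[symmetric])
    have "(c * g (h *\<^sub>R x) - c * g (h *\<^sub>R y))\<^sup>2 * (1 / norm (y - x) powr ?e)
        = c\<^sup>2 * h powr ?e * ((g (h *\<^sub>R x) - g (h *\<^sub>R y))\<^sup>2 * (1 / norm (h *\<^sub>R y - h *\<^sub>R x) powr ?e))"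
      unfolding n using h by (simp add: powr_mult right_diff_distrib[symmetric] power_mult_distrib)
    then have "ennreal ((c * g (h *\<^sub>R x) - c * g (h *\<^sub>R y))\<^sup>2) * ennreal (1 / norm (y - x) powr ?e)
        = ?k * (ennreal ((g (h *\<^sub>R x) - g (h *\<^sub>R y))\<^sup>2) * ennreal (1 / norm (h *\<^sub>R y - h *\<^sub>R x) powr ?e))"
    proof -
      have nn: "0 \<le> c\<^sup>2 * h powr ?e" "0 \<le> (c * g (h *\<^sub>R x) - c * g (h *\<^sub>R y))\<^sup>2"
        "0 \<le> (g (h *\<^sub>R x) - g (h *\<^sub>R y))\<^sup>2" "0 \<le> 1 / norm (h *\<^sub>R y - h *\<^sub>R x) powr ?e" "0 \<le> 1 / norm (y - x) powr ?e"
        by simp_all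
      assume "(c * g (h *\<^sub>R x) - c * g (h *\<^sub>R y))\<^sup>2 * (1 / norm (y - x) powr ?e)
        = c\<^sup>2 * h powr ?e * ((g (h *\<^sub>R x) - g (h *\<^sub>R y))\<^sup>2 * (1 / norm (h *\<^sub>R y - h *\<^sub>R x) powr ?e))"
      from arg_cong[OF this, of ennreal] show ?thesis
        by (simp only: ennreal_mult[OF nn(2,5)] ennreal_mult[OF nn(1) mult_nonneg_nonneg[OF nn(3,4)]] ennreal_mult[OF nn(3,4)])
    qed
    then show ?thesis unfolding F_def ind by (simp only: mult.assoc)
  qed
  have inner: "(\<integral>\<^sup>+y. ?k * F (h *\<^sub>R x) (h *\<^sub>R y) \<partial>lborel) = ?k * (ennreal (1 / h ^ CARD('n)) * (\<integral>\<^sup>+y. F (h *\<^sub>R x) y \<partial>lborel))" for x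
  proof -
    have "(\<integral>\<^sup>+y. ?k * F (h *\<^sub>R x) (h *\<^sub>R y) \<partial>lborel) = ?k * (\<integral>\<^sup>+y. F (h *\<^sub>R x) (h *\<^sub>R y) \<partial>lborel)"
      by (rule nn_integral_cmult) measurable
    also have "(\<integral>\<^sup>+y. F (h *\<^sub>R x) (h *\<^sub>R y) \<partial>lborel) = ennreal (1 / h ^ CARD('n)) * (\<integral>\<^sup>+y. F (h *\<^sub>R x) y \<partial>lborel)"
      using h by (subst lborel_nn_integral_scale) auto
    finally show ?thesis .
  qed
  define Q where "Q x = (\<integral>\<^sup>+y. F x y \<partial>lborel) * indicator (ball 0 (h * R)) x" for x
  have Qm[measurable]: "Q \<in> borel_measurable borel" unfolding Q_def by measurable
  have "slob (ball 0 R) \<sigma> (\<lambda>x. c * g (h *\<^sub>R x)) = (\<integral>\<^sup>+x. ?k * (ennreal (1 / h ^ CARD('n)) * Q (h *\<^sub>R x)) \<partial>lborel)"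
    unfolding slob_def dbl_def pt inner Q_def by (intro nn_integral_cong) (simp add: ind mult.assoc)
  also have "\<dots> = ?k * (ennreal (1 / h ^ CARD('n)) * (ennreal (1 / h ^ CARD('n)) * (\<integral>\<^sup>+x. Q x \<partial>lborel)))"
    using h by (simp add: nn_integral_cmult lborel_nn_integral_scale)
  also have "(\<integral>\<^sup>+x. Q x \<partial>lborel) = slob (ball 0 (h * R)) \<sigma> g"
    unfolding Q_def F_def slob_def dbl_def ..
  also have "?k * (ennreal (1 / h ^ CARD('n)) * (ennreal (1 / h ^ CARD('n)) * slob (ball 0 (h * R)) \<sigma> g))
      = ennreal (c\<^sup>2 * h powr ?e / (h ^ CARD('n))\<^sup>2) * slob (ball 0 (h * R)) \<sigma> g"
  proof -
    have "c\<^sup>2 * h powr ?e / (h ^ CARD('n))\<^sup>2 = c\<^sup>2 * h powr ?e * (1 / h ^ CARD('n) * (1 / h ^ CARD('n)))"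
      by (simp add: power2_eq_square)
    moreover have "ennreal (c\<^sup>2 * h powr ?e * (1 / h ^ CARD('n) * (1 / h ^ CARD('n))))
        = ?k * (ennreal (1 / h ^ CARD('n)) * ennreal (1 / h ^ CARD('n)))"
      using h by (subst ennreal_mult, simp, simp, subst ennreal_mult) simp_all
    ultimately show ?thesis by (simp only: mult.assoc)
  qed
  finally show ?thesis .
qed

section \<open>Weak derivatives under restriction, subtraction and dilation, and of smooth
  functions\<close>

lemma wpart_subset:
  assumes "wpart S i g g'" "T \<subseteq> S" "T \<in> sets borel"
  shows "wpart T i g g'"
  using assms set_integrable_subset[of lborel S _ T] test_functions_mono[of T S] by (auto simp: wpart_def)

lemma wpart_diff:
  assumes g: "wpart S i g g'" and f: "wpart S i f f'"
  shows "wpart S i (\<lambda>x. g x - f x) (\<lambda>x. g' x - f' x)"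
  unfolding wpart_def
proof (intro conjI ballI)
  show "set_integrable lborel S (\<lambda>x. g x - f x)" "set_integrable lborel S (\<lambda>x. g' x - f' x)"
    using g f by (auto simp: wpart_def intro: set_integral_diff)
  show "(\<lambda>x. g x - f x) \<in> borel_measurable borel" "(\<lambda>x. g' x - f' x) \<in> borel_measurable borel"
    using g f by (auto simp: wpart_def)
  fix \<phi> assume \<phi>: "\<phi> \<in> test_functions S"
  have "integrable lborel (\<lambda>x. g x * partial_deriv i \<phi> x)" "integrable lborel (\<lambda>x. f x * partial_deriv i \<phi> x)"
    "integrable lborel (\<lambda>x. g' x * \<phi> x)" "integrable lborel (\<lambda>x. f' x * \<phi> x)"
    using g f integrable_mult_test[OF _ \<phi>] integrable_mult_test[OF _ test_partial[OF \<phi>]] by (auto simp: wpart_def)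
  then show "(LINT x|lborel. (g x - f x) * partial_deriv i \<phi> x) = - (LINT x|lborel. (g' x - f' x) * \<phi> x)"
    using g f \<phi> by (simp add: wpart_def left_diff_distrib)
qed

text \<open>The chain rule is carried out on the side of the test functions:
  \<open>\<phi> (y / h)\<close> is a test function on \<open>S\<close>, and substituting back and
  forth transfers the identity for \<open>g\<close>.\<close>

lemma wpart_scale:
  fixes g :: "real^'n::finite \<Rightarrow> real"
  assumes g: "wpart S i g g'" and h: "h > 0"
  shows "wpart {x. h *\<^sub>R x \<in> S} i (\<lambda>x. c * g (h *\<^sub>R x)) (\<lambda>x. c * h * g' (h *\<^sub>R x))"
proof -
  have [measurable]: "g \<in> borel_measurable borel" "g' \<in> borel_measurable borel" using g by (auto simp: wpart_def)
  have int: "set_integrable lborel {x. h *\<^sub>R x \<in> S} (\<lambda>x. c * f (h *\<^sub>R x))"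
    if "set_integrable lborel S f" for f :: "real^'n \<Rightarrow> real" and c
  proof -
    have i: "integrable lborel (\<lambda>x. indicator S x * f x)" using that by (simp add: set_integrable_def)
    have "integrable lborel (\<lambda>x. indicator S (h *\<^sub>R x) * f (h *\<^sub>R x))"
    proof (rule integrableI_bounded)
      note [measurable] = borel_measurable_integrable[OF i]
      show "(\<lambda>x. indicator S (h *\<^sub>R x) * f (h *\<^sub>R x)) \<in> borel_measurable lborel"
        using measurable_compose[of "\<lambda>x. h *\<^sub>R x" lborel lborel "\<lambda>x. indicator S x * f x" borel] by simp
      have "(\<integral>\<^sup>+x. ennreal (norm (indicator S (h *\<^sub>R x) * f (h *\<^sub>R x))) \<partial>lborel)
          = ennreal (1 / \<bar>h\<bar> ^ DIM(real^'n)) * (\<integral>\<^sup>+x. ennreal (norm (indicator S x * f x)) \<partial>lborel)"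
        using h by (intro lborel_nn_integral_scale[of "\<lambda>x. ennreal (norm (indicator S x * f x))"]) auto
      also have "\<dots> < \<infinity>" using i by (simp add: integrable_iff_bounded ennreal_mult_less_top)
      finally show "(\<integral>\<^sup>+x. ennreal (norm (indicator S (h *\<^sub>R x) * f (h *\<^sub>R x))) \<partial>lborel) < \<infinity>" .
    qed
    then have "integrable lborel (\<lambda>x. c * (indicator S (h *\<^sub>R x) * f (h *\<^sub>R x)))" by simp
    moreover have "(\<lambda>x. indicator {x. h *\<^sub>R x \<in> S} x *\<^sub>R (c * f (h *\<^sub>R x)))
        = (\<lambda>x. c * (indicator S (h *\<^sub>R x) * f (h *\<^sub>R x)))"
      by (rule ext) (simp add: indicator_def)
    ultimately show ?thesis unfolding set_integrable_def by (simp only:)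
  qed
  show ?thesis
    unfolding wpart_def
  proof (intro conjI ballI)
    show "set_integrable lborel {x. h *\<^sub>R x \<in> S} (\<lambda>x. c * g (h *\<^sub>R x))"
      "set_integrable lborel {x. h *\<^sub>R x \<in> S} (\<lambda>x. c * h * g' (h *\<^sub>R x))"
      using g by (auto simp: wpart_def intro!: int)
    fix \<phi> assume \<phi>: "\<phi> \<in> test_functions {x. h *\<^sub>R x \<in> S}"
    define \<psi> where "\<psi> y = \<phi> (0 + (1 / h) *\<^sub>R y)" for y
    have \<psi>: "\<psi> \<in> test_functions S"
      unfolding \<psi>_def
    proof (rule test_affine[OF \<phi>])
      fix x assume "0 + (1 / h) *\<^sub>R x \<in> closure {x. \<phi> x \<noteq> 0}"
      then have "0 + (1 / h) *\<^sub>R x \<in> {x. h *\<^sub>R x \<in> S}" using test_subset[OF \<phi>] by blast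
      then show "x \<in> S" using h by simp
    qed (use h in simp)
    note [measurable] = test_measurable[OF \<psi>] test_measurable[OF test_partial[OF \<psi>]]
    have p: "partial_deriv i \<phi> x = h * partial_deriv i \<psi> (h *\<^sub>R x)" "\<phi> x = \<psi> (h *\<^sub>R x)" for x
      using h partial_deriv_affine[where f = \<phi> and b = 0 and c = "1 / h" and x = "h *\<^sub>R x" and i = i, OF test_differentiable[OF \<phi>]]
      by (auto simp: \<psi>_def[abs_def])
    have "(LINT x|lborel. c * g (h *\<^sub>R x) * partial_deriv i \<phi> x) = c * h * (LINT x|lborel. (\<lambda>y. g y * partial_deriv i \<psi> y) (h *\<^sub>R x))"
      unfolding p by (subst integral_mult_right_zero[symmetric]) (simp add: mult_ac)
    also have "(LINT x|lborel. (\<lambda>y. g y * partial_deriv i \<psi> y) (h *\<^sub>R x)) = (1 / \<bar>h\<bar> ^ DIM(real^'n)) * (LINT y|lborel. g y * partial_deriv i \<psi> y)"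
      using h by (subst lborel_integral_scale) auto
    also have "(LINT y|lborel. g y * partial_deriv i \<psi> y) = - (LINT y|lborel. g' y * \<psi> y)"
      using g \<psi> by (simp add: wpart_def)
    also have "c * h * ((1 / \<bar>h\<bar> ^ DIM(real^'n)) * - (LINT y|lborel. g' y * \<psi> y)) = - (c * h * (LINT x|lborel. (\<lambda>y. g' y * \<psi> y) (h *\<^sub>R x)))"
      using h by (subst lborel_integral_scale) auto
    also have "c * h * (LINT x|lborel. (\<lambda>y. g' y * \<psi> y) (h *\<^sub>R x)) = (LINT x|lborel. c * h * g' (h *\<^sub>R x) * \<phi> x)"
      unfolding p(2) by (subst integral_mult_right_zero[symmetric]) (simp add: mult_ac)
    finally show "(LINT x|lborel. c * g (h *\<^sub>R x) * partial_deriv i \<phi> x) = - (LINT x|lborel. c * h * g' (h *\<^sub>R x) * \<phi> x)" .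
  qed measurable
qed

lemma set_integrable_continuous_bounded:
  fixes p :: "'a::euclidean_space \<Rightarrow> real"
  assumes S: "bounded S" "S \<in> sets borel" and p: "continuous_on UNIV p"
  shows "set_integrable lborel S p"
proof -
  have "compact (closure S)" using S by (simp add: compact_closure)
  then have "set_integrable lborel (closure S) p"
    unfolding set_integrable_def using continuous_on_subset[OF p, of "closure S"]
    by (intro borel_integrable_compact) auto
  then show ?thesis by (rule set_integrable_subset) (use S closure_subset in auto)
qed

text \<open>Integration by parts: the product \<open>p * \<phi>\<close> has compact support, so the
  integral of its partial derivative vanishes, and the product rule splits it into the two
  sides.\<close>

lemma wpart_smooth:
  fixes p :: "real^'n::finite \<Rightarrow> real"
  assumes S: "bounded S" "S \<in> sets borel" and p: "\<And>x. p differentiable (at x)" and q: "continuous_on UNIV (partial_deriv i p)"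
  shows "wpart S i p (partial_deriv i p)"
  unfolding wpart_def
proof (intro conjI ballI)
  have pc: "continuous_on UNIV p"
    using p by (auto intro!: continuous_at_imp_continuous_on differentiable_imp_continuous_within)
  show "p \<in> borel_measurable borel" "partial_deriv i p \<in> borel_measurable borel"
    using pc q by (auto intro: borel_measurable_continuous_onI)
  show si: "set_integrable lborel S p" "set_integrable lborel S (partial_deriv i p)"
    using S pc q by (auto intro: set_integrable_continuous_bounded)
  fix \<phi> assume \<phi>: "\<phi> \<in> test_functions S"
  have d: "((\<lambda>x. p x * \<phi> x) has_derivative (\<lambda>v. p x * frechet_derivative \<phi> (at x) v + frechet_derivative p (at x) v * \<phi> x)) (at x)" for x
    using p by (intro has_derivative_mult test_has_derivative[OF \<phi>]) (simp add: frechet_derivative_works[symmetric])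
  have pd: "partial_deriv i (\<lambda>x. p x * \<phi> x) x = p x * partial_deriv i \<phi> x + partial_deriv i p x * \<phi> x" for x
    by (subst partial_derivI[OF d]) (simp add: partial_deriv_def)
  have "(LINT x|lborel. partial_deriv i (\<lambda>x. p x * \<phi> x) x) = 0"
  proof (rule integral_partial_deriv_zero[OF _ _ test_compact[OF \<phi>]])
    show "(\<lambda>x. p x * \<phi> x) differentiable (at x)" for x using d by (auto simp: differentiable_def)
    show "continuous_on UNIV (partial_deriv i (\<lambda>x. p x * \<phi> x))"
      unfolding pd[abs_def] by (intro continuous_intros pc q test_continuous[OF \<phi>] test_continuous[OF test_partial[OF \<phi>]])
    show "p x * \<phi> x = 0" if "x \<notin> closure {x. \<phi> x \<noteq> 0}" for x
      using that closure_subset[of "{x. \<phi> x \<noteq> 0}"] by auto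
  qed
  then show "(LINT x|lborel. p x * partial_deriv i \<phi> x) = - (LINT x|lborel. partial_deriv i p x * \<phi> x)"
    unfolding pd using integrable_mult_test[OF si(1) test_partial[OF \<phi>]] integrable_mult_test[OF si(2) \<phi>] by simp
qed

subsection \<open>Lipschitz domains\<close>

text \<open>
  In a chart the domain lies below the graph of \<open>\<gamma>\<close>, so moving down by \<open>L |z|\<close> makes room for the segment \<open>z\<close>.
\<close>

lemma lipschitz_chart_chain:
  fixes \<Omega> :: "(real^'n::finite) set"
  assumes v: "norm v = 1" and \<gamma>: "L-lipschitz_on {y. y \<bullet> v = 0} \<gamma>" and r: "r > 0"
    and chart: "\<And>x. x \<in> ball p r \<Longrightarrow> x \<in> \<Omega> \<longleftrightarrow> x \<bullet> v < \<gamma> (x - (x \<bullet> v) *\<^sub>R v)"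
    and x: "x \<in> \<Omega>" "x \<in> ball p (r / (2 * L + 2))" and z: "x + z \<in> \<Omega>" "x + z \<in> ball p (r / (2 * L + 2))"
    and \<tau>: "0 \<le> \<tau>" "\<tau> \<le> 1" and s: "0 \<le> s" "s \<le> norm z" and cases: "\<tau> = 0 \<or> \<tau> = 1 \<or> s = norm z"
  shows "x + \<tau> *\<^sub>R z - s *\<^sub>R L *\<^sub>R v \<in> \<Omega>"
proof -
  \<comment> \<open>Both \<open>x\<close> and \<open>x + z\<close> lie within \<open>\<rho>\<close>
    of \<open>p\<close>, so \<open>norm z < 2 * \<rho>\<close> and the descent has depth at most
    \<open>2 * \<rho> * L\<close>. The choice of \<open>\<rho>\<close> makes
    \<open>\<rho> + 2 * \<rho> * L \<le> r\<close>, so the detour stays in the chart.\<close>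
  define \<rho> where "\<rho> = r / (2 * L + 2)"
  have L: "L \<ge> 0" using \<gamma> by (rule lipschitz_on_nonneg)
  have \<rho>: "\<rho> > 0" "\<rho> \<le> r" using r L by (auto simp: \<rho>_def field_simps)
  have v2: "v \<bullet> v = 1" using v by (simp add: norm_eq_sqrt_inner)
  define \<pi> where "\<pi> a = a - (a \<bullet> v) *\<^sub>R v" for a
  have \<pi>H: "\<pi> a \<in> {y. y \<bullet> v = 0}" for a by (simp add: \<pi>_def inner_diff_left v2)
  have \<pi>n: "norm (\<pi> a) \<le> norm a" for a
  proof -
    have "(norm (\<pi> a))\<^sup>2 = (norm a)\<^sup>2 - (a \<bullet> v)\<^sup>2"
      unfolding power2_norm_eq_inner
      by (simp add: \<pi>_def inner_diff_left inner_diff_right v2 inner_commute power2_eq_square)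
    then have "(norm (\<pi> a))\<^sup>2 \<le> (norm a)\<^sup>2" by simp
    then show ?thesis by (rule power2_le_imp_le) simp
  qed
  have \<pi>d: "\<pi> a - \<pi> b = \<pi> (a - b)" for a b by (simp add: \<pi>_def inner_diff_left algebra_simps)
  have lip: "\<gamma> (\<pi> a) \<le> \<gamma> (\<pi> b) + L * norm (a - b)" for a b
  proof -
    have "dist (\<gamma> (\<pi> a)) (\<gamma> (\<pi> b)) \<le> L * dist (\<pi> a) (\<pi> b)"
      by (rule lipschitz_onD[OF \<gamma> \<pi>H \<pi>H])
    also have "\<dots> \<le> L * norm (a - b)" using L \<pi>n[of "a - b"] by (intro mult_left_mono) (auto simp: dist_norm \<pi>d)
    finally show ?thesis by (simp add: dist_real_def)
  qed
  have ch: "a \<in> \<Omega> \<longleftrightarrow> a \<bullet> v < \<gamma> (\<pi> a)" if "a \<in> ball p r" for a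
    using chart[OF that] by (simp only: \<pi>_def)
  define y where "y = x + \<tau> *\<^sub>R z"
  have yv: "(y - s *\<^sub>R L *\<^sub>R v) \<bullet> v = y \<bullet> v - s * L" by (simp add: inner_diff_left v2)
  have y\<pi>: "\<pi> (y - s *\<^sub>R L *\<^sub>R v) = \<pi> y" by (simp add: \<pi>_def inner_diff_left v2 algebra_simps)
  have ball: "a \<in> ball p r" if "a \<in> ball p \<rho>" for a using that \<rho> by auto
  have below: "x \<bullet> v < \<gamma> (\<pi> x)" "(x + z) \<bullet> v < \<gamma> (\<pi> (x + z))"
    using chart[of x] chart[of "x + z"] x z ball by (auto simp: \<pi>_def \<rho>_def)
  have sL: "0 \<le> s * L" using s L by simp
  \<comment> \<open>The three cases are the vertical segment below \<open>x\<close>, the one below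
    \<open>x + z\<close>, and the segment joining their lower ends at full depth
    \<open>L * norm z\<close>.\<close>
  have "y \<bullet> v - s * L < \<gamma> (\<pi> y)"
    using cases
  proof (elim disjE)
    assume "s = norm z"
    \<comment> \<open>Both ends lie below the graph over their own projections. The Lipschitz bound
      compares these heights with the one over \<open>\<pi> y\<close> at a cost of
      \<open>L * norm z\<close>, and a convex combination of the two inequalities treats
      \<open>y\<close>.\<close>
    have yx: "norm (x - y) \<le> norm z" using \<tau> by (simp add: y_def mult_left_le_one_le)
    have "(x + z) - y = (1 - \<tau>) *\<^sub>R z" by (simp add: y_def algebra_simps)
    then have yz: "norm ((x + z) - y) \<le> norm z" using \<tau> by (simp add: mult_left_le_one_le)
    have 1: "x \<bullet> v < \<gamma> (\<pi> y) + L * norm z"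
      using below(1) lip[of x y] mult_left_mono[OF yx L] by linarith
    have 2: "(x + z) \<bullet> v < \<gamma> (\<pi> y) + L * norm z"
      using below(2) lip[of "x + z" y] mult_left_mono[OF yz L] by linarith
    have "y \<bullet> v = (1 - \<tau>) * (x \<bullet> v) + \<tau> * ((x + z) \<bullet> v)"
      by (simp add: y_def inner_add_left algebra_simps)
    also have "\<dots> < \<gamma> (\<pi> y) + L * norm z"
      using 1 2 \<tau> by (intro convex_bound_lt) auto
    finally show ?thesis using \<open>s = norm z\<close> by (simp add: mult.commute)
  qed (use below sL in \<open>auto simp: y_def\<close>)
  moreover have "y - s *\<^sub>R L *\<^sub>R v \<in> ball p r"
  proof -
    have "x \<in> ball p \<rho>" "x + z \<in> ball p \<rho>" using x z by (auto simp: \<rho>_def)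
    moreover have "y = (1 - \<tau>) *\<^sub>R x + \<tau> *\<^sub>R (x + z)" by (simp add: y_def algebra_simps)
    ultimately have "y \<in> ball p \<rho>" using convexD_alt[OF convex_ball] \<tau> by metis
    then have 1: "norm (p - y) < \<rho>" by (simp add: dist_norm)
    have "norm z \<le> norm (p - x) + norm (p - (x + z))"
      using norm_triangle_ineq4[of "p - x" "p - (x + z)"] by simp
    also have "\<dots> < 2 * \<rho>" using \<open>x \<in> ball p \<rho>\<close> \<open>x + z \<in> ball p \<rho>\<close> by (simp add: dist_norm)
    finally have "s \<le> 2 * \<rho>" using s by simp
    then have "norm (s *\<^sub>R L *\<^sub>R v) \<le> 2 * \<rho> * L" using s L v by (simp add: mult_right_mono)
    moreover have "norm (p - (y - s *\<^sub>R L *\<^sub>R v)) \<le> norm (p - y) + norm (s *\<^sub>R L *\<^sub>R v)"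
      using norm_triangle_ineq[of "p - y" "s *\<^sub>R L *\<^sub>R v"] by (simp add: algebra_simps)
    ultimately have "norm (p - (y - s *\<^sub>R L *\<^sub>R v)) < \<rho> + 2 * \<rho> * L" using 1 by linarith
    also have "\<rho> + 2 * \<rho> * L \<le> \<rho> * (2 * L + 2)" using \<rho> by (simp add: algebra_simps)
    also have "\<dots> = r" using L by (simp add: \<rho>_def)
    finally show ?thesis by (simp add: dist_norm)
  qed
  ultimately have "y - s *\<^sub>R L *\<^sub>R v \<in> \<Omega>"
    using ch[of "y - s *\<^sub>R L *\<^sub>R v"] by (simp only: yv y\<pi>)
  then show ?thesis by (simp add: y_def)
qed

text \<open>A Lebesgue number argument. About each point of the closure a single vector works on a
  whole ball: \<open>0\<close> at interior points, \<open>L *\<^sub>R v\<close> at boundary points.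
  Finitely many balls of half the radius cover the compact closure; with \<open>\<delta>\<close> at
  most each half radius, \<open>x\<close> and \<open>x + z\<close> lie in one common full
  ball.\<close>

lemma lipschitz_domain_chained:
  fixes \<Omega> :: "(real^'n::finite) set"
  assumes "bounded_lipschitz_domain \<Omega>"
  obtains \<delta> W where "\<delta> > 0" "finite W" "chained \<Omega> \<delta> W"
proof -
  have \<Omega>: "open \<Omega>" "bounded \<Omega>" "\<Omega> \<noteq> {}" using assms by (auto simp: bounded_lipschitz_domain_def)
  define good where "good p r w \<longleftrightarrow> (\<forall>x z. x \<in> \<Omega> \<and> x \<in> ball p r \<and> x + z \<in> \<Omega> \<and> x + z \<in> ball p r \<longrightarrow>
      segment_in \<Omega> x (- (norm z *\<^sub>R w)) \<and> segment_in \<Omega> (- (norm z *\<^sub>R w) + x) z \<and>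
      segment_in \<Omega> (z + x) (- (norm z *\<^sub>R w)))" for p w :: "real^'n" and r
  have "\<exists>r w. r > 0 \<and> good p r w" if p: "p \<in> closure \<Omega>" for p
  proof (cases "p \<in> \<Omega>")
    case True
    then obtain r where r: "r > 0" "ball p r \<subseteq> \<Omega>" using \<Omega>(1) by (auto simp: open_contains_ball)
    have "good p r 0"
      unfolding good_def
    proof (intro allI impI)
      fix x z assume a: "x \<in> \<Omega> \<and> x \<in> ball p r \<and> x + z \<in> \<Omega> \<and> x + z \<in> ball p r"
      have "x + t *\<^sub>R z \<in> ball p r" if "t \<in> {0..1}" for t
        using convexD_alt[OF convex_ball, of x p r "x + z" t] a that by (simp add: algebra_simps)
      then show "segment_in \<Omega> x (- (norm z *\<^sub>R 0)) \<and> segment_in \<Omega> (- (norm z *\<^sub>R 0) + x) z \<and> segment_in \<Omega> (z + x) (- (norm z *\<^sub>R 0))"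
        using a r by (auto simp: segment_in_def add.commute)
    qed
    with r show ?thesis by blast
  next
    case False
    then have "p \<in> frontier \<Omega>" using p \<Omega>(1) by (simp add: frontier_def interior_open)
    then obtain v r L \<gamma> where c: "norm v = 1" "r > 0" "L-lipschitz_on {y. y \<bullet> v = 0} \<gamma>"
      "\<And>x. x \<in> ball p r \<Longrightarrow> x \<in> \<Omega> \<longleftrightarrow> x \<bullet> v < \<gamma> (x - (x \<bullet> v) *\<^sub>R v)"
      using assms unfolding bounded_lipschitz_domain_def by blast
    have L: "L \<ge> 0" using c(3) by (rule lipschitz_on_nonneg)
    have "good p (r / (2 * L + 2)) (L *\<^sub>R v)"
      unfolding good_def
    proof (intro allI impI)
      fix x z assume a: "x \<in> \<Omega> \<and> x \<in> ball p (r / (2 * L + 2)) \<and> x + z \<in> \<Omega> \<and> x + z \<in> ball p (r / (2 * L + 2))"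
      have *: "x + \<tau> *\<^sub>R z - s *\<^sub>R L *\<^sub>R v \<in> \<Omega>" if "0 \<le> \<tau>" "\<tau> \<le> 1" "0 \<le> s" "s \<le> norm z" "\<tau> = 0 \<or> \<tau> = 1 \<or> s = norm z" for \<tau> s
        by (rule lipschitz_chart_chain[OF c(1,3,2,4), where z = z]) (use a that in auto)
      have "segment_in \<Omega> x (- (norm z *\<^sub>R (L *\<^sub>R v)))"
        unfolding segment_in_def
      proof
        fix t :: real assume "t \<in> {0..1}"
        then show "x + t *\<^sub>R - (norm z *\<^sub>R L *\<^sub>R v) \<in> \<Omega>"
          using *[of 0 "t * norm z"] by (simp add: mult_left_le_one_le mult.assoc)
      qed
      moreover have "segment_in \<Omega> (- (norm z *\<^sub>R (L *\<^sub>R v)) + x) z"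
        unfolding segment_in_def
      proof
        fix t :: real assume "t \<in> {0..1}"
        then show "- (norm z *\<^sub>R L *\<^sub>R v) + x + t *\<^sub>R z \<in> \<Omega>"
          using *[of t "norm z"] by (simp add: algebra_simps)
      qed
      moreover have "segment_in \<Omega> (z + x) (- (norm z *\<^sub>R (L *\<^sub>R v)))"
        unfolding segment_in_def
      proof
        fix t :: real assume "t \<in> {0..1}"
        then show "z + x + t *\<^sub>R - (norm z *\<^sub>R L *\<^sub>R v) \<in> \<Omega>"
          using *[of 1 "t * norm z"] by (simp add: mult_left_le_one_le add.commute mult.assoc)
      qed
      ultimately show "segment_in \<Omega> x (- (norm z *\<^sub>R (L *\<^sub>R v))) \<and> segment_in \<Omega> (- (norm z *\<^sub>R (L *\<^sub>R v)) + x) z \<and>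
          segment_in \<Omega> (z + x) (- (norm z *\<^sub>R (L *\<^sub>R v)))" by blast
    qed
    moreover have "r / (2 * L + 2) > 0" using c(2) L by simp
    ultimately show ?thesis by blast
  qed
  then obtain r w where rw: "\<And>p. p \<in> closure \<Omega> \<Longrightarrow> r p > 0" "\<And>p. p \<in> closure \<Omega> \<Longrightarrow> good p (r p) (w p)" by metis
  have "compact (closure \<Omega>)" using \<Omega> by (simp add: compact_closure)
  moreover have "open (ball p (r p / 2))" for p by simp
  moreover have "closure \<Omega> \<subseteq> (\<Union>p\<in>closure \<Omega>. ball p (r p / 2))" using rw(1) by force
  ultimately obtain P where P: "P \<subseteq> closure \<Omega>" "finite P" "closure \<Omega> \<subseteq> (\<Union>p\<in>P. ball p (r p / 2))"
    by (rule compactE_image)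
  have Pne: "P \<noteq> {}" using P(3) \<Omega>(3) by auto
  define \<delta> where "\<delta> = Min ((\<lambda>p. r p / 2) ` P)"
  have \<delta>: "\<delta> > 0"
    unfolding \<delta>_def using P(1,2) Pne rw(1) by (subst Min_gr_iff) auto
  have \<delta>r: "\<delta> \<le> r p / 2" if "p \<in> P" for p
    unfolding \<delta>_def using P(2) that by (intro Min_le) auto
  have "chained \<Omega> \<delta> (w ` P)"
    unfolding chained_def
  proof (intro ballI allI impI)
    fix x z assume x: "x \<in> \<Omega>" and z: "x + z \<in> \<Omega> \<and> norm z < \<delta>"
    obtain p where p: "p \<in> P" "x \<in> ball p (r p / 2)" using P(3) x closure_subset[of \<Omega>] by blast
    have "dist p (x + z) \<le> dist p x + norm z" using dist_triangle[of p "x + z" x] by (simp add: dist_norm)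
    then have "x + z \<in> ball p (r p)" "x \<in> ball p (r p)" using p \<delta> \<delta>r[OF p(1)] z zero_le_dist[of p x] by auto
    then show "\<exists>w\<in>w ` P. segment_in \<Omega> x (- (norm z *\<^sub>R w)) \<and> segment_in \<Omega> (- (norm z *\<^sub>R w) + x) z \<and>
        segment_in \<Omega> (z + x) (- (norm z *\<^sub>R w))"
      using rw(2)[of p] p P(1) x z unfolding good_def by blast
  qed
  with \<delta> P(2) show thesis using that by blast
qed

subsection \<open>Growth of the derivatives at a point\<close>

text \<open>
  A jet is the family of all weak derivatives of a function, represented by everywhere defined Borel
  functions; entries of order greater than \<open>M\<close> are arbitrary. In \<open>jet_le\<close> each of the squared
  seminorms that make up the Sobolev norm of order \<open>m\<close> is at most \<open>E\<close>.
\<close>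

definition jet :: "nat \<Rightarrow> (real^'n::finite) set \<Rightarrow> (('n \<Rightarrow> nat) \<Rightarrow> real^'n \<Rightarrow> real) \<Rightarrow> bool" where
  "jet M S g \<longleftrightarrow> (\<forall>\<alpha>. multi_order \<alpha> \<le> M \<longrightarrow> g \<alpha> \<in> borel_measurable borel \<and> l2sq S (g \<alpha>) < \<infinity>) \<and>
     (\<forall>\<alpha> i. multi_order \<alpha> < M \<longrightarrow> wpart S i (g \<alpha>) (g (\<alpha>(i := Suc (\<alpha> i)))))"

definition jet_le :: "real \<Rightarrow> (real^'n::finite) set \<Rightarrow> (('n \<Rightarrow> nat) \<Rightarrow> real^'n \<Rightarrow> real) \<Rightarrow> real \<Rightarrow> bool" where
  "jet_le m S g E \<longleftrightarrow> jet (nat \<lfloor>m\<rfloor>) S g \<and> 0 \<le> E \<and>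
     (\<forall>\<alpha>. multi_order \<alpha> \<le> nat \<lfloor>m\<rfloor> \<longrightarrow> l2sq S (g \<alpha>) \<le> ennreal E) \<and>
     (frac m \<noteq> 0 \<longrightarrow> (\<forall>\<alpha>. multi_order \<alpha> = nat \<lfloor>m\<rfloor> \<longrightarrow> slob S (frac m) (g \<alpha>) \<le> ennreal E))"

lemma multi_order_upd: "multi_order (\<alpha>(i := Suc (\<alpha> i))) = Suc (multi_order \<alpha>)"
proof -
  have "multi_order (\<alpha>(i := Suc (\<alpha> i))) = Suc (\<alpha> i) + (\<Sum>j\<in>UNIV - {i}. \<alpha> j)"
    unfolding multi_order_def by (subst sum.remove[of _ i]) auto
  moreover have "multi_order \<alpha> = \<alpha> i + (\<Sum>j\<in>UNIV - {i}. \<alpha> j)"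
    unfolding multi_order_def by (subst sum.remove[of _ i]) auto
  ultimately show ?thesis by simp
qed

lemma dyadic_scale_exists:
  fixes \<rho> R :: real
  assumes "0 < \<rho>" "\<rho> \<le> R"
  shows "\<exists>j. R / 2 ^ Suc j < \<rho> \<and> \<rho> \<le> R / 2 ^ j"
proof -
  have "(\<lambda>j. R * (1 / 2) ^ j) \<longlonglongrightarrow> R * 0"
    by (intro tendsto_mult tendsto_const LIMSEQ_realpow_zero) auto
  then have "\<forall>\<^sub>F j in sequentially. R * (1 / 2) ^ j < \<rho>"
    using assms by (intro order_tendstoD) auto
  then obtain j0 where "R * (1 / 2) ^ j0 < \<rho>"
    using eventually_happens'[OF sequentially_bot] by blast
  then have ex: "\<exists>j. R / 2 ^ j < \<rho>" by (auto simp: power_one_over)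
  define j where "j = (LEAST j. R / 2 ^ j < \<rho>)"
  have j: "R / 2 ^ j < \<rho>" unfolding j_def using ex by (rule LeastI_ex)
  have "j \<noteq> 0"
  proof
    assume "j = 0"
    with j assms show False by simp
  qed
  then obtain k where k: "j = Suc k" by (cases j) auto
  have "\<not> R / 2 ^ k < \<rho>" using not_less_Least[of k "\<lambda>j. R / 2 ^ j < \<rho>"] k by (simp add: j_def[symmetric])
  then show ?thesis using j k by auto
qed

text \<open>Since \<open>lam < 2 powr (- e)\<close>, the homogeneous part of the recursion decays
  faster than \<open>\<rho> powr e\<close>, so the inhomogeneous term dictates the rate. Running the
  induction over dyadic shells rather than over the radii \<open>R / 2^j\<close> covers every
  \<open>\<rho>\<close>. The constant is obtained before \<open>N\<close> and \<open>E\<close>,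
  which gives uniformity over all functions and centres.\<close>

lemma growth_iteration:
  fixes R lam k e :: real
  assumes R: "R > 0" and lam: "0 \<le> lam" "lam < 2 powr (- e)" and k: "k \<ge> 0" and e: "e \<ge> 0"
  obtains C where "C \<ge> 0"
    "\<And>N E \<rho>. \<lbrakk>E \<ge> 0; \<And>\<rho>. 0 < \<rho> \<Longrightarrow> \<rho> \<le> R \<Longrightarrow> N \<rho> \<le> E;
       \<And>\<rho>. 0 < \<rho> \<Longrightarrow> \<rho> \<le> R \<Longrightarrow> N (\<rho> / 2) \<le> lam * N \<rho> + k * E * \<rho> powr e; 0 < \<rho>; \<rho> \<le> R\<rbrakk>
       \<Longrightarrow> N \<rho> \<le> C * E * \<rho> powr e"
proof -
  \<comment> \<open>The first entry settles the shell between \<open>R / 2\<close> and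
    \<open>R\<close>; the second makes the induction step close, as
    \<open>lam * C + k \<le> C * 2 powr (- e)\<close>.\<close>
  define C where "C = max ((R / 2) powr (- e)) (k / (2 powr (- e) - lam))"
  have C: "C \<ge> (R / 2) powr (- e)" "C \<ge> k / (2 powr (- e) - lam)" by (auto simp: C_def)
  have C0: "C \<ge> 0" using C(1) powr_ge_zero[of "R / 2" "- e"] by linarith
  show thesis
  proof (rule that[OF C0])
    fix N :: "real \<Rightarrow> real" and E \<rho> :: real
    assume E: "E \<ge> 0" and N1: "\<And>\<rho>. 0 < \<rho> \<Longrightarrow> \<rho> \<le> R \<Longrightarrow> N \<rho> \<le> E"
      and N2: "\<And>\<rho>. 0 < \<rho> \<Longrightarrow> \<rho> \<le> R \<Longrightarrow> N (\<rho> / 2) \<le> lam * N \<rho> + k * E * \<rho> powr e"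
      and \<rho>: "0 < \<rho>" "\<rho> \<le> R"
    have "\<forall>\<rho>. R / 2 ^ Suc j < \<rho> \<and> \<rho> \<le> R / 2 ^ j \<longrightarrow> N \<rho> \<le> C * E * \<rho> powr e" for j
    proof (induction j)
      case 0
      show ?case
      proof (intro allI impI)
        fix \<rho> assume r: "R / 2 ^ Suc 0 < \<rho> \<and> \<rho> \<le> R / 2 ^ 0"
        have "1 = (R / 2) powr (- e) * (R / 2) powr e" using R by (simp add: powr_add[symmetric])
        also have "\<dots> \<le> C * \<rho> powr e" using r R e C C0 by (intro mult_mono powr_mono2) auto
        finally have "E * 1 \<le> E * (C * \<rho> powr e)" using E by (intro mult_left_mono) auto
        moreover have "N \<rho> \<le> E" using r R by (intro N1) auto
        ultimately show "N \<rho> \<le> C * E * \<rho> powr e" by (simp add: mult_ac)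
      qed
    next
      case (Suc j)
      show ?case
      proof (intro allI impI)
        fix \<rho> assume r: "R / 2 ^ Suc (Suc j) < \<rho> \<and> \<rho> \<le> R / 2 ^ Suc j"
        have r0: "0 < \<rho>" using r R by (auto intro: less_trans[rotated])
        have r2: "R / 2 ^ Suc j < 2 * \<rho> \<and> 2 * \<rho> \<le> R / 2 ^ j" using r by (auto simp: field_simps)
        have "R / 2 ^ j \<le> R" using R by (simp add: field_simps)
        then have rR: "2 * \<rho> \<le> R" using r2 by linarith
        have "N \<rho> \<le> lam * N (2 * \<rho>) + k * E * (2 * \<rho>) powr e" using N2[of "2 * \<rho>"] r0 rR by simp
        also have "\<dots> \<le> lam * (C * E * (2 * \<rho>) powr e) + k * E * (2 * \<rho>) powr e"
          using Suc r2 lam by (intro add_right_mono mult_left_mono) auto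
        also have "\<dots> = (lam * C + k) * (E * (2 * \<rho>) powr e)" by (simp add: algebra_simps)
        also have "\<dots> \<le> (C * 2 powr (- e)) * (E * (2 * \<rho>) powr e)"
        proof (intro mult_right_mono)
          have "k \<le> C * (2 powr (- e) - lam)" using C(2) lam by (simp add: field_simps)
          then show "lam * C + k \<le> C * 2 powr (- e)" by (simp add: algebra_simps)
        qed (use E in auto)
        also have "\<dots> = C * E * \<rho> powr e" using r0 by (simp add: powr_mult powr_minus field_simps)
        finally show "N \<rho> \<le> C * E * \<rho> powr e" .
      qed
    qed
    with dyadic_scale_exists[OF \<rho>] show "N \<rho> \<le> C * E * \<rho> powr e" by blast
  qed
qed

text \<open>Young's inequality with a free weight. A coefficient close to \<open>1\<close> in front
  of the second summand is what later keeps the contraction factor below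
  \<open>2 powr (- e)\<close>.\<close>

lemma l2sq_add_le:
  assumes [measurable]: "S \<in> sets borel" "f \<in> borel_measurable borel" "g \<in> borel_measurable borel" and \<eta>: "\<eta> > 0"
  shows "l2sq S (\<lambda>x. f x + g x) \<le> ennreal (1 + 1 / \<eta>) * l2sq S f + ennreal (1 + \<eta>) * l2sq S g"
proof -
  have sq: "ennreal ((a + b)\<^sup>2) \<le> ennreal (1 + 1 / \<eta>) * ennreal (a\<^sup>2) + ennreal (1 + \<eta>) * ennreal (b\<^sup>2)" for a b :: real
  proof -
    have "0 \<le> (a - \<eta> * b)\<^sup>2 / \<eta>" using \<eta> by simp
    also have "\<dots> = a\<^sup>2 / \<eta> - 2 * a * b + \<eta> * b\<^sup>2" using \<eta> by (simp add: power2_eq_square field_simps)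
    finally have "(a + b)\<^sup>2 \<le> (1 + 1 / \<eta>) * a\<^sup>2 + (1 + \<eta>) * b\<^sup>2" by (simp add: power2_eq_square algebra_simps)
    then have "ennreal ((a + b)\<^sup>2) \<le> ennreal ((1 + 1 / \<eta>) * a\<^sup>2 + (1 + \<eta>) * b\<^sup>2)" by (rule ennreal_leI)
    also have "\<dots> = ennreal ((1 + 1 / \<eta>) * a\<^sup>2) + ennreal ((1 + \<eta>) * b\<^sup>2)" using \<eta> by (intro ennreal_plus) auto
    also have "\<dots> = ennreal (1 + 1 / \<eta>) * ennreal (a\<^sup>2) + ennreal (1 + \<eta>) * ennreal (b\<^sup>2)"
      using \<eta> by (subst (1 2) ennreal_mult) (auto simp del: ennreal_plus)
    finally show ?thesis .
  qed
  have "l2sq S (\<lambda>x. f x + g x) \<le> (\<integral>\<^sup>+x. ennreal (1 + 1 / \<eta>) * (ennreal ((f x)\<^sup>2) * indicator S x) + ennreal (1 + \<eta>) * (ennreal ((g x)\<^sup>2) * indicator S x) \<partial>lborel)"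
    unfolding l2sq_def
  proof (rule nn_integral_mono)
    fix x
    show "ennreal ((f x + g x)\<^sup>2) * indicator S x \<le> ennreal (1 + 1 / \<eta>) * (ennreal ((f x)\<^sup>2) * indicator S x) + ennreal (1 + \<eta>) * (ennreal ((g x)\<^sup>2) * indicator S x)"
      using sq[of "f x" "g x"] by (cases "x \<in> S") (auto simp del: ennreal_plus)
  qed
  also have "\<dots> = ennreal (1 + 1 / \<eta>) * l2sq S f + ennreal (1 + \<eta>) * l2sq S g"
    unfolding l2sq_def by (simp add: nn_integral_add nn_integral_cmult del: ennreal_plus)
  finally show ?thesis .
qed

lemma jet_subset:
  assumes g: "jet M S g" and T: "T \<subseteq> S" "T \<in> sets borel"
  shows "jet M T g"
  unfolding jet_def
proof (intro conjI allI impI)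
  fix \<alpha> :: "'a \<Rightarrow> nat" assume \<alpha>: "multi_order \<alpha> \<le> M"
  show "g \<alpha> \<in> borel_measurable borel" using g \<alpha> by (simp add: jet_def)
  show "l2sq T (g \<alpha>) < \<infinity>" by (rule order.strict_trans1[OF l2sq_mono[OF T(1)]]) (use g \<alpha> in \<open>simp add: jet_def\<close>)
next
  fix \<alpha> :: "'a \<Rightarrow> nat" and i assume \<alpha>: "multi_order \<alpha> < M"
  show "wpart T i (g \<alpha>) (g (\<alpha>(i := Suc (\<alpha> i))))"
    by (rule wpart_subset[OF _ T]) (use g \<alpha> in \<open>simp add: jet_def\<close>)
qed

lemma jet_le_subset:
  assumes g: "jet_le m S g E" and T: "T \<subseteq> S" "T \<in> sets borel"
  shows "jet_le m T g E"
  unfolding jet_le_def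
proof (intro conjI allI impI)
  show "jet (nat \<lfloor>m\<rfloor>) T g" "0 \<le> E" using g jet_subset[OF _ T] by (auto simp: jet_le_def)
  fix \<alpha> :: "'a \<Rightarrow> nat"
  show "l2sq T (g \<alpha>) \<le> ennreal E" if "multi_order \<alpha> \<le> nat \<lfloor>m\<rfloor>"
    by (rule order_trans[OF l2sq_mono[OF T(1)]]) (use g that in \<open>simp add: jet_le_def\<close>)
  show "slob T (frac m) (g \<alpha>) \<le> ennreal E" if "frac m \<noteq> 0" "multi_order \<alpha> = nat \<lfloor>m\<rfloor>"
    by (rule order_trans[OF slob_mono[OF T(1)]]) (use g that in \<open>simp add: jet_le_def\<close>)
qed

lemma powr_le_powr_scaled:
  fixes \<rho> R a b :: real
  assumes "0 < \<rho>" "\<rho> \<le> R" "b \<le> a"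
  shows "\<rho> powr a \<le> R powr (a - b) * \<rho> powr b"
proof -
  have "\<rho> powr a = \<rho> powr (a - b) * \<rho> powr b" by (simp add: powr_add[symmetric])
  also have "\<dots> \<le> R powr (a - b) * \<rho> powr b" using assms by (intro mult_right_mono powr_mono2) auto
  finally show ?thesis .
qed

text \<open>Growth rates for \<open>l2sq\<close> and for \<open>osc\<close> share this format. The
  constant precedes centre, jet and radius, so it is uniform in all three. As \<open>E\<close>
  bounds squared norms, \<open>e\<close> is twice the exponent of the norm.\<close>

definition jet_bound :: "real \<Rightarrow> real \<Rightarrow> nat \<Rightarrow> ((real^'n::finite) set \<Rightarrow> (real^'n \<Rightarrow> real) \<Rightarrow> ennreal) \<Rightarrow>
    real \<Rightarrow> real \<Rightarrow> bool" where
  "jet_bound m R k F C e \<longleftrightarrow> 0 \<le> C \<and>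
     (\<forall>x0 g E \<alpha> \<rho>. jet_le m (ball x0 R) g E \<longrightarrow> multi_order \<alpha> = k \<longrightarrow> 0 < \<rho> \<longrightarrow> \<rho> \<le> R \<longrightarrow>
        F (ball x0 \<rho>) (g \<alpha>) \<le> ennreal (C * E * \<rho> powr e))"

lemma jet_boundI:
  assumes "0 \<le> C"
    and "\<And>x0 g E \<alpha> \<rho>. \<lbrakk>jet_le m (ball x0 R) g E; multi_order \<alpha> = k; 0 < \<rho>; \<rho> \<le> R; 0 \<le> E; jet_le m (ball x0 \<rho>) g E\<rbrakk>
      \<Longrightarrow> F (ball x0 \<rho>) (g \<alpha>) \<le> ennreal (C * E * \<rho> powr e)"
  shows "jet_bound m R k F C e"
  unfolding jet_bound_def
proof (intro conjI allI impI assms)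
  fix x0 g E \<rho>
  assume J: "jet_le m (ball x0 R) g E" and \<rho>: "0 < \<rho>" "\<rho> \<le> R"
  show "0 \<le> E" using J by (simp add: jet_le_def)
  show "jet_le m (ball x0 \<rho>) g E" by (rule jet_le_subset[OF J]) (use \<rho> in auto)
qed

lemma jet_boundD:
  assumes "jet_bound m R k F C e" "jet_le m (ball x0 R) g E" "multi_order \<alpha> = k" "0 < \<rho>" "\<rho> \<le> R"
  shows "F (ball x0 \<rho>) (g \<alpha>) \<le> ennreal (C * E * \<rho> powr e)"
  using assms by (simp add: jet_bound_def)

lemma jet_bound_weaken:
  fixes F :: "(real^'n::finite) set \<Rightarrow> (real^'n \<Rightarrow> real) \<Rightarrow> ennreal"
  assumes B: "jet_bound m R k F B e'" and e: "e \<le> e'"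
  shows "jet_bound m R k F (B * R powr (e' - e)) e"
proof (rule jet_boundI)
  show "0 \<le> B * R powr (e' - e)" using B by (simp add: jet_bound_def)
  fix x0 :: "real^'n" and g E \<rho> and \<alpha> :: "'n \<Rightarrow> nat"
  assume J: "jet_le m (ball x0 R) g E" and \<alpha>: "multi_order \<alpha> = k" and \<rho>: "0 < \<rho>" "\<rho> \<le> R" and E: "0 \<le> E"
  have "F (ball x0 \<rho>) (g \<alpha>) \<le> ennreal (B * E * \<rho> powr e')"
    by (rule jet_boundD[OF B J \<alpha> \<rho>])
  also have "\<dots> \<le> ennreal (B * E * (R powr (e' - e) * \<rho> powr e))"
    using B E by (intro ennreal_leI mult_left_mono powr_le_powr_scaled[OF \<rho> e]) (simp add: jet_bound_def)
  also have "B * E * (R powr (e' - e) * \<rho> powr e) = B * R powr (e' - e) * E * \<rho> powr e" by (simp add: mult_ac)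
  finally show "F (ball x0 \<rho>) (g \<alpha>) \<le> ennreal (B * R powr (e' - e) * E * \<rho> powr e)" .
qed

text \<open>
  With \<open>a\<close> the mean over the ball of radius \<open>\<rho>\<close>, halving the radius multiplies the norm of the
  constant \<open>a\<close> by \<open>2 ^ (- d / 2)\<close>, which beats \<open>\<rho> powr (e / 2)\<close> because \<open>e < d\<close>.
\<close>

lemma jet_bound_l2sq_of_osc:
  assumes R: "R > 0" and j: "j \<le> nat \<lfloor>m\<rfloor>" and e: "0 \<le> e" "e < real CARD('n)"
    and osc: "jet_bound m R j (osc :: (real^'n::finite) set \<Rightarrow> _) k e"
  shows "\<exists>C. jet_bound m R j (l2sq :: (real^'n) set \<Rightarrow> _) C e"
proof -
  have k: "k \<ge> 0" using osc by (simp add: jet_bound_def)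
  \<comment> \<open>Half of the available gap: \<open>1 + \<eta>\<close> stays below
    \<open>2 powr (d - e)\<close>, hence \<open>lam\<close> below \<open>2 powr (- e)\<close>. A
    positive \<open>\<eta>\<close> exists because \<open>e < d\<close>.\<close>
  define \<eta> where "\<eta> = (2 powr (real CARD('n) - e) - 1) / 2"
  have "2 powr (real CARD('n) - e) > 2 powr 0" using e by (intro powr_less_mono) auto
  then have \<eta>: "\<eta> > 0" "1 + \<eta> < 2 powr (real CARD('n) - e)" by (auto simp: \<eta>_def field_simps)
  define lam where "lam = (1 + \<eta>) / 2 ^ CARD('n)"
  have lam: "0 \<le> lam" "lam < 2 powr (- e)"
    using \<eta> by (auto simp: lam_def powr_diff powr_minus powr_realpow field_simps)
  have k': "(1 + 1 / \<eta>) * k \<ge> 0" using \<eta> k by simp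
  obtain C where C: "C \<ge> 0" and iter: "\<And>N E \<rho>. \<lbrakk>E \<ge> 0; \<And>\<rho>. 0 < \<rho> \<Longrightarrow> \<rho> \<le> R \<Longrightarrow> N \<rho> \<le> E;
       \<And>\<rho>. 0 < \<rho> \<Longrightarrow> \<rho> \<le> R \<Longrightarrow> N (\<rho> / 2) \<le> lam * N \<rho> + (1 + 1 / \<eta>) * k * E * \<rho> powr e; 0 < \<rho>; \<rho> \<le> R\<rbrakk>
       \<Longrightarrow> N \<rho> \<le> C * E * \<rho> powr e"
    using growth_iteration[OF R lam k' e(1)] by metis
  show ?thesis
  proof (rule exI, rule jet_boundI[OF C])
    fix x0 :: "real^'n" and f E \<rho> and \<alpha> :: "'n \<Rightarrow> nat"
    assume J: "jet_le m (ball x0 R) f E" and \<alpha>: "multi_order \<alpha> = j" and \<rho>: "0 < \<rho>" "\<rho> \<le> R" and E: "0 \<le> E"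
    define g where "g = f \<alpha>"
    have g[measurable]: "g \<in> borel_measurable borel" and l2: "l2sq (ball x0 R) g \<le> ennreal E"
      using J \<alpha> j by (auto simp: g_def jet_le_def jet_def)
    define N where "N \<rho> = enn2real (l2sq (ball x0 \<rho>) g)" for \<rho>
    have le: "l2sq (ball x0 \<rho>) g \<le> ennreal E" if "\<rho> \<le> R" for \<rho>
      using that by (intro order_trans[OF l2sq_mono l2]) auto
    have fin: "l2sq (ball x0 \<rho>) g < \<infinity>" if "\<rho> \<le> R" for \<rho> using le[OF that] by (auto intro: le_less_trans)
    have N: "l2sq (ball x0 \<rho>) g = ennreal (N \<rho>)" if "\<rho> \<le> R" for \<rho> unfolding N_def using fin[OF that] by simp
    have N0: "N \<rho> \<ge> 0" for \<rho> by (simp add: N_def)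
    have "N \<rho> \<le> C * E * \<rho> powr e"
    proof (rule iter[OF E _ _ \<rho>])
      show "N \<rho> \<le> E" if "\<rho> \<le> R" for \<rho> using le[OF that] E N[OF that] by simp
      fix \<rho> :: real assume \<rho>: "0 < \<rho>" "\<rho> \<le> R"
      define a where "a = avg (ball x0 \<rho>) g"
      let ?v = "unit_ball_vol (real CARD('n))"
      have "a\<^sup>2 * (?v * \<rho> ^ CARD('n)) \<le> N \<rho>"
        using avg_l2sq_le[of "ball x0 \<rho>" g] measure_ball[OF \<rho>(1), of x0] N[OF \<rho>(2)] N0
        by (simp add: a_def ennreal_le_iff)
      \<comment> \<open>On the half ball the constant \<open>a\<close> loses the volume factor
        \<open>2 ^ CARD('n)\<close>; this is the contraction in the recursion.\<close>
      then have av: "a\<^sup>2 * (?v * (\<rho> / 2) ^ CARD('n)) \<le> N \<rho> / 2 ^ CARD('n)"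
        by (simp add: power_divide field_simps)
      have "ennreal (N (\<rho> / 2)) = l2sq (ball x0 (\<rho> / 2)) g" using \<rho> by (intro N[symmetric]) auto
      also have "\<dots> = l2sq (ball x0 (\<rho> / 2)) (\<lambda>x. (g x - a) + a)" by simp
      also have "\<dots> \<le> ennreal (1 + 1 / \<eta>) * l2sq (ball x0 (\<rho> / 2)) (\<lambda>x. g x - a) + ennreal (1 + \<eta>) * l2sq (ball x0 (\<rho> / 2)) (\<lambda>_. a)"
        using \<eta>(1) by (intro l2sq_add_le) auto
      also have "\<dots> \<le> ennreal (1 + 1 / \<eta>) * ennreal (k * E * \<rho> powr e) + ennreal (1 + \<eta>) * ennreal (N \<rho> / 2 ^ CARD('n))"
      proof (intro add_mono mult_left_mono)
        have "l2sq (ball x0 (\<rho> / 2)) (\<lambda>x. g x - a) \<le> l2sq (ball x0 \<rho>) (\<lambda>x. g x - a)" using \<rho> by (intro l2sq_mono) auto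
        also have "\<dots> \<le> ennreal (k * E * \<rho> powr e)"
          using osc J \<alpha> \<rho> unfolding a_def g_def osc_def[symmetric] jet_bound_def by blast
        finally show "l2sq (ball x0 (\<rho> / 2)) (\<lambda>x. g x - a) \<le> ennreal (k * E * \<rho> powr e)" .
        have "l2sq (ball x0 (\<rho> / 2)) (\<lambda>_. a) = ennreal (a\<^sup>2 * (?v * (\<rho> / 2) ^ CARD('n)))"
          using \<rho> measure_ball(4)[of "\<rho> / 2" x0] by (subst l2sq_const) (auto simp: ennreal_mult)
        also have "\<dots> \<le> ennreal (N \<rho> / 2 ^ CARD('n))" using av by (rule ennreal_leI)
        finally show "l2sq (ball x0 (\<rho> / 2)) (\<lambda>_. a) \<le> ennreal (N \<rho> / 2 ^ CARD('n))" .
      qed auto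
      also have "\<dots> = ennreal ((1 + 1 / \<eta>) * (k * E * \<rho> powr e) + (1 + \<eta>) * (N \<rho> / 2 ^ CARD('n)))"
      proof -
        have nn: "0 \<le> 1 + 1 / \<eta>" "0 \<le> k * E * \<rho> powr e" "0 \<le> 1 + \<eta>" "0 \<le> N \<rho> / 2 ^ CARD('n)"
          using \<eta> k E N0 by auto
        show ?thesis
          by (simp only: ennreal_mult[OF nn(1,2)] ennreal_mult[OF nn(3,4)]
              ennreal_plus[OF mult_nonneg_nonneg[OF nn(1,2)] mult_nonneg_nonneg[OF nn(3,4)]])
      qed
      finally have "N (\<rho> / 2) \<le> (1 + 1 / \<eta>) * (k * E * \<rho> powr e) + (1 + \<eta>) * (N \<rho> / 2 ^ CARD('n))"
        using \<eta> k E N0 by (subst (asm) ennreal_le_iff) auto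
      then show "N (\<rho> / 2) \<le> lam * N \<rho> + (1 + 1 / \<eta>) * k * E * \<rho> powr e"
        by (simp add: lam_def algebra_simps)
    qed
    then show "l2sq (ball x0 \<rho>) (f \<alpha>) \<le> ennreal (C * E * \<rho> powr e)"
      using N[OF \<rho>(2)] by (simp add: g_def[symmetric] ennreal_leI)
  qed
qed

text \<open>Going down by one order, the Poincare inequality raises the exponent of the squared norm
  by \<open>2\<close>; the factor \<open>CARD('n)\<close> counts the first derivatives.\<close>

lemma jet_bound_osc_lower:
  assumes k: "k < nat \<lfloor>m\<rfloor>" and B: "jet_bound m R (Suc k) (l2sq :: (real^'n::finite) set \<Rightarrow> _) B b"
  shows "jet_bound m R k (osc :: (real^'n) set \<Rightarrow> _) (12 * 2 ^ CARD('n) * real CARD('n) * B) (2 + b)"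
proof (rule jet_boundI)
  have B0: "0 \<le> B" using B by (simp add: jet_bound_def)
  then show "12 * 2 ^ CARD('n) * real CARD('n) * B \<ge> 0" by simp
  fix x0 :: "real^'n" and g E \<rho> and \<alpha> :: "'n \<Rightarrow> nat"
  assume J: "jet_le m (ball x0 R) g E" and \<alpha>: "multi_order \<alpha> = k" and \<rho>: "0 < \<rho>" "\<rho> \<le> R" and E: "0 \<le> E"
    and j: "jet_le m (ball x0 \<rho>) g E"
  have "osc (ball x0 \<rho>) (g \<alpha>) \<le> ennreal (12 * 2 ^ CARD('n) * \<rho>\<^sup>2) * (\<Sum>i\<in>UNIV. l2sq (ball x0 \<rho>) (g (\<alpha>(i := Suc (\<alpha> i)))))"
    using j \<alpha> k by (intro poincare_ball[OF \<rho>(1)]) (auto simp: jet_le_def jet_def)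
  also have "\<dots> \<le> ennreal (12 * 2 ^ CARD('n) * \<rho>\<^sup>2) * (\<Sum>i\<in>(UNIV::'n set). ennreal (B * E * \<rho> powr b))"
    using \<alpha> J \<rho> B by (intro mult_left_mono sum_mono) (simp_all add: jet_bound_def multi_order_upd)
  also have "(\<Sum>i\<in>(UNIV::'n set). ennreal (B * E * \<rho> powr b)) = ennreal (\<Sum>i\<in>(UNIV::'n set). B * E * \<rho> powr b)"
    using B0 E by (intro sum_ennreal) auto
  also have "ennreal (12 * 2 ^ CARD('n) * \<rho>\<^sup>2) * ennreal (\<Sum>i\<in>(UNIV::'n set). B * E * \<rho> powr b)
      = ennreal (12 * 2 ^ CARD('n) * \<rho>\<^sup>2 * (\<Sum>i\<in>(UNIV::'n set). B * E * \<rho> powr b))"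
    using B0 E by (intro ennreal_mult[symmetric]) (auto intro!: sum_nonneg)
  also have "12 * 2 ^ CARD('n) * \<rho>\<^sup>2 * (\<Sum>i\<in>(UNIV::'n set). B * E * \<rho> powr b)
      = 12 * 2 ^ CARD('n) * real CARD('n) * B * E * \<rho> powr (2 + b)"
    using \<rho> by (simp add: powr_add powr_numeral)
  finally show "osc (ball x0 \<rho>) (g \<alpha>) \<le> ennreal (12 * 2 ^ CARD('n) * real CARD('n) * B * E * \<rho> powr (2 + b))" .
qed

lemma jet_bound_osc_top:
  assumes m: "frac m \<noteq> 0"
  shows "jet_bound m R (nat \<lfloor>m\<rfloor>) (osc :: (real^'n::finite) set \<Rightarrow> _)
    (2 powr (real CARD('n) + 2 * frac m) / unit_ball_vol (real CARD('n))) (2 * frac m)" (is "jet_bound _ _ _ _ ?C _")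
proof (rule jet_boundI)
  show "?C \<ge> 0" by simp
  have \<sigma>: "frac m > 0" using m frac_ge_0[of m] by linarith
  fix x0 :: "real^'n" and g E \<rho> and \<alpha> :: "'n \<Rightarrow> nat"
  assume \<alpha>: "multi_order \<alpha> = nat \<lfloor>m\<rfloor>" and \<rho>: "0 < \<rho>" and E: "0 \<le> E" and J: "jet_le m (ball x0 \<rho>) g E"
  have "osc (ball x0 \<rho>) (g \<alpha>) \<le> ennreal (?C * \<rho> powr (2 * frac m)) * slob (ball x0 \<rho>) (frac m) (g \<alpha>)"
    using J \<alpha> by (intro fractional_poincare_ball \<rho> \<sigma>) (auto simp: jet_le_def jet_def)
  also have "\<dots> \<le> ennreal (?C * \<rho> powr (2 * frac m)) * ennreal E"
    using J \<alpha> m by (intro mult_left_mono) (auto simp: jet_le_def)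
  also have "\<dots> = ennreal (?C * E * \<rho> powr (2 * frac m))"
    using E by (subst ennreal_mult[symmetric]) (auto simp: mult_ac)
  finally show "osc (ball x0 \<rho>) (g \<alpha>) \<le> ennreal (?C * E * \<rho> powr (2 * frac m))" .
qed

text \<open>
  The parameter \<open>\<theta>\<close> caps the exponent below \<open>d / 2\<close>, beyond which a nonzero constant would violate the bound.
\<close>

lemma jet_growth:
  assumes R: "R > 0" and m: "m \<ge> 0" and \<theta>: "0 \<le> \<theta>" "2 * \<theta> < real CARD('n)" and k: "k \<le> nat \<lfloor>m\<rfloor>"
  shows "\<exists>C. jet_bound m R k (l2sq :: (real^'n::finite) set \<Rightarrow> _) C (2 * min (m - real k) \<theta>)"
  using k
\<comment> \<open>The induction runs downward from the top order. There the exponent is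
  \<open>0\<close> for integral \<open>m\<close>, or comes from the fractional Poincare inequality;
  each step down gains a factor \<open>\<rho>^2\<close> as far as the cap allows.\<close>
proof (induction k rule: inc_induct)
  case base
  have mM: "m - real (nat \<lfloor>m\<rfloor>) = frac m" using m by (simp add: frac_def)
  show ?case
  proof (cases "frac m = 0")
    case True
    have "jet_bound m R (nat \<lfloor>m\<rfloor>) (l2sq :: (real^'n) set \<Rightarrow> _) 1 0"
      by (rule jet_boundI) (auto simp: jet_le_def)
    then show ?thesis using \<theta> unfolding mM True by auto
  next
    case False
    have "2 * min (frac m) \<theta> < real CARD('n)" using \<theta>(2) by (rule le_less_trans[rotated]) simp
    then show ?thesis
      unfolding mM using \<theta>(1) frac_ge_0[of m]
      by (intro jet_bound_l2sq_of_osc[OF R order_refl _ _ jet_bound_weaken[OF jet_bound_osc_top[OF False]]]) auto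
  qed
next
  case (step n)
  let ?b = "2 * min (m - real (Suc n)) \<theta>" and ?e = "2 * min (m - real n) \<theta>"
  obtain B where B: "jet_bound m R (Suc n) (l2sq :: (real^'n) set \<Rightarrow> _) B ?b"
    using step.IH by blast
  have "real n < real (nat \<lfloor>m\<rfloor>)" using step.hyps by simp
  also have "\<dots> \<le> m" using m by simp
  finally have nm: "real n < m" .
  have "?e \<le> 2 * \<theta>" by (intro mult_left_mono min.cobounded2) simp
  then have "?e < real CARD('n)" using \<theta>(2) by (rule le_less_trans)
  moreover have "0 \<le> ?e" using \<theta>(1) nm by simp
  \<comment> \<open>The target exponent rises by at most \<open>2\<close> per step, which is exactly
    the gain of the Poincare inequality.\<close>
  moreover have eb: "?e \<le> 2 + ?b" by (simp add: min_def)
  ultimately show ?case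
    using step.hyps(2) by (intro jet_bound_l2sq_of_osc[OF R _ _ _ jet_bound_weaken[OF jet_bound_osc_lower[OF _ B]]]) auto
qed

subsection \<open>Bounds for point evaluations\<close>

lemma avg_diff:
  assumes "set_integrable lborel S f" "set_integrable lborel S g"
  shows "avg S (\<lambda>x. f x - g x) = avg S f - avg S g"
  using assms by (simp add: avg_def diff_divide_distrib set_integral_diff)

lemma avg_const:
  fixes S :: "(real^'n::finite) set"
  assumes "0 < measure lborel S" "S \<in> sets borel" "emeasure lborel S < \<infinity>"
  shows "avg S (\<lambda>_. c) = c" "set_integrable lborel S (\<lambda>_. c :: real)"
proof -
  have i: "integrable lborel (indicator S :: _ \<Rightarrow> real)" using assms by (intro integrable_real_indicator) auto
  then show "set_integrable lborel S (\<lambda>_. c)" by (simp add: set_integrable_def)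
  show "avg S (\<lambda>_. c) = c" using assms i by (simp add: avg_def set_lebesgue_integral_def)
qed

text \<open>An exponent above \<open>d\<close> is the Campanato condition that makes the means over
  shrinking balls converge. For \<open>m < 1\<close> it is \<open>2 * m\<close>, directly from the
  fractional seminorm; otherwise the growth of the gradient is combined with the Poincare
  inequality.\<close>

lemma jet_base_oscillation:
  assumes R: "R > 0" and m: "2 * m > real CARD('n)"
  obtains B e where "e > real CARD('n)" "jet_bound m R 0 (osc :: (real^'n::finite) set \<Rightarrow> _) B e"
proof -
  have d: "real CARD('n) \<ge> 1" by (simp add: Suc_leI)
  have m0: "m > 0" using m d by linarith
  show thesis
  proof (cases "nat \<lfloor>m\<rfloor> = 0")
    case True
    then have "\<lfloor>m\<rfloor> \<le> 0" unfolding nat_0_iff .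
    moreover have "0 \<le> \<lfloor>m\<rfloor>" using m0 by simp
    ultimately have "\<lfloor>m\<rfloor> = 0" by (rule order_antisym)
    then have fm: "frac m = m" by (simp add: frac_def)
    show thesis
      using that[of "2 * frac m"] jet_bound_osc_top[where 'n = 'n, of m R] m m0 unfolding True fm by simp
  next
    case False
    have M: "Suc 0 \<le> nat \<lfloor>m\<rfloor>" using False unfolding Suc_le_eq neq0_conv .
    \<comment> \<open>The cap has to be nonnegative and below \<open>d / 2\<close> for the growth
      bound, and above \<open>d / 2 - 1\<close> so that \<open>2 + 2 * \<theta>\<close> exceeds
      \<open>d\<close>.\<close>
    define \<theta> where "\<theta> = (real CARD('n) - 1) / 2"
    have \<theta>: "0 \<le> \<theta>" "2 * \<theta> < real CARD('n)" using d by (auto simp: \<theta>_def)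
    obtain C where "jet_bound m R (Suc 0) (l2sq :: (real^'n) set \<Rightarrow> _) C (2 * min (m - real (Suc 0)) \<theta>)"
      using jet_growth[OF R less_imp_le[OF m0] \<theta> M] by blast
    note B = jet_bound_osc_lower[OF _ this]
    have "2 * \<theta> = real CARD('n) - 1" by (simp add: \<theta>_def)
    then have "2 + 2 * min (m - real (Suc 0)) \<theta> > real CARD('n)" using m by (simp add: min_def)
    then show thesis using that B M unfolding Suc_le_eq by blast
  qed
qed

lemma avg_tendsto_ball:
  fixes x0 :: "real^'n::finite"
  assumes g[measurable]: "g \<in> borel_measurable borel" and l2: "l2sq (ball x0 R) g < \<infinity>" and R: "R > 0"
    and cont: "isCont g x0"
  shows "(\<lambda>j. avg (ball x0 (R / 2 ^ j)) g) \<longlonglongrightarrow> g x0"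
proof (rule LIMSEQ_I)
  fix \<epsilon> :: real assume \<epsilon>: "\<epsilon> > 0"
  obtain \<delta> where \<delta>: "\<delta> > 0" "\<And>x. dist x x0 < \<delta> \<Longrightarrow> dist (g x) (g x0) < \<epsilon> / 2"
    using cont \<epsilon> unfolding continuous_at_eps_delta by (metis half_gt_zero)
  have "(\<lambda>j. R * (1 / 2) ^ j) \<longlonglongrightarrow> R * 0"
    by (intro tendsto_mult tendsto_const LIMSEQ_realpow_zero) auto
  then have "\<forall>\<^sub>F j in sequentially. R * (1 / 2) ^ j < \<delta>"
    using \<delta> by (intro order_tendstoD) auto
  then obtain N where N: "\<And>j. j \<ge> N \<Longrightarrow> R * (1 / 2) ^ j < \<delta>" by (auto simp: eventually_sequentially)
  show "\<exists>N. \<forall>j\<ge>N. norm (avg (ball x0 (R / 2 ^ j)) g - g x0) < \<epsilon>"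
  proof (intro exI[of _ N] allI impI)
    fix j assume "j \<ge> N"
    define B where "B = ball x0 (R / 2 ^ j)"
    have r: "R / 2 ^ j > 0" using R by simp
    note mb = measure_ball[OF r, of x0, folded B_def]
    have B[measurable]: "B \<in> sets borel" by (simp add: B_def)
    have "R / 2 ^ j \<le> R" using R by (simp add: field_simps)
    then have "l2sq B g < \<infinity>" unfolding B_def by (intro order.strict_trans1[OF l2sq_mono l2]) auto
    note gi = l2sq_finiteD[OF B mb(3) g this]
    have "ennreal ((avg B (\<lambda>x. g x - g x0))\<^sup>2 * measure lborel B) \<le> l2sq B (\<lambda>x. g x - g x0)"
      by (rule avg_l2sq_le[OF B mb(3,2)]) measurable
    also have "\<dots> \<le> l2sq B (\<lambda>_. \<epsilon> / 2)"
      unfolding l2sq_def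
    proof (rule nn_integral_mono)
      fix x
      have "(g x - g x0)\<^sup>2 \<le> (\<epsilon> / 2)\<^sup>2" if "x \<in> B"
      proof -
        have "dist x x0 < \<delta>" using that N[OF \<open>j \<ge> N\<close>] by (simp add: B_def dist_commute power_one_over)
        from \<delta>(2)[OF this] have "\<bar>g x - g x0\<bar> \<le> \<bar>\<epsilon> / 2\<bar>" by (simp add: dist_real_def)
        then show ?thesis by (rule abs_le_square_iff[THEN iffD1])
      qed
      then show "ennreal ((g x - g x0)\<^sup>2) * indicator B x \<le> ennreal ((\<epsilon> / 2)\<^sup>2) * indicator B x"
        by (cases "x \<in> B") (simp_all only: indicator_simps mult_zero_right mult_1_right order_refl ennreal_leI simp_thms not_False_eq_True)
    qed
    also have "\<dots> = ennreal ((\<epsilon> / 2)\<^sup>2 * measure lborel B)"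
      using mb by (subst l2sq_const) (auto simp: ennreal_mult emeasure_eq_ennreal_measure less_top)
    finally have "(avg B (\<lambda>x. g x - g x0))\<^sup>2 * measure lborel B \<le> (\<epsilon> / 2)\<^sup>2 * measure lborel B"
      by (subst (asm) ennreal_le_iff) auto
    then have "(avg B (\<lambda>x. g x - g x0))\<^sup>2 \<le> (\<epsilon> / 2)\<^sup>2" using mb(2) by simp
    then have "\<bar>avg B (\<lambda>x. g x - g x0)\<bar> \<le> \<epsilon> / 2" using \<epsilon> abs_le_square_iff[of _ "\<epsilon> / 2"] by simp
    moreover have "avg B (\<lambda>x. g x - g x0) = avg B g - g x0"
      using avg_diff[OF gi(1) avg_const(2)] avg_const(1) mb B by metis
    ultimately show "norm (avg (ball x0 (R / 2 ^ j)) g - g x0) < \<epsilon>" using \<epsilon> by (simp add: B_def)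
  qed
qed

text \<open>The means over the balls of radius \<open>R / 2^j\<close> change by geometrically
  decreasing amounts, controlled by the oscillation. Telescoping from the first mean, which the
  \<open>L2\<close> norm bounds, reaches the point value by continuity.\<close>

lemma jet_point_bound:
  fixes R m :: real
  assumes R: "R > 0" and m: "2 * m > real CARD('n::finite)"
  obtains C where "C \<ge> 0"
    "\<And>(x0::real^'n) g E. \<lbrakk>jet_le m (ball x0 R) g E; isCont (g (\<lambda>_. 0)) x0\<rbrakk> \<Longrightarrow> (g (\<lambda>_. 0) x0)\<^sup>2 \<le> C * E"
proof -
  obtain B e where e: "e > real CARD('n)" and osc: "jet_bound m R 0 (osc :: (real^'n) set \<Rightarrow> _) B e"
    using jet_base_oscillation[OF R m] by metis
  then have B: "B \<ge> 0" by (simp add: jet_bound_def)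
  define v where "v = unit_ball_vol (real CARD('n))"
  have v: "v > 0" by (simp add: v_def)
  \<comment> \<open>Dividing the squared oscillation, of order \<open>\<rho>^e\<close>, by the
    volume, of order \<open>\<rho>^d\<close>, and taking the root leaves increments of order
    \<open>\<rho>^s\<close>; the ratio of consecutive ones is \<open>2 powr (- s)\<close>.\<close>
  define s where "s = (e - real CARD('n)) / 2"
  have s: "s > 0" using e by (simp add: s_def)
  define q where "q = 2 powr (- s)"
  have q: "0 < q" "q < 1" using s powr_less_mono[of "- s" 0 2] by (auto simp: q_def)
  define A where "A = 2 ^ CARD('n) * B / v"
  have A: "A \<ge> 0" using B v by (simp add: A_def)
  \<comment> \<open>The first summand belongs to the telescoped increments, the second to the mean
    over the initial ball; the factors \<open>2\<close> come from splitting the square of a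
    sum.\<close>
  define C where "C = 2 * (A * (R powr s / (1 - q))\<^sup>2) + 2 / (v * R ^ CARD('n))"
  have C: "C \<ge> 0" using A v R by (simp add: C_def)
  show thesis
  proof (rule that[OF C])
    fix x0 :: "real^'n" and g E
    assume J: "jet_le m (ball x0 R) g E" and cont: "isCont (g (\<lambda>_. 0)) x0"
    define f where "f = g (\<lambda>_. 0)"
    have E: "E \<ge> 0" using J by (simp add: jet_le_def)
    have zero: "multi_order (\<lambda>_::'n. 0) = 0" by (simp add: multi_order_def)
    have f[measurable]: "f \<in> borel_measurable borel" and fE: "l2sq (ball x0 R) f \<le> ennreal E"
      using J zero by (auto simp: jet_le_def jet_def f_def)
    then have fin: "l2sq (ball x0 R) f < \<infinity>" by (auto intro: le_less_trans)
    define \<rho> where "\<rho> j = R / 2 ^ j" for j :: nat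
    have \<rho>: "0 < \<rho> j" "\<rho> j \<le> R" for j using R by (auto simp: \<rho>_def field_simps)
    define a where "a j = avg (ball x0 (\<rho> j)) f" for j
    have lim: "a \<longlonglongrightarrow> f x0"
      using avg_tendsto_ball[OF f fin R] cont by (simp add: a_def[abs_def] \<rho>_def f_def)
    define D where "D = sqrt (A * E) * R powr s"
    have D: "D \<ge> 0" using A E by (simp add: D_def)
    have step: "\<bar>a (Suc j) - a j\<bar> \<le> D * q ^ j" for j
    proof -
      let ?B = "ball x0 (\<rho> (Suc j))"
      note mb = measure_ball[OF \<rho>(1)[of "Suc j"], of x0]
      have half: "\<rho> (Suc j) = \<rho> j / 2" by (simp add: \<rho>_def)
      have "l2sq ?B f < \<infinity>" using \<rho>(2)[of "Suc j"] by (intro order.strict_trans1[OF l2sq_mono fin]) auto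
      note fi = l2sq_finiteD[OF _ mb(3) f this]
      have "avg ?B (\<lambda>x. f x - a j) = a (Suc j) - a j"
        using fi mb by (subst avg_diff) (auto simp: avg_const a_def)
      then have "ennreal ((a (Suc j) - a j)\<^sup>2 * measure lborel ?B) \<le> l2sq ?B (\<lambda>x. f x - a j)"
        using avg_l2sq_le[of ?B "\<lambda>x. f x - a j"] mb by simp
      also have "\<dots> \<le> l2sq (ball x0 (\<rho> j)) (\<lambda>x. f x - a j)"
        using \<rho>(1)[of j] by (intro l2sq_mono) (auto simp: half)
      also have "\<dots> \<le> ennreal (B * E * \<rho> j powr e)"
        using osc J \<rho> zero unfolding a_def f_def osc_def[symmetric] jet_bound_def by blast
      finally have "(a (Suc j) - a j)\<^sup>2 * (v * (\<rho> j / 2) ^ CARD('n)) \<le> B * E * \<rho> j powr e"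
        using B E by (subst (asm) ennreal_le_iff) (auto simp: mb(1)[unfolded half] v_def half)
      also have "\<rho> j powr e = \<rho> j powr (2 * s) * \<rho> j ^ CARD('n)"
      proof -
        have "2 * s = e - real CARD('n)" by (simp add: s_def)
        then show ?thesis using \<rho>(1)[of j] by (simp add: powr_diff powr_realpow)
      qed
      finally have "(a (Suc j) - a j)\<^sup>2 * v * \<rho> j ^ CARD('n) \<le> (2 ^ CARD('n) * B * E * \<rho> j powr (2 * s)) * \<rho> j ^ CARD('n)"
        by (simp add: power_divide field_simps)
      then have "(a (Suc j) - a j)\<^sup>2 * v \<le> 2 ^ CARD('n) * B * E * \<rho> j powr (2 * s)"
        using \<rho>(1)[of j] by simp
      then have "(a (Suc j) - a j)\<^sup>2 \<le> A * E * \<rho> j powr (2 * s)"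
        using v by (simp add: A_def field_simps)
      also have "\<rho> j powr (2 * s) = (\<rho> j powr s)\<^sup>2"
        by (simp add: power2_eq_square powr_add[symmetric])
      also have "A * E * (\<rho> j powr s)\<^sup>2 = (sqrt (A * E) * \<rho> j powr s)\<^sup>2"
        using A E by (simp add: power_mult_distrib)
      finally have "\<bar>a (Suc j) - a j\<bar> \<le> sqrt (A * E) * \<rho> j powr s"
        using abs_le_square_iff[of "a (Suc j) - a j" "sqrt (A * E) * \<rho> j powr s"] A E by simp
      also have "\<rho> j powr s = R powr s * q ^ j"
      proof -
        have "((1 / 2) ^ j) powr s = q ^ j" unfolding q_def
          by (induction j) (simp_all add: powr_mult powr_minus_divide powr_divide)
        moreover have "\<rho> j = R * (1 / 2) ^ j" by (simp add: \<rho>_def power_one_over)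
        ultimately show ?thesis using R by (simp only: powr_mult)
      qed
      finally show ?thesis by (simp add: D_def mult_ac)
    qed
    have part: "\<bar>a n - a 0\<bar> \<le> D / (1 - q)" for n
    proof -
      have "\<bar>a n - a 0\<bar> = \<bar>\<Sum>j<n. a (Suc j) - a j\<bar>" by (simp add: sum_lessThan_telescope)
      also have "\<dots> \<le> (\<Sum>j<n. D * q ^ j)" by (intro order_trans[OF sum_abs] sum_mono step)
      also have "\<dots> = D * ((1 - q ^ n) / (1 - q))" using q by (simp add: sum_distrib_left[symmetric] sum_gp_strict)
      also have "\<dots> \<le> D * (1 / (1 - q))" using q D by (intro mult_left_mono divide_right_mono) auto
      finally show ?thesis by simp
    qed
    have "(\<lambda>n. \<bar>a n - a 0\<bar>) \<longlonglongrightarrow> \<bar>f x0 - a 0\<bar>" by (intro tendsto_intros lim)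
    then have 1: "\<bar>f x0 - a 0\<bar> \<le> D / (1 - q)" using part by (intro LIMSEQ_le_const2) auto
    have "(a 0)\<^sup>2 * (v * R ^ CARD('n)) \<le> E"
    proof -
      note mb = measure_ball[OF R, of x0]
      have "ennreal ((a 0)\<^sup>2 * measure lborel (ball x0 R)) \<le> ennreal E"
        using avg_l2sq_le[of "ball x0 R" f] mb fE by (auto simp: a_def \<rho>_def intro: order_trans)
      then show ?thesis using E by (simp add: mb(1) v_def)
    qed
    then have 2: "(a 0)\<^sup>2 \<le> E / (v * R ^ CARD('n))" using v R by (simp add: field_simps)
    have "(f x0)\<^sup>2 \<le> 2 * (f x0 - a 0)\<^sup>2 + 2 * (a 0)\<^sup>2"
      using zero_le_power2[of "f x0 - 2 * a 0"] by (simp add: power2_eq_square algebra_simps)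
    also have "\<dots> \<le> 2 * (D / (1 - q))\<^sup>2 + 2 * (E / (v * R ^ CARD('n)))"
    proof -
      have "(f x0 - a 0)\<^sup>2 \<le> (D / (1 - q))\<^sup>2"
        using 1 by (metis abs_ge_zero power2_abs power_mono)
      then show ?thesis using 2 by simp
    qed
    also have "(D / (1 - q))\<^sup>2 = A * E * (R powr s / (1 - q))\<^sup>2"
      using A E by (simp add: D_def power_mult_distrib power_divide)
    also have "2 * (A * E * (R powr s / (1 - q))\<^sup>2) + 2 * (E / (v * R ^ CARD('n))) = C * E"
      by (simp add: C_def algebra_simps)
    finally show "(g (\<lambda>_. 0) x0)\<^sup>2 \<le> C * E" by (simp add: f_def)
  qed
qed

subsection \<open>Polynomial approximation of scaled functions\<close>

text \<open>Division by the factorials makes differentiation a pure index shift, with no numerical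
  factors to track.\<close>

definition nmono :: "('n::finite \<Rightarrow> nat) \<Rightarrow> real^'n \<Rightarrow> real" where
  "nmono \<alpha> x = (\<Prod>i\<in>UNIV. (x $ i) ^ \<alpha> i / fact (\<alpha> i))"

text \<open>The derivative of order \<open>\<beta>\<close> of the monomial \<open>\<alpha>\<close>.
  The case distinction is essential, since truncated subtraction would otherwise turn vanishing
  derivatives into nonzero monomials.\<close>

definition nmono_jet :: "('n::finite \<Rightarrow> nat) \<Rightarrow> ('n \<Rightarrow> nat) \<Rightarrow> real^'n \<Rightarrow> real" where
  "nmono_jet \<alpha> \<beta> = (if \<beta> \<le> \<alpha> then nmono (\<lambda>i. \<alpha> i - \<beta> i) else (\<lambda>_. 0))"

definition poly_jet :: "nat \<Rightarrow> (('n::finite \<Rightarrow> nat) \<Rightarrow> real) \<Rightarrow> ('n \<Rightarrow> nat) \<Rightarrow> real^'n \<Rightarrow> real" where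
  "poly_jet q c \<beta> x = (\<Sum>\<alpha> | multi_order \<alpha> < q. c \<alpha> * nmono_jet \<alpha> \<beta> x)"

lemma multi_order_component_le: "\<alpha> i \<le> multi_order \<alpha>"
  unfolding multi_order_def by (rule member_le_sum) auto

lemma finite_multi_order: "finite {\<alpha>::'n::finite \<Rightarrow> nat. multi_order \<alpha> < q}"
proof (rule finite_subset)
  show "{\<alpha>::'n \<Rightarrow> nat. multi_order \<alpha> < q} \<subseteq> PiE UNIV (\<lambda>_. {..<q})"
    using multi_order_component_le by (auto intro: le_less_trans)
qed (auto intro: finite_PiE)

lemma multi_order_mono: "\<beta> \<le> \<alpha> \<Longrightarrow> multi_order \<beta> \<le> multi_order \<alpha>"
  unfolding multi_order_def by (intro sum_mono) (simp add: le_fun_def)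

lemma multi_order_eq_imp_eq:
  assumes "\<beta> \<le> \<alpha>" "multi_order \<alpha> \<le> multi_order \<beta>"
  shows "\<beta> = \<alpha>"
proof (rule ccontr)
  assume "\<beta> \<noteq> \<alpha>"
  then obtain i where "\<beta> i < \<alpha> i" using assms(1) by (auto simp: le_fun_def fun_eq_iff le_less)
  then have "multi_order \<beta> < multi_order \<alpha>"
    unfolding multi_order_def using assms(1) by (intro sum_strict_mono_ex1) (auto simp: le_fun_def)
  then show False using assms(2) by simp
qed

lemma nmono_has_derivative:
  fixes x :: "real^'n::finite"
  shows "(nmono \<alpha> has_derivative (\<lambda>v. \<Sum>i\<in>UNIV. v $ i * (if \<alpha> i = 0 then 0 else nmono (\<alpha>(i := \<alpha> i - 1)) x))) (at x)"
proof -
  have f: "((\<lambda>x::real^'n. (x $ i) ^ \<alpha> i / fact (\<alpha> i)) has_derivative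
      (\<lambda>v. v $ i * (if \<alpha> i = 0 then 0 else (x $ i) ^ (\<alpha> i - 1) / fact (\<alpha> i - 1)))) (at x)" for i
  proof -
    have "((\<lambda>t::real. t ^ \<alpha> i / fact (\<alpha> i)) has_real_derivative real (\<alpha> i) * (x $ i) ^ (\<alpha> i - Suc 0) / fact (\<alpha> i)) (at (x $ i))"
      by (auto intro!: derivative_eq_intros)
    also have "real (\<alpha> i) * (x $ i) ^ (\<alpha> i - Suc 0) / fact (\<alpha> i) = (if \<alpha> i = 0 then 0 else (x $ i) ^ (\<alpha> i - 1) / fact (\<alpha> i - 1))"
      by (cases "\<alpha> i") (simp_all del: of_nat_Suc)
    finally have D: "((\<lambda>t::real. t ^ \<alpha> i / fact (\<alpha> i)) has_derivative
        (*) (if \<alpha> i = 0 then 0 else (x $ i) ^ (\<alpha> i - 1) / fact (\<alpha> i - 1))) (at (x $ i))"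
      by (simp add: has_field_derivative_def)
    have "((\<lambda>x::real^'n. x $ i) has_derivative (\<lambda>v. v $ i)) (at x)"
      by (rule bounded_linear_imp_has_derivative) (rule bounded_linear_vec_nth)
    from has_derivative_compose[OF this D] show ?thesis by (simp only: mult.commute)
  qed
  have "((\<lambda>x::real^'n. \<Prod>i\<in>UNIV. (x $ i) ^ \<alpha> i / fact (\<alpha> i)) has_derivative
      (\<lambda>v. \<Sum>i\<in>UNIV. (v $ i * (if \<alpha> i = 0 then 0 else (x $ i) ^ (\<alpha> i - 1) / fact (\<alpha> i - 1))) * (\<Prod>j\<in>UNIV - {i}. (x $ j) ^ \<alpha> j / fact (\<alpha> j)))) (at x)"
    by (rule has_derivative_prod) (rule f)
  also have "(\<lambda>v::real^'n. \<Sum>i\<in>UNIV. (v $ i * (if \<alpha> i = 0 then 0 else (x $ i) ^ (\<alpha> i - 1) / fact (\<alpha> i - 1))) * (\<Prod>j\<in>UNIV - {i}. (x $ j) ^ \<alpha> j / fact (\<alpha> j)))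
      = (\<lambda>v. \<Sum>i\<in>UNIV. v $ i * (if \<alpha> i = 0 then 0 else nmono (\<alpha>(i := \<alpha> i - 1)) x))"
  proof (intro ext sum.cong refl)
    fix v :: "real^'n" and i
    have "nmono (\<alpha>(i := \<alpha> i - 1)) x = (x $ i) ^ (\<alpha> i - 1) / fact (\<alpha> i - 1) * (\<Prod>j\<in>UNIV - {i}. (x $ j) ^ \<alpha> j / fact (\<alpha> j))"
      unfolding nmono_def by (subst prod.remove[of _ i]) auto
    then show "(v $ i * (if \<alpha> i = 0 then 0 else (x $ i) ^ (\<alpha> i - 1) / fact (\<alpha> i - 1))) * (\<Prod>j\<in>UNIV - {i}. (x $ j) ^ \<alpha> j / fact (\<alpha> j))
        = v $ i * (if \<alpha> i = 0 then 0 else nmono (\<alpha>(i := \<alpha> i - 1)) x)" by simp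
  qed
  finally show ?thesis by (simp add: nmono_def[abs_def])
qed

lemma nmono_jet_has_derivative:
  fixes x :: "real^'n::finite"
  shows "(nmono_jet \<alpha> \<beta> has_derivative (\<lambda>v. \<Sum>i\<in>UNIV. v $ i * nmono_jet \<alpha> (\<beta>(i := Suc (\<beta> i))) x)) (at x)"
proof (cases "\<beta> \<le> \<alpha>")
  case True
  have "(if \<alpha> i - \<beta> i = 0 then 0 else nmono ((\<lambda>i. \<alpha> i - \<beta> i)(i := (\<alpha> i - \<beta> i) - 1)) x) = nmono_jet \<alpha> (\<beta>(i := Suc (\<beta> i))) x" for i
  proof (cases "\<alpha> i - \<beta> i = 0")
    case True
    then have "\<not> \<beta>(i := Suc (\<beta> i)) \<le> \<alpha>" by (auto simp: le_fun_def dest!: spec[of _ i])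
    with True show ?thesis by (simp add: nmono_jet_def)
  next
    case False
    then have "\<beta>(i := Suc (\<beta> i)) \<le> \<alpha>" using \<open>\<beta> \<le> \<alpha>\<close> by (auto simp: le_fun_def)
    moreover have "(\<lambda>i. \<alpha> i - \<beta> i)(i := (\<alpha> i - \<beta> i) - 1) = (\<lambda>j. \<alpha> j - (\<beta>(i := Suc (\<beta> i))) j)" by auto
    ultimately show ?thesis using False by (simp add: nmono_jet_def)
  qed
  then show ?thesis
    using nmono_has_derivative[of "\<lambda>i. \<alpha> i - \<beta> i" x] True by (simp add: nmono_jet_def[of \<alpha> \<beta>])
next
  case False
  then have "\<not> \<beta>(i := Suc (\<beta> i)) \<le> \<alpha>" for i
    by (auto simp: le_fun_def split: if_splits) (metis Suc_leD)
  then show ?thesis using False by (simp add: nmono_jet_def)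
qed

lemma poly_jet_has_derivative:
  fixes x :: "real^'n::finite"
  shows "(poly_jet q c \<beta> has_derivative (\<lambda>v. \<Sum>i\<in>UNIV. v $ i * poly_jet q c (\<beta>(i := Suc (\<beta> i))) x)) (at x)"
proof -
  have "((\<lambda>x. \<Sum>\<alpha> | multi_order \<alpha> < q. c \<alpha> * nmono_jet \<alpha> \<beta> x) has_derivative
      (\<lambda>v. \<Sum>\<alpha> | multi_order \<alpha> < q. c \<alpha> * (\<Sum>i\<in>UNIV. v $ i * nmono_jet \<alpha> (\<beta>(i := Suc (\<beta> i))) x))) (at x)"
    by (intro has_derivative_sum has_derivative_mult_right nmono_jet_has_derivative)
  also have "(\<lambda>v. \<Sum>\<alpha> | multi_order \<alpha> < q. c \<alpha> * (\<Sum>i\<in>UNIV. v $ i * nmono_jet \<alpha> (\<beta>(i := Suc (\<beta> i))) x))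
      = (\<lambda>v. \<Sum>i\<in>UNIV. v $ i * poly_jet q c (\<beta>(i := Suc (\<beta> i))) x)"
    by (rule ext) (simp add: poly_jet_def sum_distrib_left sum.swap[of _ UNIV] mult_ac)
  finally show ?thesis by (simp add: poly_jet_def[abs_def])
qed

lemma poly_jet_partial_deriv: "partial_deriv i (poly_jet q c \<beta>) = poly_jet q c (\<beta>(i := Suc (\<beta> i)))"
proof
  fix x
  have "partial_deriv i (poly_jet q c \<beta>) x = (\<Sum>j\<in>UNIV. axis i 1 $ j * poly_jet q c (\<beta>(j := Suc (\<beta> j))) x)"
    by (rule partial_derivI[OF poly_jet_has_derivative])
  also have "\<dots> = poly_jet q c (\<beta>(i := Suc (\<beta> i))) x"
    by (subst sum.remove[of _ i]) (auto simp: axis_def intro!: sum.neutral)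
  finally show "partial_deriv i (poly_jet q c \<beta>) x = poly_jet q c (\<beta>(i := Suc (\<beta> i))) x" .
qed

lemma poly_jet_differentiable: "poly_jet q c \<beta> differentiable (at x)"
  unfolding differentiable_def by (rule exI) (rule poly_jet_has_derivative)

lemma poly_jet_continuous: "continuous_on UNIV (poly_jet q c \<beta>)"
  using poly_jet_differentiable by (auto intro!: continuous_at_imp_continuous_on differentiable_imp_continuous_within)

lemma poly_jet_measurable[measurable]: "poly_jet q c \<beta> \<in> borel_measurable borel"
  by (rule borel_measurable_continuous_onI[OF poly_jet_continuous])

lemma poly_jet_wpart:
  assumes "bounded S" "S \<in> sets borel"
  shows "wpart S i (poly_jet q c \<beta>) (poly_jet q c (\<beta>(i := Suc (\<beta> i))))"
proof -
  have "continuous_on UNIV (partial_deriv i (poly_jet q c \<beta>))"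
    unfolding poly_jet_partial_deriv by (rule poly_jet_continuous)
  from wpart_smooth[OF assms poly_jet_differentiable this] show ?thesis
    unfolding poly_jet_partial_deriv .
qed

lemma poly_jet_high: "q \<le> multi_order \<beta> \<Longrightarrow> poly_jet q c \<beta> x = 0"
  unfolding poly_jet_def by (rule sum.neutral) (auto simp: nmono_jet_def dest: multi_order_mono)

text \<open>At order \<open>q - 1\<close> only the coefficient of \<open>\<beta>\<close> itself
  survives, and beyond it none. The derivative is therefore constant and drops out of difference
  seminorms.\<close>

lemma poly_jet_top:
  assumes "q \<le> Suc (multi_order \<beta>)"
  shows "poly_jet q c \<beta> x = poly_jet q c \<beta> y"
  unfolding poly_jet_def
proof (rule sum.cong[OF refl])
  fix \<alpha> :: "'a \<Rightarrow> nat" assume a: "\<alpha> \<in> {\<alpha>. multi_order \<alpha> < q}"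
  have "\<beta> = \<alpha>" if "\<beta> \<le> \<alpha>" by (rule multi_order_eq_imp_eq[OF that]) (use a assms in simp)
  then show "c \<alpha> * nmono_jet \<alpha> \<beta> x = c \<alpha> * nmono_jet \<alpha> \<beta> y"
    by (auto simp: nmono_jet_def nmono_def)
qed

lemma poly_jet_in_poly_space: "poly_jet q c (\<lambda>_. 0) \<in> poly_space q"
proof -
  have "poly_jet q c (\<lambda>_. 0) = (\<lambda>x. \<Sum>\<alpha> | multi_order \<alpha> < q. (c \<alpha> / (\<Prod>i\<in>UNIV. fact (\<alpha> i))) * (\<Prod>i\<in>UNIV. (x $ i) ^ \<alpha> i))"
    by (rule ext) (simp add: poly_jet_def nmono_jet_def nmono_def le_fun_def prod_dividef)
  then show ?thesis unfolding poly_space_def by (intro CollectI exI)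
qed

text \<open>The system for the coefficients is triangular: the mean of order \<open>\<beta>\<close>
  involves only \<open>c \<alpha>\<close> with \<open>\<beta> \<le> \<alpha>\<close>, and
  \<open>c \<beta>\<close> enters with factor one. The induction on \<open>n\<close> counts how many
  orders have been matched from the top.\<close>

lemma poly_jet_matching:
  fixes t :: "('n::finite \<Rightarrow> nat) \<Rightarrow> real"
  assumes S: "bounded S" "S \<in> sets borel" and v: "0 < measure lborel S"
  obtains c where "\<And>\<beta>. multi_order \<beta> < q \<Longrightarrow> avg S (poly_jet q c \<beta>) = t \<beta>"
proof -
  have fin: "emeasure lborel S < \<infinity>" using S(1) by (rule emeasure_bounded_finite)
  have int: "set_integrable lborel S (poly_jet q c \<beta>)" for c \<beta>
    by (rule set_integrable_continuous_bounded[OF S poly_jet_continuous])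
  have "\<exists>c. \<forall>\<beta>. q - n \<le> multi_order \<beta> \<and> multi_order \<beta> < q \<longrightarrow> avg S (poly_jet q c \<beta>) = t \<beta>" for n
  proof (induction n)
    case 0
    show ?case by auto
  next
    case (Suc n)
    then obtain c where c: "\<And>\<beta>. q - n \<le> multi_order \<beta> \<Longrightarrow> multi_order \<beta> < q \<Longrightarrow> avg S (poly_jet q c \<beta>) = t \<beta>" by blast
    \<comment> \<open>Only coefficients of the next lower order \<open>q - n - 1\<close> are
      corrected, by the defect of their mean; they do not enter derivatives of order at least
      \<open>q - n\<close>. Written with \<open>Suc\<close>, the correction is void once the
      truncated difference \<open>q - n\<close> is zero.\<close>
    define c' where "c' \<alpha> = (if q - n = Suc (multi_order \<alpha>) then c \<alpha> - (avg S (poly_jet q c \<alpha>) - t \<alpha>) else c \<alpha>)" for \<alpha>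
    show ?case
    proof (intro exI[of _ c'] allI impI)
      fix \<beta> :: "'n \<Rightarrow> nat" assume b: "q - Suc n \<le> multi_order \<beta> \<and> multi_order \<beta> < q"
      show "avg S (poly_jet q c' \<beta>) = t \<beta>"
      proof (cases "q - n \<le> multi_order \<beta>")
        case True
        have "poly_jet q c' \<beta> = poly_jet q c \<beta>"
          unfolding poly_jet_def
        proof (intro ext sum.cong refl)
          fix x and \<alpha> :: "'n \<Rightarrow> nat"
          have "\<not> \<beta> \<le> \<alpha>" if "q - n = Suc (multi_order \<alpha>)" using that True by (auto dest: multi_order_mono)
          then show "c' \<alpha> * nmono_jet \<alpha> \<beta> x = c \<alpha> * nmono_jet \<alpha> \<beta> x" by (auto simp: c'_def nmono_jet_def)
        qed
        then show ?thesis using c True b by simp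
      next
        case False
        then have e: "q - n = Suc (multi_order \<beta>)" using b by auto
        have "poly_jet q c' \<beta> = (\<lambda>x. poly_jet q c \<beta> x - (avg S (poly_jet q c \<beta>) - t \<beta>))"
        proof
          fix x
          have "c' \<alpha> * nmono_jet \<alpha> \<beta> x = c \<alpha> * nmono_jet \<alpha> \<beta> x - (if \<alpha> = \<beta> then avg S (poly_jet q c \<beta>) - t \<beta> else 0)" for \<alpha>
          proof (cases "q - n = Suc (multi_order \<alpha>)")
            case True
            then have "multi_order \<alpha> \<le> multi_order \<beta>" using e by simp
            then have "\<beta> = \<alpha>" if "\<beta> \<le> \<alpha>" using multi_order_eq_imp_eq that by blast
            moreover have "nmono_jet \<beta> \<beta> x = 1" by (simp add: nmono_jet_def nmono_def)
            ultimately show ?thesis using True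
              by (cases "\<beta> \<le> \<alpha>") (auto simp: c'_def nmono_jet_def algebra_simps)
          next
            case False
            then have "\<alpha> \<noteq> \<beta>" using e by auto
            then show ?thesis using False by (simp add: c'_def)
          qed
          then show "poly_jet q c' \<beta> x = poly_jet q c \<beta> x - (avg S (poly_jet q c \<beta>) - t \<beta>)"
            unfolding poly_jet_def using b finite_multi_order[where 'n = 'n, of q] by (simp add: sum_subtractf)
        qed
        then show ?thesis
          using avg_diff[OF int avg_const(2)[OF v S(2) fin]] avg_const(1)[OF v S(2) fin] by simp
      qed
    qed
  qed
  from this[of q] show thesis using that by auto
qed

lemma l2sq_continuous_finite:
  fixes p :: "real^'n::finite \<Rightarrow> real"
  assumes S: "bounded S" "S \<in> sets borel" and p: "continuous_on UNIV p"
  shows "l2sq S p < \<infinity>"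
proof -
  have "set_integrable lborel S (\<lambda>x. (p x)\<^sup>2)"
    by (rule set_integrable_continuous_bounded[OF S]) (intro continuous_intros p)
  then have i: "integrable lborel (\<lambda>x. indicator S x * (p x)\<^sup>2)" by (simp add: set_integrable_def)
  have "l2sq S p = (\<integral>\<^sup>+x. ennreal (norm (indicator S x * (p x)\<^sup>2)) \<partial>lborel)"
    unfolding l2sq_def by (intro nn_integral_cong) (simp add: indicator_def)
  also have "\<dots> < \<infinity>" using i by (simp add: integrable_iff_bounded)
  finally show ?thesis .
qed

lemma l2sq_diff_finite:
  assumes S: "S \<in> sets borel" and f: "f \<in> borel_measurable borel" "g \<in> borel_measurable borel"
    and l2: "l2sq S f < \<infinity>" "l2sq S g < \<infinity>"
  shows "l2sq S (\<lambda>x. f x - g x) < \<infinity>"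
proof -
  have "l2sq S (\<lambda>x. f x + - g x) \<le> ennreal (1 + 1 / 1) * l2sq S f + ennreal (1 + 1) * l2sq S (\<lambda>x. - g x)"
    using f by (intro l2sq_add_le S) auto
  also have "l2sq S (\<lambda>x. - g x) = l2sq S g" by (simp add: l2sq_def)
  also have "ennreal (1 + 1 / 1) * l2sq S f + ennreal (1 + 1) * l2sq S g < \<infinity>"
    using l2 by (simp add: ennreal_mult_less_top)
  finally show ?thesis by simp
qed

text \<open>Carries all derivatives of \<open>u(h x) - p(x)\<close> at once; the power of
  \<open>h\<close> is the factor from the chain rule.\<close>

definition scaled_error :: "nat \<Rightarrow> (('n::finite \<Rightarrow> nat) \<Rightarrow> real^'n \<Rightarrow> real) \<Rightarrow> real \<Rightarrow> (('n \<Rightarrow> nat) \<Rightarrow> real) \<Rightarrow>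
    ('n \<Rightarrow> nat) \<Rightarrow> real^'n \<Rightarrow> real" where
  "scaled_error q g h c \<alpha> x = h ^ multi_order \<alpha> * g \<alpha> (h *\<^sub>R x) - poly_jet q c \<alpha> x"

definition matched :: "real \<Rightarrow> real \<Rightarrow> real \<Rightarrow> nat \<Rightarrow> (('n::finite \<Rightarrow> nat) \<Rightarrow> real^'n \<Rightarrow> real) \<Rightarrow> real \<Rightarrow>
    (('n \<Rightarrow> nat) \<Rightarrow> real) \<Rightarrow> bool" where
  "matched m R R0 q g h c \<longleftrightarrow> jet_le m (ball 0 R0) g 1 \<and> 0 < h \<and> h * R \<le> R0 \<and>
     (\<forall>\<beta>. multi_order \<beta> < q \<longrightarrow> multi_order \<beta> \<le> nat \<lfloor>m\<rfloor> \<longrightarrow> avg (ball 0 R) (scaled_error q g h c \<beta>) = 0)"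

section \<open>Size of the scaled remainder after subtracting the matching polynomial\<close>

context
  fixes m R R0 :: real and q :: nat and d :: nat
  assumes m: "2 * m > real d" and R: "R > 0" "R0 > 0"
    and q: "q = polyharmonic_order m d" and d: "d > 0"
begin

text \<open>The integer \<open>q\<close> is the least one above \<open>m - d/2\<close>, so orders
  from \<open>q\<close> on lie below the critical exponent \<open>d/2\<close>. The extreme case
  \<open>q = \<lfloor>m\<rfloor> + 1\<close> needs \<open>frac m \<ge> d/2\<close>, thus
  \<open>d = 1\<close>; then the means of all derivatives are matched and a fractional seminorm must
  be there to start from.\<close>

lemma order_bounds: "m - real q < real d / 2" "q \<le> Suc (nat \<lfloor>m\<rfloor>)" "m > 0"
    "q = Suc (nat \<lfloor>m\<rfloor>) \<Longrightarrow> frac m \<noteq> 0"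
proof -
  have qr: "real q = real_of_int \<lfloor>m - real d / 2\<rfloor> + 1"
    using m by (simp add: q polyharmonic_order_def)
  show "m - real q < real d / 2" using qr by linarith
  show m0: "m > 0" using m d by simp
  have "\<lfloor>m - real d / 2\<rfloor> \<le> \<lfloor>m\<rfloor>" by (intro floor_mono) simp
  then show "q \<le> Suc (nat \<lfloor>m\<rfloor>)" by (simp add: q polyharmonic_order_def nat_mono)
  show "frac m \<noteq> 0" if "q = Suc (nat \<lfloor>m\<rfloor>)"
  proof
    assume "frac m = 0"
    then have "m = real (nat \<lfloor>m\<rfloor>)" using m0 by (simp add: frac_def)
    then have "real q = m + 1" using that by simp
    then have "real_of_int \<lfloor>m - real d / 2\<rfloor> = m" using qr by simp
    then show False using of_int_floor_le[of "m - real d / 2"] d by simp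
  qed
qed

lemma scaled_jet:
  fixes g :: "('n::finite \<Rightarrow> nat) \<Rightarrow> real^'n \<Rightarrow> real"
  assumes dn: "d = CARD('n)" and J: "jet_le m (ball 0 R0) g 1" and h: "0 < h" "h * R \<le> R0"
  shows "jet (nat \<lfloor>m\<rfloor>) (ball 0 R) (scaled_error q g h c)"
    "\<And>\<alpha>. multi_order \<alpha> \<le> nat \<lfloor>m\<rfloor> \<Longrightarrow> l2sq (ball 0 R) (\<lambda>x. h ^ multi_order \<alpha> * g \<alpha> (h *\<^sub>R x)) < \<infinity>"
proof -
  have sub: "ball 0 (h * R) \<subseteq> ball (0::real^'n) R0" using h by auto
  have sub': "ball 0 R \<subseteq> {x::real^'n. h *\<^sub>R x \<in> ball 0 R0}"
  proof
    fix x :: "real^'n" assume "x \<in> ball 0 R"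
    then have "h * norm x < h * R" using h(1) by (intro mult_strict_left_mono) auto
    then have "h * norm x < R0" using h(2) by (rule less_le_trans)
    then show "x \<in> {x. h *\<^sub>R x \<in> ball 0 R0}" using h(1) by simp
  qed
  have jet: "jet (nat \<lfloor>m\<rfloor>) (ball 0 R0) g" using J by (simp add: jet_le_def)
  have bm: "g \<alpha> \<in> borel_measurable borel" if "multi_order \<alpha> \<le> nat \<lfloor>m\<rfloor>" for \<alpha> using jet that by (simp add: jet_def)
  have gm: "(\<lambda>x. h ^ multi_order \<alpha> * g \<alpha> (h *\<^sub>R x)) \<in> borel_measurable borel" if "multi_order \<alpha> \<le> nat \<lfloor>m\<rfloor>" for \<alpha>
    using bm[OF that] by measurable
  show l2: "l2sq (ball 0 R) (\<lambda>x. h ^ multi_order \<alpha> * g \<alpha> (h *\<^sub>R x)) < \<infinity>" if "multi_order \<alpha> \<le> nat \<lfloor>m\<rfloor>" for \<alpha>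
  proof -
    have "l2sq (ball 0 (h * R)) (g \<alpha>) < \<infinity>"
      by (rule order.strict_trans1[OF l2sq_mono[OF sub]]) (use jet that in \<open>simp add: jet_def\<close>)
    then show ?thesis unfolding l2sq_scale[OF h(1) bm[OF that]] by (simp add: ennreal_mult_less_top)
  qed
  show "jet (nat \<lfloor>m\<rfloor>) (ball 0 R) (scaled_error q g h c)"
    unfolding jet_def
  proof (intro conjI allI impI)
    fix \<alpha> :: "'n \<Rightarrow> nat" assume a: "multi_order \<alpha> \<le> nat \<lfloor>m\<rfloor>"
    show "scaled_error q g h c \<alpha> \<in> borel_measurable borel"
      unfolding scaled_error_def[abs_def] using gm[OF a] by measurable
    show "l2sq (ball 0 R) (scaled_error q g h c \<alpha>) < \<infinity>"
      unfolding scaled_error_def[abs_def]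
      by (rule l2sq_diff_finite[OF _ gm[OF a] poly_jet_measurable l2[OF a] l2sq_continuous_finite[OF _ _ poly_jet_continuous]]) auto
  next
    fix \<alpha> :: "'n \<Rightarrow> nat" and i assume a: "multi_order \<alpha> < nat \<lfloor>m\<rfloor>"
    have "wpart (ball 0 R0) i (g \<alpha>) (g (\<alpha>(i := Suc (\<alpha> i))))" using jet a by (simp add: jet_def)
    from wpart_scale[OF this h(1), of "h ^ multi_order \<alpha>"]
    have "wpart (ball 0 R) i (\<lambda>x. h ^ multi_order \<alpha> * g \<alpha> (h *\<^sub>R x)) (\<lambda>x. h ^ multi_order \<alpha> * h * g (\<alpha>(i := Suc (\<alpha> i))) (h *\<^sub>R x))"
      by (rule wpart_subset[OF _ sub']) simp
    from wpart_diff[OF this poly_jet_wpart[of _ i q c \<alpha>]]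
    show "wpart (ball 0 R) i (scaled_error q g h c \<alpha>) (scaled_error q g h c (\<alpha>(i := Suc (\<alpha> i))))"
      by (simp add: scaled_error_def[abs_def] multi_order_upd mult.commute[of h])
  qed
qed

text \<open>The polynomial contributes only a constant to derivatives of top order. The exponents
  are \<open>2 * \<lfloor>m\<rfloor>\<close> from the chain rule, \<open>d + 2 * frac m\<close> from
  the kernel and \<open>- 2 * d\<close> from the two integrals, in total
  \<open>2 * m - d\<close>.\<close>

lemma scaled_error_slob:
  fixes g :: "('n::finite \<Rightarrow> nat) \<Rightarrow> real^'n \<Rightarrow> real"
  assumes dn: "d = CARD('n)" and J: "jet_le m (ball 0 R0) g 1" and h: "0 < h" "h * R \<le> R0"
    and \<alpha>: "multi_order \<alpha> = nat \<lfloor>m\<rfloor>" and fm: "frac m \<noteq> 0"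
  shows "slob (ball 0 R) (frac m) (scaled_error q g h c \<alpha>) \<le> ennreal (h powr (2 * m - real d))"
proof -
  have sub: "ball 0 (h * R) \<subseteq> ball (0::real^'n) R0" using h by auto
  have bm: "g \<alpha> \<in> borel_measurable borel" using J \<alpha> by (simp add: jet_le_def jet_def)
  have "scaled_error q g h c \<alpha> x - scaled_error q g h c \<alpha> y
      = h ^ multi_order \<alpha> * g \<alpha> (h *\<^sub>R x) - h ^ multi_order \<alpha> * g \<alpha> (h *\<^sub>R y)" for x y
    using poly_jet_top[of q \<alpha> c x y] order_bounds(2) \<alpha> by (simp add: scaled_error_def)
  then have "slob (ball 0 R) (frac m) (scaled_error q g h c \<alpha>) = slob (ball 0 R) (frac m) (\<lambda>x. h ^ multi_order \<alpha> * g \<alpha> (h *\<^sub>R x))"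
    by (simp add: slob_def dbl_def)
  also have "\<dots> = ennreal ((h ^ multi_order \<alpha>)\<^sup>2 * h powr (real CARD('n) + 2 * frac m) / (h ^ CARD('n))\<^sup>2) * slob (ball 0 (h * R)) (frac m) (g \<alpha>)"
    by (rule slob_scale[OF h(1) bm])
  also have "\<dots> \<le> ennreal ((h ^ multi_order \<alpha>)\<^sup>2 * h powr (real CARD('n) + 2 * frac m) / (h ^ CARD('n))\<^sup>2) * ennreal 1"
  proof (intro mult_left_mono)
    have "slob (ball 0 (h * R)) (frac m) (g \<alpha>) \<le> slob (ball 0 R0) (frac m) (g \<alpha>)" by (rule slob_mono[OF sub])
    also have "\<dots> \<le> ennreal 1" using J \<alpha> fm by (simp add: jet_le_def)
    finally show "slob (ball 0 (h * R)) (frac m) (g \<alpha>) \<le> ennreal 1" .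
  qed simp
  also have "(h ^ multi_order \<alpha>)\<^sup>2 * h powr (real CARD('n) + 2 * frac m) / (h ^ CARD('n))\<^sup>2 = h powr (2 * m - real d)"
  proof -
    have mM: "m = real (multi_order \<alpha>) + frac m" using order_bounds(3) by (simp add: \<alpha> frac_def)
    have "2 * m - real d = real (multi_order \<alpha>) + real (multi_order \<alpha>) + (real CARD('n) + 2 * frac m) - real CARD('n) - real CARD('n)"
      using mM dn by linarith
    then show ?thesis using h(1) by (simp only: powr_add powr_diff powr_realpow power2_eq_square divide_divide_eq_left)
  qed
  finally show ?thesis by simp
qed

text \<open>No trace of the polynomial is left at these orders. Chain rule and substitution give the
  exponent \<open>2 * k - d\<close>, and the growth bound on the ball of radius \<open>h * R\<close>
  adds the missing \<open>2 * (m - k)\<close>.\<close>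

lemma scaled_error_l2sq_high:
  assumes dn: "d = CARD('n::finite)" and qk: "q \<le> k" and kM: "k \<le> nat \<lfloor>m\<rfloor>"
  shows "\<exists>C\<ge>0. \<forall>(g :: ('n \<Rightarrow> nat) \<Rightarrow> real^'n \<Rightarrow> real) h c \<alpha>. matched m R R0 q g h c \<longrightarrow>
      multi_order \<alpha> = k \<longrightarrow> l2sq (ball 0 R) (scaled_error q g h c \<alpha>) \<le> ennreal (C * h powr (2 * m - real d))"
proof -
  \<comment> \<open>The entry \<open>m - q\<close> keeps the cap inactive for every
    \<open>k \<ge> q\<close>; the other entry makes the nonnegativity immediate and is still below
    \<open>d / 2\<close>.\<close>
  define \<theta> where "\<theta> = max (m - real q) ((real d - 1) / 2)"
  have \<theta>: "0 \<le> \<theta>" "2 * \<theta> < real CARD('n)"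
  proof -
    have d1: "0 \<le> (real d - 1) / 2" using d by simp
    show "0 \<le> \<theta>" unfolding \<theta>_def by (rule max.coboundedI2[OF d1])
    have "\<theta> < real d / 2" unfolding \<theta>_def using order_bounds(1) by (simp only: max_less_iff_conj) simp
    then show "2 * \<theta> < real CARD('n)" using dn by simp
  qed
  obtain C where B: "jet_bound m R0 k (l2sq :: (real^'n) set \<Rightarrow> _) C (2 * min (m - real k) \<theta>)"
    using jet_growth[OF R(2) less_imp_le[OF order_bounds(3)] \<theta> kM] by blast
  then have C: "C \<ge> 0" by (simp add: jet_bound_def)
  have mk: "min (m - real k) \<theta> = m - real k" using qk by (simp add: \<theta>_def)
  show ?thesis
  proof (intro exI[of _ "C * R powr (2 * (m - real k))"] conjI allI impI)
    show "0 \<le> C * R powr (2 * (m - real k))" using C by simp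
    fix g :: "('n \<Rightarrow> nat) \<Rightarrow> real^'n \<Rightarrow> real" and h c and \<alpha> :: "'n \<Rightarrow> nat"
    assume "matched m R R0 q g h c" and \<alpha>: "multi_order \<alpha> = k"
    then have J: "jet_le m (ball 0 R0) g 1" and h: "0 < h" "h * R \<le> R0" by (simp_all add: matched_def)
    have bm: "g \<alpha> \<in> borel_measurable borel" using J \<alpha> kM by (simp add: jet_le_def jet_def)
    have "scaled_error q g h c \<alpha> = (\<lambda>x. h ^ k * g \<alpha> (h *\<^sub>R x))"
      using poly_jet_high[of q \<alpha> c] qk \<alpha> by (simp add: scaled_error_def[abs_def])
    then have "l2sq (ball 0 R) (scaled_error q g h c \<alpha>) = ennreal ((h ^ k)\<^sup>2 / h ^ CARD('n)) * l2sq (ball 0 (h * R)) (g \<alpha>)"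
      by (simp only: l2sq_scale[OF h(1) bm])
    also have "\<dots> \<le> ennreal ((h ^ k)\<^sup>2 / h ^ CARD('n)) * ennreal (C * 1 * (h * R) powr (2 * min (m - real k) \<theta>))"
      using h R by (intro mult_left_mono jet_boundD[OF B J \<alpha>]) auto
    also have "\<dots> = ennreal ((h ^ k)\<^sup>2 / h ^ CARD('n) * (C * 1 * (h * R) powr (2 * (m - real k))))"
      unfolding mk using h C by (intro ennreal_mult[symmetric]) auto
    also have "(h ^ k)\<^sup>2 / h ^ CARD('n) * (C * 1 * (h * R) powr (2 * (m - real k))) = C * R powr (2 * (m - real k)) * h powr (2 * m - real d)"
    proof -
      have "h powr (2 * m - real d) = h powr (real k + real k + 2 * (m - real k) - real CARD('n))"
        using dn by (simp add: algebra_simps)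
      also have "\<dots> = (h ^ k)\<^sup>2 * h powr (2 * (m - real k)) / h ^ CARD('n)"
        using h(1) by (simp only: powr_add powr_diff powr_realpow power2_eq_square)
      finally show ?thesis using h R by (simp add: powr_mult)
    qed
    finally show "l2sq (ball 0 R) (scaled_error q g h c \<alpha>) \<le> ennreal (C * R powr (2 * (m - real k)) * h powr (2 * m - real d))" .
  qed
qed

text \<open>The induction descends in the order. Below \<open>q\<close> the means vanish, so the
  Poincare inequality on the fixed ball of radius \<open>R\<close> bounds order \<open>n\<close> by
  order \<open>n + 1\<close> without losing a power of \<open>h\<close>.\<close>

lemma scaled_error_l2sq:
  assumes dn: "d = CARD('n::finite)" and k: "k \<le> nat \<lfloor>m\<rfloor>"
  shows "\<exists>C\<ge>0. \<forall>(g :: ('n \<Rightarrow> nat) \<Rightarrow> real^'n \<Rightarrow> real) h c \<alpha>. matched m R R0 q g h c \<longrightarrow>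
      multi_order \<alpha> = k \<longrightarrow> l2sq (ball 0 R) (scaled_error q g h c \<alpha>) \<le> ennreal (C * h powr (2 * m - real d))"
  using k
proof (induction k rule: inc_induct)
    case base
    show ?case
    proof (cases "q \<le> nat \<lfloor>m\<rfloor>")
      case True
      then show ?thesis by (rule scaled_error_l2sq_high[OF dn]) simp
    next
      case False
      \<comment> \<open>Here \<open>q = \<lfloor>m\<rfloor> + 1\<close>, so no order from
        \<open>q\<close> on is available to start from; the fractional seminorm of top order takes
        this place.\<close>
      then have fm: "frac m \<noteq> 0" using order_bounds(2,4) by simp
      have \<sigma>: "frac m > 0" using fm frac_ge_0[of m] by linarith
      let ?C = "2 powr (real CARD('n) + 2 * frac m) / unit_ball_vol (real CARD('n)) * R powr (2 * frac m)"
      show ?thesis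
      proof (intro exI[of _ ?C] conjI allI impI)
        show "0 \<le> ?C" by simp
        fix g :: "('n \<Rightarrow> nat) \<Rightarrow> real^'n \<Rightarrow> real" and h c and \<alpha> :: "'n \<Rightarrow> nat"
        assume M: "matched m R R0 q g h c" and \<alpha>: "multi_order \<alpha> = nat \<lfloor>m\<rfloor>"
        then have J: "jet_le m (ball 0 R0) g 1" and h: "0 < h" "h * R \<le> R0"
          and av: "\<forall>\<beta>. multi_order \<beta> < q \<longrightarrow> multi_order \<beta> \<le> nat \<lfloor>m\<rfloor> \<longrightarrow> avg (ball 0 R) (scaled_error q g h c \<beta>) = 0"
          by (simp_all add: matched_def)
        have j: "jet (nat \<lfloor>m\<rfloor>) (ball 0 R) (scaled_error q g h c)" by (rule scaled_jet(1)[OF dn J h])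
        have "avg (ball 0 R) (scaled_error q g h c \<alpha>) = 0" using av \<alpha> False by simp
        then have "l2sq (ball 0 R) (scaled_error q g h c \<alpha>) \<le> ennreal ?C * slob (ball 0 R) (frac m) (scaled_error q g h c \<alpha>)"
          using fractional_poincare_ball[OF R(1) _ _ \<sigma>, of "scaled_error q g h c \<alpha>" 0] j \<alpha> by (simp add: jet_def osc_def)
        also have "\<dots> \<le> ennreal ?C * ennreal (h powr (2 * m - real d))"
          by (intro mult_left_mono scaled_error_slob[OF dn J h \<alpha> fm]) simp
        also have "\<dots> = ennreal (?C * h powr (2 * m - real d))" by (intro ennreal_mult[symmetric]) auto
        finally show "l2sq (ball 0 R) (scaled_error q g h c \<alpha>) \<le> ennreal (?C * h powr (2 * m - real d))" .
      qed
    qed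
  next
    case (step n)
    show ?case
    proof (cases "q \<le> n")
      case True
      then show ?thesis by (rule scaled_error_l2sq_high[OF dn]) (use step.hyps in simp)
    next
      case False
      obtain B where B: "B \<ge> 0" "\<And>(g :: ('n \<Rightarrow> nat) \<Rightarrow> real^'n \<Rightarrow> real) h c \<alpha>. \<lbrakk>matched m R R0 q g h c; multi_order \<alpha> = Suc n\<rbrakk> \<Longrightarrow> l2sq (ball 0 R) (scaled_error q g h c \<alpha>) \<le> ennreal (B * h powr (2 * m - real d))"
        using step.IH by blast
      let ?C = "12 * 2 ^ CARD('n) * R\<^sup>2 * (real CARD('n) * B)"
      show ?thesis
      proof (intro exI[of _ ?C] conjI allI impI)
        show "0 \<le> ?C" using B by simp
        fix g :: "('n \<Rightarrow> nat) \<Rightarrow> real^'n \<Rightarrow> real" and h c and \<alpha> :: "'n \<Rightarrow> nat"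
        assume M: "matched m R R0 q g h c" and \<alpha>: "multi_order \<alpha> = n"
        then have J: "jet_le m (ball 0 R0) g 1" and h: "0 < h" "h * R \<le> R0"
          and av: "\<forall>\<beta>. multi_order \<beta> < q \<longrightarrow> multi_order \<beta> \<le> nat \<lfloor>m\<rfloor> \<longrightarrow> avg (ball 0 R) (scaled_error q g h c \<beta>) = 0"
          by (simp_all add: matched_def)
        let ?w = "scaled_error q g h c"
        have j: "jet (nat \<lfloor>m\<rfloor>) (ball 0 R) ?w" by (rule scaled_jet(1)[OF dn J h])
        have "avg (ball 0 R) (?w \<alpha>) = 0" using av \<alpha> False step.hyps by simp
        then have "l2sq (ball 0 R) (?w \<alpha>) = osc (ball 0 R) (?w \<alpha>)" by (simp add: osc_def)
        also have "\<dots> \<le> ennreal (12 * 2 ^ CARD('n) * R\<^sup>2) * (\<Sum>i\<in>UNIV. l2sq (ball 0 R) (?w (\<alpha>(i := Suc (\<alpha> i)))))"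
          using j \<alpha> step.hyps by (intro poincare_ball R) (simp_all add: jet_def)
        also have "\<dots> \<le> ennreal (12 * 2 ^ CARD('n) * R\<^sup>2) * (\<Sum>i\<in>(UNIV::'n set). ennreal (B * h powr (2 * m - real d)))"
          using \<alpha> by (intro mult_left_mono sum_mono B(2)[OF M]) (simp_all add: multi_order_upd)
        also have "(\<Sum>i\<in>(UNIV::'n set). ennreal (B * h powr (2 * m - real d))) = ennreal (\<Sum>i\<in>(UNIV::'n set). B * h powr (2 * m - real d))"
          using B by (intro sum_ennreal) auto
        also have "ennreal (12 * 2 ^ CARD('n) * R\<^sup>2) * ennreal (\<Sum>i\<in>(UNIV::'n set). B * h powr (2 * m - real d))
            = ennreal (12 * 2 ^ CARD('n) * R\<^sup>2 * (\<Sum>i\<in>(UNIV::'n set). B * h powr (2 * m - real d)))"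
          using B by (intro ennreal_mult[symmetric]) (auto intro!: sum_nonneg)
        also have "12 * 2 ^ CARD('n) * R\<^sup>2 * (\<Sum>i\<in>(UNIV::'n set). B * h powr (2 * m - real d)) = ?C * h powr (2 * m - real d)"
          by simp
        finally show "l2sq (ball 0 R) (?w \<alpha>) \<le> ennreal (?C * h powr (2 * m - real d))" .
      qed
    qed
qed

lemma scaled_approximation:
  assumes dn: "d = CARD('n::finite)"
  obtains C where "C \<ge> 0"
    "\<And>(g :: ('n \<Rightarrow> nat) \<Rightarrow> real^'n \<Rightarrow> real) h. \<lbrakk>jet_le m (ball 0 R0) g 1; 0 < h; h * R \<le> R0\<rbrakk> \<Longrightarrow>
      \<exists>c. jet_le m (ball 0 R) (scaled_error q g h c) (C * h powr (2 * m - real d))"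
proof -
  have "\<forall>k. \<exists>C. k \<le> nat \<lfloor>m\<rfloor> \<longrightarrow> C \<ge> 0 \<and> (\<forall>(g :: ('n \<Rightarrow> nat) \<Rightarrow> real^'n \<Rightarrow> real) h c \<alpha>. matched m R R0 q g h c \<longrightarrow>
      multi_order \<alpha> = k \<longrightarrow> l2sq (ball 0 R) (scaled_error q g h c \<alpha>) \<le> ennreal (C * h powr (2 * m - real d)))"
    using scaled_error_l2sq[OF dn] by meson
  then obtain C where C: "\<And>k. k \<le> nat \<lfloor>m\<rfloor> \<Longrightarrow> C k \<ge> 0" and bound:
    "\<And>(g :: ('n \<Rightarrow> nat) \<Rightarrow> real^'n \<Rightarrow> real) h c \<alpha>. \<lbrakk>multi_order \<alpha> \<le> nat \<lfloor>m\<rfloor>; matched m R R0 q g h c\<rbrakk> \<Longrightarrow>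
      l2sq (ball 0 R) (scaled_error q g h c \<alpha>) \<le> ennreal (C (multi_order \<alpha>) * h powr (2 * m - real d))"
    by metis
  \<comment> \<open>The summand \<open>1\<close> covers the difference seminorm of top order, whose
    bound has constant one.\<close>
  define D where "D = 1 + (\<Sum>k\<le>nat \<lfloor>m\<rfloor>. C k)"
  have D1: "D \<ge> 1" using C by (auto simp: D_def intro!: sum_nonneg)
  have CD: "C k \<le> D" if "k \<le> nat \<lfloor>m\<rfloor>" for k
  proof -
    have "C k \<le> (\<Sum>k\<le>nat \<lfloor>m\<rfloor>. C k)" using that C by (intro member_le_sum) auto
    then show ?thesis by (simp add: D_def)
  qed
  show thesis
  proof (rule that[of D])
    show "D \<ge> 0" using D1 by simp
    fix g :: "('n \<Rightarrow> nat) \<Rightarrow> real^'n \<Rightarrow> real" and h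
    assume J: "jet_le m (ball 0 R0) g 1" and h: "0 < h" "h * R \<le> R0"
    have B: "bounded (ball (0::real^'n) R)" "ball (0::real^'n) R \<in> sets borel" by auto
    note mb = measure_ball[OF R(1), of "0::real^'n"]
    obtain c where c: "\<And>\<beta>. multi_order \<beta> < q \<Longrightarrow> avg (ball 0 R) (poly_jet q c \<beta>) = avg (ball 0 R) (\<lambda>x. h ^ multi_order \<beta> * g \<beta> (h *\<^sub>R x))"
      using poly_jet_matching[OF B mb(2), of q "\<lambda>\<beta>. avg (ball 0 R) (\<lambda>x. h ^ multi_order \<beta> * g \<beta> (h *\<^sub>R x))"] by blast
    have av: "\<forall>\<beta>. multi_order \<beta> < q \<longrightarrow> multi_order \<beta> \<le> nat \<lfloor>m\<rfloor> \<longrightarrow> avg (ball 0 R) (scaled_error q g h c \<beta>) = 0"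
    proof (intro allI impI)
      fix \<beta> :: "'n \<Rightarrow> nat" assume b: "multi_order \<beta> < q" "multi_order \<beta> \<le> nat \<lfloor>m\<rfloor>"
      have [measurable]: "g \<beta> \<in> borel_measurable borel" using J b by (simp add: jet_le_def jet_def)
      have "set_integrable lborel (ball 0 R) (\<lambda>x. h ^ multi_order \<beta> * g \<beta> (h *\<^sub>R x))"
        by (rule l2sq_finiteD(1)[OF B(2) mb(3) _ scaled_jet(2)[OF dn J h b(2)]]) measurable
      from avg_diff[OF this set_integrable_continuous_bounded[OF B poly_jet_continuous[of q c \<beta>]]] c[OF b(1)]
      show "avg (ball 0 R) (scaled_error q g h c \<beta>) = 0" by (simp add: scaled_error_def[abs_def])
    qed
    have "jet_le m (ball 0 R) (scaled_error q g h c) (D * h powr (2 * m - real d))"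
      unfolding jet_le_def
    proof (intro conjI allI impI)
      show "jet (nat \<lfloor>m\<rfloor>) (ball 0 R) (scaled_error q g h c)" by (rule scaled_jet(1)[OF dn J h])
      show "0 \<le> D * h powr (2 * m - real d)" using D1 by simp
      fix \<alpha> :: "'n \<Rightarrow> nat"
      show "l2sq (ball 0 R) (scaled_error q g h c \<alpha>) \<le> ennreal (D * h powr (2 * m - real d))" if a: "multi_order \<alpha> \<le> nat \<lfloor>m\<rfloor>"
      proof -
        have "l2sq (ball 0 R) (scaled_error q g h c \<alpha>) \<le> ennreal (C (multi_order \<alpha>) * h powr (2 * m - real d))"
          by (rule bound[OF a]) (use J h av in \<open>simp add: matched_def\<close>)
        also have "\<dots> \<le> ennreal (D * h powr (2 * m - real d))" using CD[OF a] by (intro ennreal_leI mult_right_mono) auto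
        finally show ?thesis .
      qed
      show "slob (ball 0 R) (frac m) (scaled_error q g h c \<alpha>) \<le> ennreal (D * h powr (2 * m - real d))"
        if fm: "frac m \<noteq> 0" and a: "multi_order \<alpha> = nat \<lfloor>m\<rfloor>"
      proof -
        have "slob (ball 0 R) (frac m) (scaled_error q g h c \<alpha>) \<le> ennreal (h powr (2 * m - real d))"
          by (rule scaled_error_slob[OF dn J h a fm])
        also have "\<dots> \<le> ennreal (D * h powr (2 * m - real d))"
          using mult_right_mono[OF D1, of "h powr (2 * m - real d)"] by (intro ennreal_leI) simp
        finally show ?thesis .
      qed
    qed
    then show "\<exists>c. jet_le m (ball 0 R) (scaled_error q g h c) (D * h powr (2 * m - real d))" by blast
  qed
qed

end

subsection \<open>Sobolev functions as families of Borel functions\<close>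

lemma ex_count_list: "\<exists>is. \<forall>i. count_list is i = (\<alpha> :: 'n::finite \<Rightarrow> nat) i"
proof (induction "multi_order \<alpha>" arbitrary: \<alpha>)
  case 0
  then have "\<alpha> i = 0" for i using multi_order_component_le[of \<alpha> i] by simp
  then show ?case by (intro exI[of _ "[]"]) simp
next
  case (Suc n)
  have "\<exists>i. \<alpha> i \<noteq> 0"
  proof (rule ccontr)
    assume "\<not> ?thesis"
    with Suc(2) show False by (simp add: multi_order_def)
  qed
  then obtain i where i: "\<alpha> i \<noteq> 0" by blast
  let ?\<beta> = "\<alpha>(i := \<alpha> i - 1)"
  have \<alpha>: "\<alpha> = ?\<beta>(i := Suc (?\<beta> i))" using i by auto
  have "n = multi_order ?\<beta>" using Suc(2) multi_order_upd[of ?\<beta> i] \<alpha> by simp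
  then obtain js where js: "\<forall>i. count_list js i = ?\<beta> i" using Suc(1) by blast
  have "count_list (i # js) j = \<alpha> j" for j using js i by auto
  then show ?case by blast
qed

lemma multi_order_count_list: "multi_order (count_list is) = length is" for "is" :: "'n::finite list"
proof (induction "is")
  case (Cons i js)
  have e: "count_list (i # js) = (count_list js)(i := Suc (count_list js i))" by (rule ext) simp
  show ?case by (simp only: e multi_order_upd Cons.IH length_Cons)
qed (simp add: multi_order_def)

lemma test_foldr: "\<phi> \<in> test_functions S \<Longrightarrow> foldr partial_deriv is \<phi> \<in> test_functions S"
  by (induction "is") (auto intro: test_partial)

text \<open>The bridge between the definitions, which integrate over \<open>lebesgue_on S\<close>,
  and the proof, which integrates Borel functions over \<open>lborel\<close>. The two functions are
  compared on \<open>S\<close> only.\<close>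

definition borel_rep :: "(real^'n::finite) set \<Rightarrow> (real^'n \<Rightarrow> real) \<Rightarrow> (real^'n \<Rightarrow> real) \<Rightarrow> bool" where
  "borel_rep S f f' \<longleftrightarrow> f' \<in> borel_measurable borel \<and>
     (\<lambda>x. indicator S x * f x) \<in> borel_measurable lebesgue \<and> (AE x in lborel. x \<in> S \<longrightarrow> f x = f' x)"

lemma borel_rep_self:
  assumes "S \<in> sets borel" "f' \<in> borel_measurable borel" "\<And>x. x \<in> S \<Longrightarrow> f x = f' x"
  shows "borel_rep S f f'"
proof -
  have "(\<lambda>x. indicator S x * f' x) \<in> borel_measurable lborel" using assms by measurable
  then have "(\<lambda>x. indicator S x * f' x) \<in> borel_measurable lebesgue" by (rule measurable_completion)
  moreover have "(\<lambda>x. indicator S x * f x) = (\<lambda>x. indicator S x * f' x)"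
    using assms(3) by (auto simp: indicator_def)
  ultimately show ?thesis using assms by (auto simp: borel_rep_def)
qed

text \<open>Measurability on compact boxes is glued over a countable cover of \<open>S\<close>. A
  Lebesgue measurable function agrees almost everywhere with a Borel one, and integrability over
  compact sets carries over.\<close>

lemma locally_integrable_borel_rep:
  fixes u :: "real^'n::finite \<Rightarrow> real"
  assumes S: "open S" and u: "locally_integrable S u"
  obtains u' where "borel_rep S u u'" "\<And>K. compact K \<Longrightarrow> K \<subseteq> S \<Longrightarrow> set_integrable lborel K u'"
proof -
  obtain \<D> where \<D>: "countable \<D>" "\<D> \<subseteq> Pow S" "\<And>X. X \<in> \<D> \<Longrightarrow> \<exists>a b. X = cbox a b" "\<Union>\<D> = S"
    using open_countable_Union_open_cbox[OF S] by metis
  have meas: "(\<lambda>x. indicator S x * u x) \<in> borel_measurable lebesgue"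
  \<comment> \<open>The set \<open>- S\<close> joins the boxes as one more piece, on which the
    cut-off function is zero.\<close>
  proof (rule measurable_piecewise_restrict[where C = "insert (- S) \<D>"])
    show "countable (insert (- S) \<D>)" using \<D> by simp
    show "space lebesgue \<subseteq> \<Union>(insert (- S) \<D>)" using \<D>(4) by auto
    fix X assume X: "X \<in> insert (- S) \<D>"
    show "X \<inter> space lebesgue \<in> sets lebesgue"
    proof (cases "X = - S")
      case True
      have "- S \<in> sets borel" using S by auto
      then show ?thesis using True by simp
    next
      case False
      then obtain a b where "X = cbox a b" using X \<D>(3) by blast
      then show ?thesis by simp
    qed
    show "(\<lambda>x. indicator S x * u x) \<in> borel_measurable (lebesgue_on X)"
    proof (cases "X = - S")
      case True
      have "(\<lambda>x. indicator S x * u x) \<in> borel_measurable (lebesgue_on X) \<longleftrightarrow> (\<lambda>_. 0 :: real) \<in> borel_measurable (lebesgue_on X)"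
        using True by (intro measurable_cong) (simp add: space_restrict_space)
      then show ?thesis by simp
    next
      case False
      then obtain a b where X': "X = cbox a b" "X \<subseteq> S" using X \<D>(2,3) by blast
      then have "integrable (lebesgue_on X) u" using u by (auto simp: locally_integrable_def)
      then have "u \<in> borel_measurable (lebesgue_on X)" by (rule borel_measurable_integrable)
      moreover have "(\<lambda>x. indicator S x * u x) \<in> borel_measurable (lebesgue_on X) \<longleftrightarrow> u \<in> borel_measurable (lebesgue_on X)"
        using X'(2) by (intro measurable_cong) (auto simp: space_restrict_space indicator_def)
      ultimately show ?thesis by simp
    qed
  qed
  then obtain u' where u': "u' \<in> borel_measurable lborel" "AE x in lborel. indicator S x * u x = u' x"
    using completion_ex_borel_measurable_real by blast
  have [measurable]: "u' \<in> borel_measurable borel" using u'(1) by simp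
  have ae: "AE x in lborel. x \<in> S \<longrightarrow> u x = u' x"
    using u'(2) by eventually_elim (auto simp: indicator_def)
  show thesis
  proof (rule that[of u'])
    show "borel_rep S u u'" using meas ae by (auto simp: borel_rep_def)
    fix K assume K: "compact K" "K \<subseteq> S"
    have KL: "K \<in> sets borel" using K(1) by (rule borel_compact)
    have "integrable (lebesgue_on K) u" using u K by (auto simp: locally_integrable_def)
    then have iu: "integrable lebesgue (\<lambda>x. indicator K x *\<^sub>R u x)"
      using KL by (subst (asm) integrable_restrict_space) auto
    have m': "(\<lambda>x. indicator K x *\<^sub>R u' x) \<in> borel_measurable lborel" using KL by measurable
    have "AE x in lebesgue. indicator K x *\<^sub>R u x = indicator K x *\<^sub>R u' x"
    proof (rule AE_completion)
      show "AE x in lborel. indicator K x *\<^sub>R u x = indicator K x *\<^sub>R u' x"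
        using ae by eventually_elim (use K(2) in \<open>auto simp: indicator_def\<close>)
    qed
    from integrable_cong_AE[THEN iffD1, OF borel_measurable_integrable[OF iu] measurable_completion[OF m'] this iu]
    have "integrable lebesgue (\<lambda>x. indicator K x *\<^sub>R u' x)" .
    then show "set_integrable lborel K u'"
      unfolding set_integrable_def using integrable_completion[OF m'] by simp
  qed
qed

lemma lebesgue_on_test_integral:
  fixes f :: "real^'n::finite \<Rightarrow> real"
  assumes S: "open S" and f: "borel_rep S f f'" and \<phi>: "\<phi> \<in> test_functions S"
  shows "(LINT x|lebesgue_on S. f x * \<phi> x) = (LINT x|lborel. f' x * \<phi> x)"
proof -
  note [measurable] = test_measurable[OF \<phi>]
  have [measurable]: "f' \<in> borel_measurable borel" using f by (simp add: borel_rep_def)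
  have m': "(\<lambda>x. f' x * \<phi> x) \<in> borel_measurable lborel" by measurable
  have \<phi>m: "\<phi> \<in> borel_measurable lebesgue" by (rule measurable_completion) measurable
  have "(LINT x|lebesgue_on S. f x * \<phi> x) = (LINT x|lebesgue. indicator S x *\<^sub>R (f x * \<phi> x))"
    using S by (intro integral_restrict_space) auto
  also have "\<dots> = (LINT x|lebesgue. f' x * \<phi> x)"
  proof (rule integral_cong_AE)
    have "(\<lambda>x. (indicator S x * f x) * \<phi> x) \<in> borel_measurable lebesgue"
      by (rule borel_measurable_times[OF _ \<phi>m]) (use f in \<open>simp add: borel_rep_def\<close>)
    then show "(\<lambda>x. indicator S x *\<^sub>R (f x * \<phi> x)) \<in> borel_measurable lebesgue" by (simp add: mult.assoc)
    show "(\<lambda>x. f' x * \<phi> x) \<in> borel_measurable lebesgue" using m' by (rule measurable_completion)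
    show "AE x in lebesgue. indicator S x *\<^sub>R (f x * \<phi> x) = f' x * \<phi> x"
    proof (rule AE_completion)
      have "AE x in lborel. x \<in> S \<longrightarrow> f x = f' x" using f by (simp add: borel_rep_def)
      then show "AE x in lborel. indicator S x *\<^sub>R (f x * \<phi> x) = f' x * \<phi> x"
        by eventually_elim (use test_zero[OF \<phi>] in \<open>auto simp: indicator_def\<close>)
    qed
  qed
  also have "\<dots> = (LINT x|lborel. f' x * \<phi> x)" by (rule integral_completion[OF m'])
  finally show ?thesis .
qed

lemma test_functions_support: "\<phi> \<in> test_functions S \<Longrightarrow> \<phi> \<in> test_functions (closure {x. \<phi> x \<noteq> 0})"
  by (simp add: test_functions_def)

text \<open>As \<open>weak_deriv\<close> is a choice, this uniqueness is what allows the Sobolev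
  norm to be evaluated with whichever family of weak derivatives is at hand.\<close>

lemma weak_deriv_unique:
  fixes u :: "real^'n::finite \<Rightarrow> real"
  assumes S: "open S" and g: "has_weak_deriv S \<alpha> u g1" "has_weak_deriv S \<alpha> u g2"
  shows "AE x in lborel. x \<in> S \<longrightarrow> g1 x = g2 x"
proof -
  have li: "locally_integrable S g1" "locally_integrable S g2" using g by (auto simp: has_weak_deriv_def)
  obtain f1 where f1: "borel_rep S g1 f1" "\<And>K. compact K \<Longrightarrow> K \<subseteq> S \<Longrightarrow> set_integrable lborel K f1"
    using locally_integrable_borel_rep[OF S li(1)] by blast
  obtain f2 where f2: "borel_rep S g2 f2" "\<And>K. compact K \<Longrightarrow> K \<subseteq> S \<Longrightarrow> set_integrable lborel K f2"
    using locally_integrable_borel_rep[OF S li(2)] by blast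
  obtain js where js: "\<forall>i. count_list js i = \<alpha> i" using ex_count_list by blast
  have "AE x in lborel. x \<in> S \<longrightarrow> f1 x - f2 x = 0"
  proof (rule fundamental_lemma[OF S])
    show "set_integrable lborel (cbox a b) (\<lambda>x. f1 x - f2 x)" if "cbox a b \<subseteq> S" for a b
      using f1(2)[OF compact_cbox that] f2(2)[OF compact_cbox that] by (rule set_integral_diff)
    fix \<phi> assume \<phi>: "\<phi> \<in> test_functions S"
    have "(- 1) ^ multi_order \<alpha> * (LINT x|lebesgue_on S. g1 x * \<phi> x) = (- 1) ^ multi_order \<alpha> * (LINT x|lebesgue_on S. g2 x * \<phi> x)"
      using g \<phi> js by (auto simp: has_weak_deriv_def)
    then have "(LINT x|lebesgue_on S. g1 x * \<phi> x) = (LINT x|lebesgue_on S. g2 x * \<phi> x)" by simp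
    then have eq: "(LINT x|lborel. f1 x * \<phi> x) = (LINT x|lborel. f2 x * \<phi> x)"
      by (simp add: lebesgue_on_test_integral[OF S f1(1) \<phi>] lebesgue_on_test_integral[OF S f2(1) \<phi>])
    have "integrable lborel (\<lambda>x. f1 x * \<phi> x)" "integrable lborel (\<lambda>x. f2 x * \<phi> x)"
      using f1(2)[OF test_compact[OF \<phi>] test_subset[OF \<phi>]] f2(2)[OF test_compact[OF \<phi>] test_subset[OF \<phi>]]
      by (auto intro: integrable_mult_test[OF _ test_functions_support[OF \<phi>]])
    then show "(LINT x|lborel. (f1 x - f2 x) * \<phi> x) = 0" using eq by (simp add: left_diff_distrib)
  qed
  moreover have "AE x in lborel. x \<in> S \<longrightarrow> g1 x = f1 x" "AE x in lborel. x \<in> S \<longrightarrow> g2 x = f2 x"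
    using f1 f2 by (auto simp: borel_rep_def)
  ultimately show ?thesis by eventually_elim auto
qed

lemma weak_deriv_works: "has_weak_deriv S \<alpha> u g \<Longrightarrow> has_weak_deriv S \<alpha> u (weak_deriv S \<alpha> u)"
  unfolding weak_deriv_def by (rule someI[where P = "has_weak_deriv S \<alpha> u"])

lemma L2_sq_eq_l2sq:
  assumes S: "open S" and ae: "AE x in lborel. x \<in> S \<longrightarrow> f x = f' x"
  shows "L2_sq S f = l2sq S f'"
proof -
  have "L2_sq S f = (\<integral>\<^sup>+x. ennreal ((f x)\<^sup>2) * indicator S x \<partial>lebesgue)"
    unfolding L2_sq_def using S by (intro nn_integral_restrict_space) auto
  also have "\<dots> = (\<integral>\<^sup>+x. ennreal ((f x)\<^sup>2) * indicator S x \<partial>lborel)" by (rule nn_integral_completion)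
  also have "\<dots> = l2sq S f'"
    unfolding l2sq_def by (rule nn_integral_cong_AE) (use ae in \<open>eventually_elim, auto simp: indicator_def\<close>)
  finally show ?thesis .
qed

text \<open>The representative is inserted in the inner integral for every fixed \<open>x\<close>,
  and then in the outer one, so that no null sets of the product space occur.\<close>

lemma slobodeckij_sq_eq_slob:
  fixes f :: "real^'n::finite \<Rightarrow> real"
  assumes S: "open S" and ae: "AE x in lborel. x \<in> S \<longrightarrow> f x = f' x"
  shows "slobodeckij_sq S \<sigma> f = slob S \<sigma> f'"
proof -
  have "(\<integral>\<^sup>+y. ennreal ((f x - f y)\<^sup>2 / norm (x - y) powr (real CARD('n) + 2 * \<sigma>)) \<partial>lebesgue_on S)
      = (\<integral>\<^sup>+y\<in>S. ennreal ((f x - f' y)\<^sup>2) * ennreal (1 / norm (y - x) powr (real CARD('n) + 2 * \<sigma>)) \<partial>lborel)" (is "?L x = ?I (f x) x") for x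
  proof -
    have "?L x = (\<integral>\<^sup>+y. ennreal ((f x - f y)\<^sup>2 / norm (x - y) powr (real CARD('n) + 2 * \<sigma>)) * indicator S y \<partial>lebesgue)"
      using S by (intro nn_integral_restrict_space) auto
    also have "\<dots> = (\<integral>\<^sup>+y. ennreal ((f x - f y)\<^sup>2 / norm (x - y) powr (real CARD('n) + 2 * \<sigma>)) * indicator S y \<partial>lborel)"
      by (rule nn_integral_completion)
    also have "\<dots> = ?I (f x) x"
    proof (rule nn_integral_cong_AE)
      have e: "ennreal (a\<^sup>2 / norm (x - y) powr c) = ennreal (a\<^sup>2) * ennreal (1 / norm (y - x) powr c)" for a c y
        by (subst ennreal_mult[symmetric]) (auto simp: norm_minus_commute)
      show "AE y in lborel. ennreal ((f x - f y)\<^sup>2 / norm (x - y) powr (real CARD('n) + 2 * \<sigma>)) * indicator S y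
          = ennreal ((f x - f' y)\<^sup>2) * ennreal (1 / norm (y - x) powr (real CARD('n) + 2 * \<sigma>)) * indicator S y"
        using ae by eventually_elim (auto simp: e indicator_def)
    qed
    finally show ?thesis .
  qed
  then have "slobodeckij_sq S \<sigma> f = (\<integral>\<^sup>+x. ?I (f x) x \<partial>lebesgue_on S)" by (simp add: slobodeckij_sq_def)
  also have "\<dots> = (\<integral>\<^sup>+x. ?I (f x) x * indicator S x \<partial>lebesgue)"
    using S by (intro nn_integral_restrict_space) auto
  also have "\<dots> = (\<integral>\<^sup>+x. ?I (f x) x * indicator S x \<partial>lborel)" by (rule nn_integral_completion)
  also have "\<dots> = (\<integral>\<^sup>+x. ?I (f' x) x * indicator S x \<partial>lborel)"
    by (rule nn_integral_cong_AE) (use ae in \<open>eventually_elim, auto simp: indicator_def\<close>)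
  finally show ?thesis by (simp add: slob_def dbl_def)
qed

lemma has_weak_deriv_cong:
  assumes "\<And>x. x \<in> S \<Longrightarrow> u x = v x"
  shows "has_weak_deriv S \<alpha> u g \<longleftrightarrow> has_weak_deriv S \<alpha> v g"
proof -
  have "integrable (lebesgue_on K) u \<longleftrightarrow> integrable (lebesgue_on K) v" if "K \<subseteq> S" for K
    using that assms by (intro Bochner_Integration.integrable_cong) (auto simp: space_restrict_space)
  then have "locally_integrable S u \<longleftrightarrow> locally_integrable S v" by (auto simp: locally_integrable_def)
  moreover have "(LINT x|lebesgue_on S. u x * \<phi> x) = (LINT x|lebesgue_on S. v x * \<phi> x)" for \<phi>
    using assms by (intro Bochner_Integration.integral_cong) (auto simp: space_restrict_space)
  ultimately show ?thesis by (simp add: has_weak_deriv_def)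
qed

text \<open>The derivatives are moved from \<open>\<phi>\<close> to the jet one at a time, outermost
  first; \<open>\<beta>\<close> records those already moved.\<close>

lemma jet_iterated:
  fixes g :: "('n::finite \<Rightarrow> nat) \<Rightarrow> real^'n \<Rightarrow> real"
  assumes "jet M S g" "multi_order \<beta> + length is \<le> M" "\<phi> \<in> test_functions S"
  shows "(LINT x|lborel. g \<beta> x * foldr partial_deriv is \<phi> x)
    = (- 1) ^ length is * (LINT x|lborel. g (\<lambda>i. \<beta> i + count_list is i) x * \<phi> x)"
  using assms(2)
proof (induction "is" arbitrary: \<beta>)
  case (Cons i js)
  let ?\<beta> = "\<beta>(i := Suc (\<beta> i))"
  have "wpart S i (g \<beta>) (g ?\<beta>)" using assms(1) Cons.prems by (simp add: jet_def)
  then have "(LINT x|lborel. g \<beta> x * partial_deriv i (foldr partial_deriv js \<phi>) x) = - (LINT x|lborel. g ?\<beta> x * foldr partial_deriv js \<phi> x)"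
    using test_foldr[OF assms(3)] by (simp add: wpart_def)
  also have "(LINT x|lborel. g ?\<beta> x * foldr partial_deriv js \<phi> x) = (- 1) ^ length js * (LINT x|lborel. g (\<lambda>j. ?\<beta> j + count_list js j) x * \<phi> x)"
    using Cons.prems by (intro Cons.IH) (simp only: multi_order_upd length_Cons add_Suc add_Suc_right)
  also have "(\<lambda>j. ?\<beta> j + count_list js j) = (\<lambda>j. \<beta> j + count_list (i # js) j)" by (rule ext) simp
  finally show ?case by simp
qed simp

lemma jet_has_weak_deriv:
  fixes g :: "('n::finite \<Rightarrow> nat) \<Rightarrow> real^'n \<Rightarrow> real"
  assumes S: "open S" "bounded S" and g: "jet M S g" and \<alpha>: "multi_order \<alpha> \<le> M"
  shows "has_weak_deriv S \<alpha> (g (\<lambda>_. 0)) (g \<alpha>)"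
proof -
  have Sb: "S \<in> sets borel" "emeasure lborel S < \<infinity>" using S emeasure_bounded_finite by auto
  have bm: "g \<beta> \<in> borel_measurable borel" if "multi_order \<beta> \<le> M" for \<beta> using g that by (simp add: jet_def)
  have li: "locally_integrable S (g \<beta>)" if b: "multi_order \<beta> \<le> M" for \<beta>
    unfolding locally_integrable_def
  proof (intro allI impI)
    fix K assume K: "compact K \<and> K \<subseteq> S"
    then have KL: "K \<in> sets borel" by (auto intro: borel_compact)
    have "set_integrable lborel S (g \<beta>)"
      by (rule l2sq_finiteD(1)[OF Sb bm[OF b]]) (use g b in \<open>simp add: jet_def\<close>)
    then have i: "set_integrable lborel K (g \<beta>)" by (rule set_integrable_subset) (use K KL in auto)
    have "(\<lambda>x. indicator K x *\<^sub>R g \<beta> x) \<in> borel_measurable lborel" using KL bm[OF b] by measurable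
    then have "integrable lebesgue (\<lambda>x. indicator K x *\<^sub>R g \<beta> x)"
      using i by (simp add: set_integrable_def integrable_completion)
    then show "integrable (lebesgue_on K) (g \<beta>)" using KL by (subst integrable_restrict_space) auto
  qed
  have z: "multi_order (\<lambda>_::'n. 0) = 0" by (simp add: multi_order_def)
  show ?thesis
    unfolding has_weak_deriv_def
  proof (intro conjI ballI allI impI)
    show "locally_integrable S (g (\<lambda>_. 0))" "locally_integrable S (g \<alpha>)" using li z \<alpha> by auto
    fix \<phi> "is" assume \<phi>: "\<phi> \<in> test_functions S" and c: "\<forall>i. count_list is i = \<alpha> i"
    have \<alpha>': "\<alpha> = count_list is" using c by (simp add: fun_eq_iff)
    have len: "multi_order \<alpha> = length is" by (simp add: \<alpha>' multi_order_count_list)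
    have "(LINT x|lebesgue_on S. g (\<lambda>_. 0) x * foldr partial_deriv is \<phi> x) = (LINT x|lborel. g (\<lambda>_. 0) x * foldr partial_deriv is \<phi> x)"
      using Sb bm z by (intro lebesgue_on_test_integral[OF S(1) borel_rep_self test_foldr[OF \<phi>]]) auto
    also have "\<dots> = (- 1) ^ length is * (LINT x|lborel. g (\<lambda>i. 0 + count_list is i) x * \<phi> x)"
      using \<alpha> len z by (intro jet_iterated[OF g _ \<phi>]) simp
    also have "(\<lambda>i. 0 + count_list is i) = \<alpha>" by (simp add: \<alpha>')
    also have "(LINT x|lborel. g \<alpha> x * \<phi> x) = (LINT x|lebesgue_on S. g \<alpha> x * \<phi> x)"
      using Sb bm \<alpha> by (intro lebesgue_on_test_integral[OF S(1) borel_rep_self \<phi>, symmetric]) auto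
    finally show "(LINT x|lebesgue_on S. g (\<lambda>_. 0) x * foldr partial_deriv is \<phi> x)
        = (- 1) ^ multi_order \<alpha> * (LINT x|lebesgue_on S. g \<alpha> x * \<phi> x)" by (simp add: len)
  qed
qed

lemma finite_multi_order_le: "finite {\<alpha>::'n::finite \<Rightarrow> nat. multi_order \<alpha> \<le> M}" "finite {\<alpha>::'n::finite \<Rightarrow> nat. multi_order \<alpha> = M}"
  by (rule finite_subset[OF _ finite_multi_order[of "Suc M"]], auto)+

text \<open>Each summand of the squared Sobolev norm is at most \<open>E\<close>, because the chosen
  weak derivatives agree with the jet almost everywhere; \<open>N\<close> bounds the number of
  summands.\<close>

lemma sobolev_of_jet:
  fixes w :: "('n::finite \<Rightarrow> nat) \<Rightarrow> real^'n \<Rightarrow> real"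
  assumes S: "open S" "bounded S" and w: "jet_le \<mu> S w E" and v: "\<And>x. x \<in> S \<Longrightarrow> v x = w (\<lambda>_. 0) x"
  defines "N \<equiv> real (card {\<alpha>::'n \<Rightarrow> nat. multi_order \<alpha> \<le> nat \<lfloor>\<mu>\<rfloor>} + card {\<alpha>::'n \<Rightarrow> nat. multi_order \<alpha> = nat \<lfloor>\<mu>\<rfloor>})"
  shows "v \<in> sobolev_space S \<mu>" "sobolev_norm S \<mu> v \<le> sqrt (N * E)"
proof -
  let ?M = "nat \<lfloor>\<mu>\<rfloor>"
  have j: "jet ?M S w" and E: "E \<ge> 0" using w by (auto simp: jet_le_def)
  have wd: "has_weak_deriv S \<alpha> v (w \<alpha>)" if "multi_order \<alpha> \<le> ?M" for \<alpha>
    using jet_has_weak_deriv[OF S j that] has_weak_deriv_cong[of S v "w (\<lambda>_. 0)", OF v] by simp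
  have ae: "AE x in lborel. x \<in> S \<longrightarrow> weak_deriv S \<alpha> v x = w \<alpha> x" if "multi_order \<alpha> \<le> ?M" for \<alpha>
  proof (rule weak_deriv_unique[OF S(1)])
    show "has_weak_deriv S \<alpha> v (weak_deriv S \<alpha> v)" by (rule weak_deriv_works[OF wd[OF that]])
  qed (rule wd[OF that])
  have A: "(\<Sum>\<alpha>\<in>{\<alpha>::'n \<Rightarrow> nat. multi_order \<alpha> \<le> ?M}. L2_sq S (weak_deriv S \<alpha> v)) \<le> (\<Sum>\<alpha>\<in>{\<alpha>::'n \<Rightarrow> nat. multi_order \<alpha> \<le> ?M}. ennreal E)"
    using w by (intro sum_mono) (auto simp: L2_sq_eq_l2sq[OF S(1) ae] jet_le_def)
  have B: "(if frac \<mu> = 0 then 0 else \<Sum>\<alpha>\<in>{\<alpha>::'n \<Rightarrow> nat. multi_order \<alpha> = ?M}. slobodeckij_sq S (frac \<mu>) (weak_deriv S \<alpha> v))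
      \<le> (\<Sum>\<alpha>\<in>{\<alpha>::'n \<Rightarrow> nat. multi_order \<alpha> = ?M}. ennreal E)"
  proof (cases "frac \<mu> = 0")
    case False
    have "(\<Sum>\<alpha>\<in>{\<alpha>::'n \<Rightarrow> nat. multi_order \<alpha> = ?M}. slobodeckij_sq S (frac \<mu>) (weak_deriv S \<alpha> v)) \<le> (\<Sum>\<alpha>\<in>{\<alpha>::'n \<Rightarrow> nat. multi_order \<alpha> = ?M}. ennreal E)"
    proof (rule sum_mono)
      fix \<alpha> :: "'n \<Rightarrow> nat" assume "\<alpha> \<in> {\<alpha>. multi_order \<alpha> = ?M}"
      then show "slobodeckij_sq S (frac \<mu>) (weak_deriv S \<alpha> v) \<le> ennreal E"
        using slobodeckij_sq_eq_slob[OF S(1) ae, of \<alpha>] w False by (simp add: jet_le_def)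
    qed
    with False show ?thesis by simp
  qed simp
  have "sobolev_sq S \<mu> v \<le> (\<Sum>\<alpha>\<in>{\<alpha>::'n \<Rightarrow> nat. multi_order \<alpha> \<le> ?M}. ennreal E) + (\<Sum>\<alpha>\<in>{\<alpha>::'n \<Rightarrow> nat. multi_order \<alpha> = ?M}. ennreal E)"
    unfolding sobolev_sq_def by (intro add_mono A B)
  also have "\<dots> = ennreal (N * E)"
    using E by (simp add: N_def ennreal_mult distrib_right ennreal_of_nat_eq_real_of_nat)
  finally have le: "sobolev_sq S \<mu> v \<le> ennreal (N * E)" .
  then have "sobolev_sq S \<mu> v < \<infinity>" by (auto intro: le_less_trans)
  then show "v \<in> sobolev_space S \<mu>" using wd by (auto simp: sobolev_space_def)
  have "enn2real (sobolev_sq S \<mu> v) \<le> N * E"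
    using enn2real_mono[OF le] E by (simp add: N_def)
  then show "sobolev_norm S \<mu> v \<le> sqrt (N * E)" by (simp add: sobolev_norm_def)
qed

lemma jet_of_sobolev:
  fixes u :: "real^'n::finite \<Rightarrow> real"
  assumes S: "open S" "bounded S" and m: "m \<ge> 0" and u: "u \<in> sobolev_space_cont S m" "sobolev_norm S m u \<le> 1"
  obtains g where "jet_le m S g 1" "\<And>x. x \<in> S \<Longrightarrow> g (\<lambda>_. 0) x = u x"
proof -
  let ?M = "nat \<lfloor>m\<rfloor>"
  have Sb: "S \<in> sets borel" "emeasure lborel S < \<infinity>" using S emeasure_bounded_finite by auto
  have us: "u \<in> sobolev_space S m" and uc: "continuous_on S u" using u by (auto simp: sobolev_space_cont_def)
  have wd: "has_weak_deriv S \<alpha> u (weak_deriv S \<alpha> u)" if "multi_order \<alpha> \<le> ?M" for \<alpha>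
    using us that weak_deriv_works unfolding sobolev_space_def by blast
  have z: "multi_order (\<lambda>_::'n. 0) = 0" by (simp add: multi_order_def)
  have li: "locally_integrable S u" using wd[of "\<lambda>_. 0"] z by (auto simp: has_weak_deriv_def)
  define u0 where "u0 x = indicator S x * u x" for x
  have u0: "u0 \<in> borel_measurable borel"
    unfolding u0_def using borel_measurable_continuous_on_indicator[OF Sb(1) uc] by simp
  have u0S: "u0 x = u x" if "x \<in> S" for x using that by (simp add: u0_def)
  have rep0: "borel_rep S u u0" by (rule borel_rep_self[OF Sb(1) u0]) (simp add: u0S)
  have rep0': "borel_rep S (weak_deriv S (\<lambda>_. 0) u) u0"
  proof -
    have "has_weak_deriv S (\<lambda>_. 0) u u"
      unfolding has_weak_deriv_def
    proof (intro conjI ballI allI impI li)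
      fix \<phi> and js :: "'n list" assume "\<forall>i. count_list js i = 0"
      then have "js = []" by (simp add: count_list_0_iff)
      then show "(LINT x|lebesgue_on S. u x * foldr partial_deriv js \<phi> x) = (- 1) ^ multi_order (\<lambda>_::'n. 0) * (LINT x|lebesgue_on S. u x * \<phi> x)"
        by (simp add: z)
    qed
    then have "AE x in lborel. x \<in> S \<longrightarrow> weak_deriv S (\<lambda>_. 0) u x = u x"
      using weak_deriv_unique[OF S(1) wd[of "\<lambda>_. 0"]] z by simp
    then have "AE x in lborel. x \<in> S \<longrightarrow> weak_deriv S (\<lambda>_. 0) u x = u0 x"
      by eventually_elim (simp add: u0S)
    moreover obtain f where "borel_rep S (weak_deriv S (\<lambda>_. 0) u) f"
      using locally_integrable_borel_rep[OF S(1)] wd[of "\<lambda>_. 0"] z by (metis has_weak_deriv_def le0)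
    ultimately show ?thesis using u0 by (simp add: borel_rep_def)
  qed
  have "\<exists>f. multi_order \<alpha> \<le> ?M \<longrightarrow> borel_rep S (weak_deriv S \<alpha> u) f" for \<alpha>
    using locally_integrable_borel_rep[OF S(1)] wd[of \<alpha>] by (metis has_weak_deriv_def)
  then obtain f where f: "\<And>\<alpha>. multi_order \<alpha> \<le> ?M \<Longrightarrow> borel_rep S (weak_deriv S \<alpha> u) (f \<alpha>)" by metis
  \<comment> \<open>The entry of order zero is the continuous function \<open>u\<close> itself, cut
    off outside \<open>S\<close>. Point evaluations act on it, so its values must survive
    exactly.\<close>
  define g where "g \<alpha> = (if \<alpha> = (\<lambda>_. 0) then u0 else f \<alpha>)" for \<alpha>
  have g: "borel_rep S (weak_deriv S \<alpha> u) (g \<alpha>)" if "multi_order \<alpha> \<le> ?M" for \<alpha>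
    using f[OF that] rep0' by (simp add: g_def)
  have ae: "AE x in lborel. x \<in> S \<longrightarrow> weak_deriv S \<alpha> u x = g \<alpha> x" if "multi_order \<alpha> \<le> ?M" for \<alpha>
    using g[OF that] by (simp add: borel_rep_def)
  have gm: "g \<alpha> \<in> borel_measurable borel" if "multi_order \<alpha> \<le> ?M" for \<alpha>
    using g[OF that] by (simp add: borel_rep_def)
  have fin: "sobolev_sq S m u < \<infinity>" using us by (simp add: sobolev_space_def)
  have "enn2real (sobolev_sq S m u) \<le> 1" using u(2) by (simp add: sobolev_norm_def)
  then have "ennreal (enn2real (sobolev_sq S m u)) \<le> ennreal 1" by (rule ennreal_leI)
  then have sq1: "sobolev_sq S m u \<le> 1" using fin by simp
  have l2: "l2sq S (g \<alpha>) \<le> 1" if a: "multi_order \<alpha> \<le> ?M" for \<alpha>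
  proof -
    have "l2sq S (g \<alpha>) = L2_sq S (weak_deriv S \<alpha> u)" by (rule L2_sq_eq_l2sq[OF S(1) ae[OF a], symmetric])
    also have "\<dots> \<le> (\<Sum>\<alpha>\<in>{\<alpha>. multi_order \<alpha> \<le> ?M}. L2_sq S (weak_deriv S \<alpha> u))"
      by (rule member_le_sum[OF _ _ finite_multi_order_le(1)]) (use a in auto)
    also have "\<dots> \<le> sobolev_sq S m u" unfolding sobolev_sq_def by simp
    finally show ?thesis using sq1 by (rule order_trans)
  qed
  have sl: "slob S (frac m) (g \<alpha>) \<le> 1" if a: "multi_order \<alpha> = ?M" and fm: "frac m \<noteq> 0" for \<alpha>
  proof -
    have "slob S (frac m) (g \<alpha>) = slobodeckij_sq S (frac m) (weak_deriv S \<alpha> u)"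
      by (rule slobodeckij_sq_eq_slob[OF S(1) ae, symmetric]) (simp add: a)
    also have "\<dots> \<le> (\<Sum>\<alpha>\<in>{\<alpha>. multi_order \<alpha> = ?M}. slobodeckij_sq S (frac m) (weak_deriv S \<alpha> u))"
      by (rule member_le_sum[OF _ _ finite_multi_order_le(2)]) (use a in auto)
    also have "\<dots> \<le> sobolev_sq S m u" unfolding sobolev_sq_def using fm by simp
    finally show ?thesis using sq1 by (rule order_trans)
  qed
  have l2fin: "l2sq S (g \<alpha>) < \<infinity>" if a: "multi_order \<alpha> \<le> ?M" for \<alpha>
    by (rule le_less_trans[OF l2[OF a]]) simp
  have si: "set_integrable lborel S (g \<alpha>)" if a: "multi_order \<alpha> \<le> ?M" for \<alpha>
    by (rule l2sq_finiteD(1)[OF Sb gm[OF a] l2fin[OF a]])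
  have wp: "wpart S i (g \<alpha>) (g (\<alpha>(i := Suc (\<alpha> i))))" if a: "multi_order \<alpha> < ?M" for \<alpha> i
  proof -
    let ?\<beta> = "\<alpha>(i := Suc (\<alpha> i))"
    have aM: "multi_order \<alpha> \<le> ?M" and bM: "multi_order ?\<beta> \<le> ?M" using a by (auto simp: multi_order_upd)
    obtain js where js: "\<forall>j. count_list js j = \<alpha> j" using ex_count_list by blast
    \<comment> \<open>With \<open>i\<close> at the end of the list, \<open>foldr\<close> takes the
      derivative in direction \<open>i\<close> first. The identity of order \<open>?\<beta>\<close>
      for \<open>\<phi>\<close> and the one of order \<open>\<alpha>\<close> for
      \<open>partial_deriv i \<phi>\<close> thus share their left-hand side.\<close>
    have js': "\<forall>j. count_list (js @ [i]) j = ?\<beta> j" using js by simp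
    show ?thesis
      unfolding wpart_def
    proof (intro conjI ballI gm si aM bM)
      fix \<phi> assume \<phi>: "\<phi> \<in> test_functions S"
      note \<phi>i = test_partial[OF \<phi>, of i]
      have "(LINT x|lebesgue_on S. u x * foldr partial_deriv js (partial_deriv i \<phi>) x)
          = (- 1) ^ multi_order \<alpha> * (LINT x|lebesgue_on S. weak_deriv S \<alpha> u x * partial_deriv i \<phi> x)"
        using wd[OF aM] \<phi>i js unfolding has_weak_deriv_def by blast
      moreover have "(LINT x|lebesgue_on S. u x * foldr partial_deriv (js @ [i]) \<phi> x)
          = (- 1) ^ multi_order ?\<beta> * (LINT x|lebesgue_on S. weak_deriv S ?\<beta> u x * \<phi> x)"
        using wd[OF bM] \<phi> js' unfolding has_weak_deriv_def by blast
      ultimately have "(- 1) ^ multi_order \<alpha> * (LINT x|lebesgue_on S. weak_deriv S \<alpha> u x * partial_deriv i \<phi> x)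
          = (- 1) ^ multi_order \<alpha> * - (LINT x|lebesgue_on S. weak_deriv S ?\<beta> u x * \<phi> x)"
        by (simp add: multi_order_upd)
      then have "(LINT x|lebesgue_on S. weak_deriv S \<alpha> u x * partial_deriv i \<phi> x) = - (LINT x|lebesgue_on S. weak_deriv S ?\<beta> u x * \<phi> x)"
        by (subst (asm) mult_cancel_left) simp
      then show "(LINT x|lborel. g \<alpha> x * partial_deriv i \<phi> x) = - (LINT x|lborel. g ?\<beta> x * \<phi> x)"
        by (simp only: lebesgue_on_test_integral[OF S(1) g[OF aM] \<phi>i] lebesgue_on_test_integral[OF S(1) g[OF bM] \<phi>])
    qed
  qed
  show thesis
  proof (rule that[of g])
    show "jet_le m S g 1"
      unfolding jet_le_def jet_def using gm l2 wp sl l2fin by auto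
    show "g (\<lambda>_. 0) x = u x" if "x \<in> S" for x using that by (simp add: g_def u0S)
  qed
qed

subsection \<open>The convergence rate\<close>

text \<open>Only the difference seminorm of order \<open>\<lfloor>\<mu>\<rfloor>\<close> is new. If
  \<open>\<mu>\<close> and \<open>m\<close> have the same integer part, the seminorm of order
  \<open>m\<close> dominates it on a bounded set; otherwise one more derivative lies in
  \<open>L2\<close>, and the chains turn its bound into a bound for differences.\<close>

lemma jet_le_lower_order:
  fixes S :: "(real^'n::finite) set"
  assumes S: "open S" "bounded S" and W: "finite W" "chained S \<delta> W" "\<delta> > 0" and \<mu>: "0 \<le> \<mu>" "\<mu> \<le> m"
  obtains C where "C \<ge> 0" "\<And>w E. jet_le m S w E \<Longrightarrow> jet_le \<mu> S w (C * E)"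
proof -
  let ?M = "nat \<lfloor>m\<rfloor>" and ?N = "nat \<lfloor>\<mu>\<rfloor>"
  have Sb: "S \<in> sets borel" "emeasure lborel S < \<infinity>" using S emeasure_bounded_finite by auto
  have NM: "?N \<le> ?M" using \<mu> by (intro nat_mono floor_mono)
  have red: "jet_le \<mu> S w (C * E)"
    if w: "jet_le m S w E" and C: "C \<ge> 1"
      and sl: "\<And>\<alpha>. frac \<mu> \<noteq> 0 \<Longrightarrow> multi_order \<alpha> = ?N \<Longrightarrow> slob S (frac \<mu>) (w \<alpha>) \<le> ennreal (C * E)"
    for w E C
  proof -
    have E: "E \<ge> 0" using w by (simp add: jet_le_def)
    have "E \<le> C * E" using mult_right_mono[OF C E] by simp
    then have EC: "ennreal E \<le> ennreal (C * E)" by (rule ennreal_leI)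
    have l2: "l2sq S (w \<alpha>) \<le> ennreal (C * E)" if "multi_order \<alpha> \<le> ?N" for \<alpha>
      by (rule order_trans[OF _ EC]) (use w that NM in \<open>simp add: jet_le_def\<close>)
    have "jet ?N S w" using w NM by (simp add: jet_le_def jet_def)
    then show ?thesis using l2 sl E C unfolding jet_le_def by auto
  qed
  show thesis
  proof (cases "frac \<mu> = 0")
    case True
    show thesis by (rule that[of 1]) (use red[of _ _ 1] True in auto)
  next
    case fr: False
    have fr0: "frac \<mu> > 0" using fr frac_ge_0[of \<mu>] by linarith
    have fr1: "frac \<mu> < 1" by (rule frac_lt_1)
    show thesis
    proof (cases "?N = ?M")
      case True
      then have fl: "\<lfloor>\<mu>\<rfloor> = \<lfloor>m\<rfloor>" using \<mu> by (simp add: eq_nat_nat_iff)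
      then have fle: "frac \<mu> \<le> frac m" using \<mu> by (simp add: frac_def)
      then have fm: "frac m \<noteq> 0" using fr0 by linarith
      obtain B where B: "\<And>x. x \<in> S \<Longrightarrow> norm x \<le> B" using S(2) by (auto simp: bounded_iff)
      have D: "norm (y - x) \<le> B + B" if "x \<in> S" "y \<in> S" for x y
        using norm_triangle_ineq4[of y x] B[OF that(1)] B[OF that(2)] by linarith
      define C where "C = max 1 ((B + B) powr (2 * (frac m - frac \<mu>)))"
      have C: "C \<ge> 1" "C \<ge> (B + B) powr (2 * (frac m - frac \<mu>))" by (auto simp: C_def)
      show thesis
      proof (rule that[of C])
        show "C \<ge> 0" using C(1) by simp
        fix w E assume w: "jet_le m S w E"
        have E: "E \<ge> 0" using w by (simp add: jet_le_def)
        show "jet_le \<mu> S w (C * E)"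
        proof (rule red[OF w C(1)])
          fix \<alpha> :: "'n \<Rightarrow> nat" assume \<alpha>: "multi_order \<alpha> = ?N"
          have "w \<alpha> \<in> borel_measurable borel" using w \<alpha> True by (simp add: jet_le_def jet_def)
          then have "slob S (frac \<mu>) (w \<alpha>) \<le> ennreal ((B + B) powr (2 * (frac m - frac \<mu>))) * slob S (frac m) (w \<alpha>)"
            by (intro slob_le_slob Sb D fle)
          also have "\<dots> \<le> ennreal C * ennreal E"
            using w \<alpha> True fm C by (intro mult_mono ennreal_leI) (auto simp: jet_le_def)
          also have "\<dots> = ennreal (C * E)" using C E by (intro ennreal_mult[symmetric]) auto
          finally show "slob S (frac \<mu>) (w \<alpha>) \<le> ennreal (C * E)" .
        qed
      qed
    next
      case False
      have lt: "?N < ?M" using NM False by (rule le_neq_implies_less)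
      obtain C1 where C1: "C1 \<ge> 0" "\<And>g G. (\<And>i. wpart S i g (G i)) \<Longrightarrow> slob S (frac \<mu>) g \<le> ennreal C1 * (l2sq S g + (\<Sum>i\<in>UNIV. l2sq S (G i)))"
        using slob_le_gradient[OF S(1) Sb(2) W fr0 fr1] by metis
      define C where "C = max 1 (C1 * (1 + real CARD('n)))"
      have C: "C \<ge> 1" "C \<ge> C1 * (1 + real CARD('n))" by (auto simp: C_def)
      show thesis
      proof (rule that[of C])
        show "C \<ge> 0" using C(1) by simp
        fix w E assume w: "jet_le m S w E"
        have E: "E \<ge> 0" using w by (simp add: jet_le_def)
        show "jet_le \<mu> S w (C * E)"
        proof (rule red[OF w C(1)])
          fix \<alpha> :: "'n \<Rightarrow> nat" assume \<alpha>: "multi_order \<alpha> = ?N"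
          have aM: "multi_order \<alpha> \<le> ?M" and bM: "multi_order (\<alpha>(i := Suc (\<alpha> i))) \<le> ?M" for i
            unfolding multi_order_upd \<alpha> using lt by (rule less_imp_le, rule Suc_leI)
          have b: "l2sq S (w \<beta>) \<le> ennreal E" if "multi_order \<beta> \<le> ?M" for \<beta>
            using w that by (simp add: jet_le_def)
          have "slob S (frac \<mu>) (w \<alpha>) \<le> ennreal C1 * (l2sq S (w \<alpha>) + (\<Sum>i\<in>UNIV. l2sq S (w (\<alpha>(i := Suc (\<alpha> i))))))"
            by (rule C1(2)) (use w \<alpha> lt in \<open>simp add: jet_le_def jet_def\<close>)
          also have "\<dots> \<le> ennreal C1 * (ennreal E + (\<Sum>i\<in>(UNIV::'n set). ennreal E))"
            by (intro mult_left_mono add_mono sum_mono b aM bM) simp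
          also have "(\<Sum>i\<in>(UNIV::'n set). ennreal E) = ennreal (\<Sum>i\<in>(UNIV::'n set). E)"
            using E by (intro sum_ennreal) auto
          also have "ennreal C1 * (ennreal E + ennreal (\<Sum>i\<in>(UNIV::'n set). E)) = ennreal (C1 * (E + (\<Sum>i\<in>(UNIV::'n set). E)))"
          proof -
            have s0: "0 \<le> (\<Sum>i\<in>(UNIV::'n set). E)" using E by (rule sum_nonneg)
            show ?thesis
              by (simp only: ennreal_plus[OF E s0] ennreal_mult[OF C1(1) add_nonneg_nonneg[OF E s0]])
          qed
          also have "\<dots> \<le> ennreal (C * E)"
          proof (rule ennreal_leI)
            have "C1 * (E + (\<Sum>i\<in>(UNIV::'n set). E)) = C1 * (1 + real CARD('n)) * E" by (simp add: algebra_simps)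
            also have "\<dots> \<le> C * E" using C E by (intro mult_right_mono)
            finally show "C1 * (E + (\<Sum>i\<in>(UNIV::'n set). E)) \<le> C * E" .
          qed
          finally show "slob S (frac \<mu>) (w \<alpha>) \<le> ennreal (C * E)" .
        qed
      qed
    qed
  qed
qed

lemma poly_jet_le:
  fixes S :: "(real^'n::finite) set"
  assumes S: "open S" "bounded S"
  shows "\<exists>E. jet_le (real M) S (poly_jet q c) E"
proof -
  have Sb: "S \<in> sets borel" using S by auto
  define E where "E = (\<Sum>\<alpha>\<in>{\<alpha>::'n \<Rightarrow> nat. multi_order \<alpha> \<le> M}. enn2real (l2sq S (poly_jet q c \<alpha>)))"
  have fin: "l2sq S (poly_jet q c \<alpha>) < \<infinity>" for \<alpha>
    by (rule l2sq_continuous_finite[OF S(2) Sb poly_jet_continuous])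
  have "l2sq S (poly_jet q c \<alpha>) \<le> ennreal E" if "multi_order \<alpha> \<le> M" for \<alpha>
  proof -
    have "enn2real (l2sq S (poly_jet q c \<alpha>)) \<le> E"
      unfolding E_def by (rule member_le_sum[OF _ _ finite_multi_order_le(1)]) (use that in auto)
    then have "ennreal (enn2real (l2sq S (poly_jet q c \<alpha>))) \<le> ennreal E" by (rule ennreal_leI)
    then show ?thesis using fin by simp
  qed
  then have "jet_le (real M) S (poly_jet q c) E"
    unfolding jet_le_def jet_def using fin poly_jet_wpart[OF S(2) Sb]
    by (auto simp: E_def intro!: sum_nonneg)
  then show ?thesis by blast
qed

lemma stencil_rate:
  fixes \<Omega> X :: "(real^'n::finite) set"
    and m \<mu> s :: real
    and \<Lambda> :: "(real^'n \<Rightarrow> real) \<Rightarrow> real"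
  assumes m: "m > real CARD('n) / 2"
    and dom: "bounded_lipschitz_domain \<Omega>" and scal: "scalable \<Omega>"
    and X: "finite X" "X \<subseteq> \<Omega>"
    and \<mu>: "0 \<le> \<mu>" "\<mu> \<le> m"
    and cont: "continuous_functional_on_sobolev \<Omega> \<mu> \<Lambda>"
    and order: "has_scaling_order (sobolev_space \<Omega> \<mu>) \<Lambda> s"
    and exact: "poly_exact \<Lambda> X (polyharmonic_order m CARD('n)) a"
  shows "has_convergence_rate \<Omega> m (stencil_error \<Lambda> s X a) (m - s - real CARD('n) / 2)"
proof -
  define q where "q = polyharmonic_order m CARD('n)"
  have \<Omega>: "open \<Omega>" "bounded \<Omega>" using dom by (auto simp: bounded_lipschitz_domain_def)
  have \<Omega>b: "\<Omega> \<in> sets borel" using \<Omega> by auto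
  have m2: "2 * m > real CARD('n)" and m0: "m \<ge> 0" using m by (auto intro: order_trans[rotated])
  have lin: "linear_functional_on (sobolev_space \<Omega> \<mu>) \<Lambda>" using cont by (simp add: continuous_functional_on_sobolev_def)
  obtain C\<Lambda>' where "\<And>u. u \<in> sobolev_space \<Omega> \<mu> \<Longrightarrow> \<bar>\<Lambda> u\<bar> \<le> C\<Lambda>' * sobolev_norm \<Omega> \<mu> u"
    using cont by (auto simp: continuous_functional_on_sobolev_def)
  \<comment> \<open>Taking the absolute value makes the continuity constant monotone in the norm
    estimate.\<close>
  define C\<Lambda> where "C\<Lambda> = \<bar>C\<Lambda>'\<bar>"
  have C\<Lambda>: "C\<Lambda> \<ge> 0" "\<bar>\<Lambda> u\<bar> \<le> C\<Lambda> * sobolev_norm \<Omega> \<mu> u" if "u \<in> sobolev_space \<Omega> \<mu>" for u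
  proof -
    show "C\<Lambda> \<ge> 0" by (simp add: C\<Lambda>_def)
    have "C\<Lambda>' * sobolev_norm \<Omega> \<mu> u \<le> C\<Lambda> * sobolev_norm \<Omega> \<mu> u"
      unfolding C\<Lambda>_def by (intro mult_right_mono) (auto simp: sobolev_norm_def)
    then show "\<bar>\<Lambda> u\<bar> \<le> C\<Lambda> * sobolev_norm \<Omega> \<mu> u"
      using \<open>\<And>u. u \<in> sobolev_space \<Omega> \<mu> \<Longrightarrow> \<bar>\<Lambda> u\<bar> \<le> C\<Lambda>' * sobolev_norm \<Omega> \<mu> u\<close>[OF that] by simp
  qed
  have C\<Lambda>0: "C\<Lambda> \<ge> 0" by (simp add: C\<Lambda>_def)
  obtain R' where R': "R' > 0" "\<And>x. x \<in> \<Omega> \<Longrightarrow> norm x \<le> R'" using \<Omega>(2) by (auto simp: bounded_pos)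
  \<comment> \<open>The margin lets the unit ball about each node fit into \<open>ball 0 R\<close>,
    so that the point bound with radius one applies to the remainder.\<close>
  define R where "R = R' + 2"
  have R: "R > 0" using R' by (simp add: R_def)
  have \<Omega>R: "\<Omega> \<subseteq> ball 0 R" using R'(2) by (force simp: R_def)
  have XR: "ball x 1 \<subseteq> ball 0 R" if "x \<in> X" for x
  proof
    fix y assume "y \<in> ball x 1"
    then have "norm (x - y) < 1" by (simp add: dist_norm)
    moreover have "norm x \<le> R'" using R'(2) X that by auto
    ultimately show "y \<in> ball 0 R" using norm_triangle_ineq2[of y x] by (simp add: R_def norm_minus_commute)
  qed
  have "0 \<in> \<Omega>" using scal interior_subset by (auto simp: scalable_def)
  then obtain R0 where R0: "R0 > 0" "ball 0 R0 \<subseteq> \<Omega>" using \<Omega>(1) by (auto simp: open_contains_ball)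
  obtain \<delta> W where W: "\<delta> > 0" "finite W" "chained \<Omega> \<delta> W" using lipschitz_domain_chained[OF dom] by metis
  obtain C1 where C1: "C1 \<ge> 0" and appr: "\<And>(g :: ('n \<Rightarrow> nat) \<Rightarrow> real^'n \<Rightarrow> real) h. \<lbrakk>jet_le m (ball 0 R0) g 1; 0 < h; h * R \<le> R0\<rbrakk> \<Longrightarrow>
      \<exists>c. jet_le m (ball 0 R) (scaled_error q g h c) (C1 * h powr (2 * m - real CARD('n)))"
    using scaled_approximation[OF m2 R R0(1) q_def _ refl] by (metis zero_less_card_finite)
  obtain C2 where C2: "C2 \<ge> 0" and lower: "\<And>w E. jet_le m (ball (0::real^'n) R) w E \<Longrightarrow> jet_le \<mu> (ball 0 R) w (C2 * E)"
    using jet_le_lower_order[where S = "ball (0::real^'n) R" and W = "{0}" and \<delta> = 1, OF open_ball bounded_ball _ chained_convex[OF convex_ball] _ \<mu>] by auto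
  \<comment> \<open>Used to place \<open>u\<close> in the domain of order \<open>\<mu>\<close>,
    where \<open>\<Lambda>\<close> and its scaling law apply. The difference \<open>v\<close> is
    estimated on the convex ball, with the constant \<open>C2\<close>.\<close>
  obtain C4 where lower\<Omega>: "\<And>w E. jet_le m \<Omega> w E \<Longrightarrow> jet_le \<mu> \<Omega> w (C4 * E)"
    using jet_le_lower_order[OF \<Omega> W(2,3,1) \<mu>] by metis
  obtain C3 where C3: "C3 \<ge> 0" and point: "\<And>(x0::real^'n) g E. \<lbrakk>jet_le m (ball x0 1) g E; isCont (g (\<lambda>_. 0)) x0\<rbrakk> \<Longrightarrow> (g (\<lambda>_. 0) x0)\<^sup>2 \<le> C3 * E"
    using jet_point_bound[OF zero_less_one m2] by metis
  have poly_mem: "poly_jet q c (\<lambda>_. 0) \<in> sobolev_space \<Omega> \<mu>" for c :: "('n \<Rightarrow> nat) \<Rightarrow> real"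
  proof -
    \<comment> \<open>An integral order has no difference seminorm to verify, so the polynomial is
      first placed in the smallest integral order above \<open>\<mu>\<close>.\<close>
    have \<mu>M: "\<mu> \<le> real (Suc (nat \<lfloor>\<mu>\<rfloor>))" using \<mu>(1) by simp linarith
    obtain C where "\<And>w E. jet_le (real (Suc (nat \<lfloor>\<mu>\<rfloor>))) \<Omega> w E \<Longrightarrow> jet_le \<mu> \<Omega> w (C * E)"
      using jet_le_lower_order[OF \<Omega> W(2,3,1) \<mu>(1) \<mu>M] by metis
    moreover obtain E where "jet_le (real (Suc (nat \<lfloor>\<mu>\<rfloor>))) \<Omega> (poly_jet q c) E" using poly_jet_le[OF \<Omega>] by blast
    ultimately have "jet_le \<mu> \<Omega> (poly_jet q c) (C * E)" by blast
    then show ?thesis by (rule sobolev_of_jet(1)[OF \<Omega>]) simp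
  qed
  define N where "N = real (card {\<alpha>::'n \<Rightarrow> nat. multi_order \<alpha> \<le> nat \<lfloor>\<mu>\<rfloor>} + card {\<alpha>::'n \<Rightarrow> nat. multi_order \<alpha> = nat \<lfloor>\<mu>\<rfloor>})"
  define K where "K = C\<Lambda> * sqrt (N * (C2 * C1)) + (\<Sum>x\<in>X. \<bar>a x\<bar>) * sqrt (C3 * C1)"
  have main: "\<bar>stencil_error \<Lambda> s X a h u\<bar> \<le> K * h powr (m - s - real CARD('n) / 2)"
    if h: "0 < h" "h \<le> 1" "h * R \<le> R0" and u: "u \<in> sobolev_space_cont \<Omega> m" "sobolev_norm \<Omega> m u \<le> 1" for h u
  proof -
    obtain g where g: "jet_le m \<Omega> g 1" "\<And>x. x \<in> \<Omega> \<Longrightarrow> g (\<lambda>_. 0) x = u x"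
      using jet_of_sobolev[OF \<Omega> m0 u] by metis
    have uV: "u \<in> sobolev_space \<Omega> \<mu>"
      by (rule sobolev_of_jet(1)[OF \<Omega> lower\<Omega>[OF g(1)]]) (simp add: g(2))
    have "jet_le m (ball 0 R0) g 1" by (rule jet_le_subset[OF g(1) R0(2)]) simp
    from appr[OF this h(1,3)] obtain c where w: "jet_le m (ball 0 R) (scaled_error q g h c) (C1 * h powr (2 * m - real CARD('n)))" by blast
    define E where "E = C1 * h powr (2 * m - real CARD('n))"
    have E: "E \<ge> 0" using C1 by (simp add: E_def)
    \<comment> \<open>\<open>E\<close> bounds squared norms; its root carries the factor
      \<open>h powr (m - d / 2)\<close>.\<close>
    have sqE: "sqrt (k * E) = sqrt (k * C1) * h powr (m - real CARD('n) / 2)" if "k \<ge> 0" for k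
    proof -
      have "h powr (2 * m - real CARD('n)) = (h powr (m - real CARD('n) / 2))\<^sup>2"
        by (simp add: power2_eq_square powr_add[symmetric])
      then show ?thesis by (simp add: E_def mult.assoc[symmetric] real_sqrt_mult)
    qed
    define p where "p = poly_jet q c (\<lambda>_. 0)"
    define v where "v x = u (h *\<^sub>R x) - p x" for x
    have h\<Omega>: "h *\<^sub>R x \<in> \<Omega>" if "x \<in> \<Omega>" for x
      using scal that h by (auto simp: scalable_def image_subset_iff)
    have vw: "v x = scaled_error q g h c (\<lambda>_. 0) x" if "x \<in> \<Omega>" for x
      using g(2)[OF h\<Omega>[OF that]] by (simp add: v_def p_def scaled_error_def multi_order_def)
    have "jet_le \<mu> \<Omega> (scaled_error q g h c) (C2 * E)"
      by (rule jet_le_subset[OF lower[OF w[folded E_def]] \<Omega>R \<Omega>b])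
    note vs = sobolev_of_jet[OF \<Omega> this vw, folded N_def]
    have pV: "p \<in> sobolev_space \<Omega> \<mu>" unfolding p_def by (rule poly_mem)
    have "(\<lambda>x. u (h *\<^sub>R x)) = (\<lambda>x. v x + p x)" by (simp add: v_def)
    then have \<Lambda>u: "\<Lambda> (\<lambda>x. u (h *\<^sub>R x)) = \<Lambda> v + \<Lambda> p"
      using lin vs(1) pV by (simp add: linear_functional_on_def)
    have \<Lambda>p: "\<Lambda> p = nodal X a p"
      using exact poly_jet_in_poly_space[of q c] by (simp add: poly_exact_def p_def q_def)
    have sc: "\<Lambda> (\<lambda>x. u (h *\<^sub>R x)) = h powr s * \<Lambda> u"
      using order uV h by (simp add: has_scaling_order_def)
    have "stencil_error \<Lambda> s X a h u = h powr (- s) * (\<Lambda> v - nodal X a v)"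
    proof -
      have "\<Lambda> u = h powr (- s) * (h powr s * \<Lambda> u)" using h by (simp add: mult.assoc[symmetric] powr_add[symmetric])
      then have "\<Lambda> u = h powr (- s) * (\<Lambda> v + nodal X a p)" using sc \<Lambda>u \<Lambda>p by simp
      moreover have "(\<Sum>x\<in>X. a x * u (h *\<^sub>R x)) = nodal X a v + nodal X a p"
        by (simp add: nodal_def v_def right_diff_distrib sum_subtractf)
      ultimately show ?thesis by (simp add: stencil_error_def algebra_simps)
    qed
    moreover have "\<bar>\<Lambda> v - nodal X a v\<bar> \<le> K * h powr (m - real CARD('n) / 2)"
    proof -
      have "\<bar>\<Lambda> v\<bar> \<le> C\<Lambda> * sobolev_norm \<Omega> \<mu> v" by (rule C\<Lambda>(2)[OF vs(1)])
      also have "\<dots> \<le> C\<Lambda> * sqrt (N * (C2 * E))" by (intro mult_left_mono vs(2) C\<Lambda>0)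
      also have "\<dots> = C\<Lambda> * sqrt (N * (C2 * C1)) * h powr (m - real CARD('n) / 2)"
        using sqE[of "N * C2"] C2 by (simp add: N_def mult.assoc)
      finally have 1: "\<bar>\<Lambda> v\<bar> \<le> C\<Lambda> * sqrt (N * (C2 * C1)) * h powr (m - real CARD('n) / 2)" .
      have pt: "\<bar>v x\<bar> \<le> sqrt (C3 * E)" if x: "x \<in> X" for x
      proof -
        have x\<Omega>: "x \<in> \<Omega>" using x X by auto
        have uc: "continuous_on \<Omega> u" using u(1) by (simp add: sobolev_space_cont_def)
        have "continuous_on \<Omega> (\<lambda>x. u (h *\<^sub>R x))"
          by (rule continuous_on_compose2[OF uc]) (auto intro!: continuous_intros h\<Omega>)
        then have "continuous_on \<Omega> v"
          unfolding v_def p_def by (intro continuous_on_diff continuous_on_subset[OF poly_jet_continuous]) auto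
        then have "continuous_on \<Omega> (scaled_error q g h c (\<lambda>_. 0))"
          using vw by (rule continuous_on_eq)
        then have "isCont (scaled_error q g h c (\<lambda>_. 0)) x"
          using \<Omega>(1) x\<Omega> by (simp add: continuous_on_eq_continuous_at)
        moreover have "jet_le m (ball x 1) (scaled_error q g h c) E"
          by (rule jet_le_subset[OF w[folded E_def] XR[OF x]]) simp
        ultimately have "(v x)\<^sup>2 \<le> C3 * E" using point vw[OF x\<Omega>] by simp
        then have "sqrt ((v x)\<^sup>2) \<le> sqrt (C3 * E)" by (rule real_sqrt_le_mono)
        then show ?thesis by simp
      qed
      have "\<bar>nodal X a v\<bar> \<le> (\<Sum>x\<in>X. \<bar>a x\<bar> * sqrt (C3 * E))"
        unfolding nodal_def by (intro order_trans[OF sum_abs] sum_mono) (simp add: abs_mult mult_left_mono pt)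
      also have "\<dots> = (\<Sum>x\<in>X. \<bar>a x\<bar>) * sqrt (C3 * C1) * h powr (m - real CARD('n) / 2)"
        using sqE[OF C3] by (simp add: sum_distrib_right mult.assoc)
      finally have 2: "\<bar>nodal X a v\<bar> \<le> (\<Sum>x\<in>X. \<bar>a x\<bar>) * sqrt (C3 * C1) * h powr (m - real CARD('n) / 2)" .
      have "\<bar>\<Lambda> v - nodal X a v\<bar> \<le> \<bar>\<Lambda> v\<bar> + \<bar>nodal X a v\<bar>" by (rule abs_triangle_ineq4)
      also have "\<dots> \<le> K * h powr (m - real CARD('n) / 2)" using 1 2 by (simp add: K_def distrib_right)
      finally show ?thesis .
    qed
    ultimately have "\<bar>stencil_error \<Lambda> s X a h u\<bar> \<le> h powr (- s) * (K * h powr (m - real CARD('n) / 2))"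
      by (simp add: abs_mult mult_left_mono)
    also have "\<dots> = K * h powr (m - s - real CARD('n) / 2)"
      by (simp add: powr_add[symmetric] mult.left_commute algebra_simps)
    finally show ?thesis .
  qed
  \<comment> \<open>The bound \<open>1\<close> serves scalability and the scaling law, the bound
    \<open>R0 / R\<close> keeps the dilated ball inside \<open>\<Omega>\<close>.\<close>
  define h0 where "h0 = min 1 (R0 / R)"
  have h0: "h0 > 0" using R R0 by (simp add: h0_def)
  have "dual_norm (sobolev_space_cont \<Omega> m) (sobolev_norm \<Omega> m) (stencil_error \<Lambda> s X a h) \<le> ennreal (K * h powr (m - s - real CARD('n) / 2))"
    if "0 < h" "h < h0" for h
  proof -
    have "h \<le> 1" "h * R \<le> R0" using that R by (auto simp: h0_def field_simps)
    then show ?thesis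
      unfolding dual_norm_def using that by (intro SUP_least ennreal_leI main) auto
  qed
  then show ?thesis
    unfolding has_convergence_rate_def
    using h0 by (intro exI[of _ K]) (auto simp: eventually_at_right_field)
qed

subsection \<open>Existence of optimal weights\<close>

text \<open>For functions in the unit ball some admissible constant lies below \<open>2\<close>, by
  the definition of the infimum. The real \<open>sqrt\<close> is negative on negative numbers; the
  absolute value keeps the factor nonnegative while \<open>C\<close> is enlarged to
  \<open>2\<close>.\<close>

lemma bl_unit_ball_nodal_bound:
  fixes u :: "real^'n::finite \<Rightarrow> real"
  assumes "finite X" and b: "\<And>p. p \<in> poly_space (polyharmonic_order m CARD('n)) \<Longrightarrow> nodal X b p = 0"
    and u: "u \<in> bl_space \<kappa> m" "bl_norm \<kappa> m u \<le> 1"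
  shows "\<bar>nodal X b u\<bar> \<le> 2 * \<bar>sqrt (\<Sum>y\<in>X. \<Sum>z\<in>X. b y * b z * polyharmonic_kernel \<kappa> m CARD('n) (norm (y - z)))\<bar>"
proof -
  let ?K = "sqrt (\<Sum>y\<in>X. \<Sum>z\<in>X. b y * b z * polyharmonic_kernel \<kappa> m CARD('n) (norm (y - z)))"
  have "{C. bl_bound \<kappa> m u C} \<noteq> {}" using u(1) by (auto simp: bl_space_def)
  moreover have "Inf {C. bl_bound \<kappa> m u C} < 2" using u(2) by (simp add: bl_norm_def)
  ultimately obtain C where C: "bl_bound \<kappa> m u C" "C < 2"
    by (metis cInf_lessD mem_Collect_eq)
  have "\<bar>nodal X b u\<bar> \<le> C * ?K"
    using C(1) assms(1) b unfolding bl_bound_def nodal_def by blast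
  also have "\<dots> \<le> C * \<bar>?K\<bar>" using C(1) by (intro mult_left_mono) (auto simp: bl_bound_def)
  also have "\<dots> \<le> 2 * \<bar>?K\<bar>" using C(2) by (intro mult_right_mono) auto
  finally show ?thesis .
qed

text \<open>In use, \<open>f\<close> is a seminorm along a line and \<open>N\<close> the seminorm of
  its direction. Outside the interval of half-length \<open>2 * f 0 / N\<close> the growth condition
  gives \<open>f r \<ge> f 0\<close>, so the minimum over this compact interval is global; for
  \<open>N = 0\<close> the function is constant.\<close>

lemma seminorm_minimum_line:
  fixes f :: "real \<Rightarrow> real"
  assumes N: "N \<ge> 0" and f0: "f 0 \<ge> 0" and lip: "\<And>r r'. \<bar>f r - f r'\<bar> \<le> N * \<bar>r - r'\<bar>" and co: "\<And>r. f r \<ge> \<bar>r\<bar> * N - f 0"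
  shows "\<exists>r. \<forall>r'. f r \<le> f r'"
proof (cases "N = 0")
  case True
  then have "f r = f r'" for r r' using lip[of r r'] by simp
  then have "\<forall>r'. f 0 \<le> f r'" by (metis order_refl)
  then show ?thesis by blast
next
  case False
  then have N0: "N > 0" using N by simp
  define L where "L = 2 * f 0 / N"
  have L: "L \<ge> 0" using N0 f0 by (simp add: L_def)
  have "N-lipschitz_on {-L..L} f"
    by (rule lipschitz_onI) (use lip N in \<open>auto simp: dist_real_def\<close>)
  then have "continuous_on {-L..L} f" by (rule lipschitz_on_continuous_on)
  then have "\<exists>r\<in>{-L..L}. \<forall>r'\<in>{-L..L}. f r \<le> f r'"
    using L by (intro continuous_attains_inf) auto
  then obtain r where r: "\<And>r'. r' \<in> {-L..L} \<Longrightarrow> f r \<le> f r'" by blast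
  have "f r \<le> f r'" for r'
  proof (cases "r' \<in> {-L..L}")
    case False
    then have "L \<le> \<bar>r'\<bar>" by auto
    then have "L * N \<le> \<bar>r'\<bar> * N" using N by (intro mult_right_mono)
    then have "2 * f 0 \<le> \<bar>r'\<bar> * N" using N0 by (simp add: L_def)
    then have "f 0 \<le> f r'" using co[of r'] by simp
    then show ?thesis using r[of 0] L by auto
  qed (rule r)
  then show ?thesis by blast
qed

text \<open>
  The seminorm may have a nontrivial kernel, so minimizing sequences need not be bounded; the
  coordinates are therefore eliminated one at a time by passing to the quotient seminorm.
\<close>

lemma seminorm_minimum:
  fixes P :: "('i \<Rightarrow> real) \<Rightarrow> real" and L :: "('i \<Rightarrow> real) set"
  assumes "finite I" "i0 \<notin> I"
    and "\<And>s t. s \<in> L \<Longrightarrow> t \<in> L \<Longrightarrow> (\<lambda>i. s i + t i) \<in> L" "\<And>c s. s \<in> L \<Longrightarrow> (\<lambda>i. c * s i) \<in> L"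
    and "\<And>s. s \<in> L \<Longrightarrow> 0 \<le> P s" "\<And>s t. s \<in> L \<Longrightarrow> t \<in> L \<Longrightarrow> P (\<lambda>i. s i + t i) \<le> P s + P t"
    and "\<And>c s. s \<in> L \<Longrightarrow> P (\<lambda>i. c * s i) \<le> \<bar>c\<bar> * P s"
    and "\<And>s t. s \<in> L \<Longrightarrow> t \<in> L \<Longrightarrow> (\<And>i. i \<in> insert i0 I \<Longrightarrow> s i = t i) \<Longrightarrow> P s = P t"
    and "\<exists>s\<in>L. s i0 = 1"
  shows "\<exists>t\<in>L. t i0 = 1 \<and> (\<forall>s\<in>L. s i0 = 1 \<longrightarrow> P t \<le> P s)"
  using assms
proof (induction I arbitrary: L P rule: finite_induct)
  case empty
  then obtain s where s: "s \<in> L" "s i0 = 1" by blast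
  have "P s \<le> P t" if "t \<in> L" "t i0 = 1" for t
    using empty.prems(7)[OF s(1) that(1)] s that by simp
  with s show ?case by blast
next
  case (insert j I)
  note add = insert.prems(2) and scale = insert.prems(3) and nonneg = insert.prems(4)
    and subadd = insert.prems(5) and hom = insert.prems(6) and det = insert.prems(7)
  have ij: "i0 \<noteq> j" "i0 \<notin> I" using insert.prems(1) by auto
  have diff: "(\<lambda>i. s i - t i) \<in> L" if "s \<in> L" "t \<in> L" for s t
    using add[OF that(1) scale[OF that(2), of "-1"]] by simp
  show ?case
  proof (cases "\<exists>e\<in>L. e i0 = 0 \<and> e j \<noteq> 0")
    case False
    show ?thesis
    proof (rule insert.IH[OF ij(2) add scale nonneg subadd hom _ insert.prems(8)])
      fix s t assume st: "s \<in> L" "t \<in> L" and eq: "\<And>i. i \<in> insert i0 I \<Longrightarrow> s i = t i"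
      have "s j - t j = 0" using False diff[OF st] eq[of i0] by auto
      then show "P s = P t" using eq by (intro det[OF st]) auto
    qed
  next
    case True
    then obtain e' where e': "e' \<in> L" "e' i0 = 0" "e' j \<noteq> 0" by blast
    define e where "e i = (1 / e' j) * e' i" for i
    have e: "e \<in> L" "e i0 = 0" "e j = 1" using scale[OF e'(1), of "1 / e' j"] e' by (auto simp: e_def[abs_def])
    \<comment> \<open>\<open>T s r\<close> moves \<open>s\<close> along \<open>e\<close>, which
      changes coordinate \<open>j\<close> but not \<open>i0\<close>. \<open>P'\<close> is the
      quotient seminorm modulo \<open>e\<close>, and \<open>L'\<close> the slice that represents the
      quotient.\<close>
    define T where "T s r i = s i + r * e i" for s r i
    have T: "T s r \<in> L" if "s \<in> L" for s r
      unfolding T_def using add[OF that scale[OF e(1)]] .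
    define L' where "L' = {s \<in> L. s j = 0}"
    define P' where "P' s = (INF r. P (T s r))" for s
    have bdd: "bdd_below (range (\<lambda>r. P (T s r)))" if "s \<in> L" for s
      using nonneg[OF T[OF that]] by (intro bdd_belowI2[of _ 0]) auto
    have P'_le: "P' s \<le> P (T s r)" if "s \<in> L" for s r
      unfolding P'_def by (rule cINF_lower[OF bdd[OF that]]) simp
    have le_P': "x \<le> P' s" if "\<And>r. x \<le> P (T s r)" for x s
      unfolding P'_def by (rule cINF_greatest) (use that in auto)
    have "\<exists>t\<in>L'. t i0 = 1 \<and> (\<forall>s\<in>L'. s i0 = 1 \<longrightarrow> P' t \<le> P' s)"
    proof (rule insert.IH[OF ij(2)])
      show "(\<lambda>i. s i + t i) \<in> L'" if "s \<in> L'" "t \<in> L'" for s t using that add by (auto simp: L'_def)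
      show "(\<lambda>i. c * s i) \<in> L'" if "s \<in> L'" for c s using that scale by (auto simp: L'_def)
      show "0 \<le> P' s" if "s \<in> L'" for s
        by (rule le_P') (use that nonneg T in \<open>auto simp: L'_def\<close>)
      show "P' (\<lambda>i. s i + t i) \<le> P' s + P' t" if "s \<in> L'" "t \<in> L'" for s t
      proof -
        have st: "s \<in> L" "t \<in> L" using that by (auto simp: L'_def)
        have "P' (\<lambda>i. s i + t i) \<le> P (T s r) + P (T t r')" for r r'
        proof -
          have "T (\<lambda>i. s i + t i) (r + r') = (\<lambda>i. T s r i + T t r' i)" by (auto simp: T_def algebra_simps)
          then show ?thesis
            using P'_le[OF add[OF st], of "r + r'"] subadd[OF T[OF st(1), of r] T[OF st(2), of r']] by simp
        qed
        then have "P' (\<lambda>i. s i + t i) - P (T s r) \<le> P' t" for r by (intro le_P') (simp add: algebra_simps)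
        then have "P' (\<lambda>i. s i + t i) - P' t \<le> P' s" by (intro le_P') (simp add: algebra_simps)
        then show ?thesis by simp
      qed
      show "P' (\<lambda>i. c * s i) \<le> \<bar>c\<bar> * P' s" if "s \<in> L'" for c s
      proof -
        have s: "s \<in> L" using that by (auto simp: L'_def)
        have le: "P' (\<lambda>i. c * s i) \<le> \<bar>c\<bar> * P (T s r)" for r
        proof -
          have "T (\<lambda>i. c * s i) (c * r) = (\<lambda>i. c * T s r i)" by (auto simp: T_def algebra_simps)
          then show ?thesis using P'_le[OF scale[OF s], of c "c * r"] hom[OF T[OF s, of r], of c] by simp
        qed
        show ?thesis
        proof (cases "c = 0")
          case True
          then show ?thesis using le[of 0] by simp
        next
          case False
          have "P' (\<lambda>i. c * s i) / \<bar>c\<bar> \<le> P' s"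
            by (rule le_P') (use le False in \<open>simp add: field_simps\<close>)
          then show ?thesis using False by (simp add: field_simps)
        qed
      qed
      show "P' s = P' t" if "s \<in> L'" "t \<in> L'" "\<And>i. i \<in> insert i0 I \<Longrightarrow> s i = t i" for s t
      proof -
        have "P (T s r) = P (T t r)" for r
          using that by (intro det T) (auto simp: L'_def T_def)
        then show ?thesis by (simp add: P'_def)
      qed
      obtain s where s: "s \<in> L" "s i0 = 1" using insert.prems(8) by blast
      have "T s (- s j) \<in> L'" using T[OF s(1)] e by (simp add: L'_def T_def)
      moreover have "T s (- s j) i0 = 1" using s e by (simp add: T_def)
      ultimately show "\<exists>s\<in>L'. s i0 = 1" by blast
    qed
    then obtain t where t: "t \<in> L'" "t i0 = 1" and tmin: "\<And>s. s \<in> L' \<Longrightarrow> s i0 = 1 \<Longrightarrow> P' t \<le> P' s" by blast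
    have tL: "t \<in> L" using t by (simp add: L'_def)
    have T0: "T t 0 = t" by (simp add: T_def[abs_def])
    \<comment> \<open>A minimizer of the quotient seminorm is lifted by a minimization over its
      line, where the infimum is attained.\<close>
    have "\<exists>r. \<forall>r'. P (T t r) \<le> P (T t r')"
    proof (rule seminorm_minimum_line)
      show "0 \<le> P e" "0 \<le> P (T t 0)" using nonneg e tL T0 by auto
      have one: "P (T t r) \<le> P (T t r') + P e * \<bar>r - r'\<bar>" for r r'
      proof -
        have "T t r = (\<lambda>i. T t r' i + (r - r') * e i)" by (auto simp: T_def algebra_simps)
        then have "P (T t r) \<le> P (T t r') + P (\<lambda>i. (r - r') * e i)"
          using subadd[OF T[OF tL, of r'] scale[OF e(1), of "r - r'"]] by simp
        then show ?thesis using hom[OF e(1), of "r - r'"] by (simp add: mult.commute)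
      qed
      show "\<bar>P (T t r) - P (T t r')\<bar> \<le> P e * \<bar>r - r'\<bar>" for r r'
        using one[of r r'] one[of r' r] by (simp add: abs_minus_commute abs_le_iff)
      show "\<bar>r\<bar> * P e - P (T t 0) \<le> P (T t r)" for r
      proof (cases "r = 0")
        case False
        have "P (\<lambda>i. r * e i) \<le> P (T t r) + P (\<lambda>i. - 1 * t i)"
        proof -
          have "(\<lambda>i. r * e i) = (\<lambda>i. T t r i + - 1 * t i)" by (auto simp: T_def)
          then show ?thesis using subadd[OF T[OF tL, of r] scale[OF tL, of "- 1"]] by simp
        qed
        also have "P (\<lambda>i. - 1 * t i) \<le> P t" using hom[OF tL, of "- 1"] by simp
        finally have 1: "P (\<lambda>i. r * e i) \<le> P (T t r) + P t" by simp
        have "e = (\<lambda>i. (1 / r) * (r * e i))" using False by auto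
        then have "P e \<le> \<bar>1 / r\<bar> * P (\<lambda>i. r * e i)" using hom[OF scale[OF e(1), of r], of "1 / r"] by simp
        then have "\<bar>r\<bar> * P e \<le> P (\<lambda>i. r * e i)" using False by (simp add: field_simps)
        with 1 show ?thesis by (simp add: T0)
      qed (use nonneg T tL in simp)
    qed
    then obtain r where r: "\<And>r'. P (T t r) \<le> P (T t r')" by blast
    have "P (T t r) \<le> P s" if s: "s \<in> L" "s i0 = 1" for s
    proof -
      have s': "T s (- s j) \<in> L'" using T[OF s(1)] e by (simp add: L'_def T_def)
      have "P (T t r) \<le> P' t" by (rule le_P') (rule r)
      also have "\<dots> \<le> P' (T s (- s j))" by (rule tmin[OF s']) (use s e in \<open>simp add: T_def\<close>)
      also have "\<dots> \<le> P (T (T s (- s j)) (s j))" using s' by (intro P'_le) (simp add: L'_def)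
      also have "T (T s (- s j)) (s j) = s" by (auto simp: T_def)
      finally show ?thesis .
    qed
    moreover have "T t r \<in> L" "T t r i0 = 1" using T[OF tL] t e by (auto simp: T_def)
    ultimately show ?thesis by blast
  qed
qed

text \<open>The admissible weights form an affine set. An additional coordinate \<open>None\<close>
  for the coefficient of \<open>\<Lambda>\<close> turns the error functionals into a linear family:
  the dual norm becomes a seminorm on the subspace \<open>L\<close> annihilating the polynomials,
  and the constraint reads \<open>s None = 1\<close>.\<close>

lemma bl_optimal_weights_exist:
  fixes X :: "(real^'n::finite) set"
  assumes X: "finite X"
    and a0: "poly_exact \<Lambda> X (polyharmonic_order m CARD('n)) a0" "bl_dual_norm \<kappa> m (\<lambda>u. \<Lambda> u - nodal X a0 u) < \<infinity>"
  shows "\<exists>a. bl_optimal_weights \<kappa> m \<Lambda> X a"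
proof -
  define Po :: "(real^'n \<Rightarrow> real) set" where "Po = poly_space (polyharmonic_order m CARD('n))"
  define U :: "(real^'n \<Rightarrow> real) set" where "U = {u \<in> bl_space \<kappa> m. bl_norm \<kappa> m u \<le> 1}"
  define err where "err s u = s None * \<Lambda> u - nodal X (\<lambda>x. s (Some x)) u" for s u
  define L where "L = {s. \<forall>p\<in>Po. err s p = 0}"
  define Q where "Q s = (SUP u\<in>U. ennreal \<bar>err s u\<bar>)" for s
  have err_add: "err (\<lambda>i. s i + t i) u = err s u + err t u" for s t u
    by (simp add: err_def nodal_def algebra_simps sum.distrib)
  have err_scale: "err (\<lambda>i. c * s i) u = c * err s u" for c s u
    by (simp add: err_def nodal_def algebra_simps sum_distrib_left)
  have Q_eq: "bl_dual_norm \<kappa> m (\<lambda>u. \<Lambda> u - nodal X a u) = Q (case_option 1 a)" for a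
    by (simp add: bl_dual_norm_def dual_norm_def Q_def U_def err_def)
  have L_eq: "poly_exact \<Lambda> X (polyharmonic_order m CARD('n)) a \<longleftrightarrow> case_option 1 a \<in> L" for a
    by (simp add: poly_exact_def L_def Po_def err_def)
  have fin: "Q s < \<infinity>" if s: "s \<in> L" for s
  proof -
    \<comment> \<open>Subtracting \<open>s None\<close> times the given error functional leaves a
      purely nodal one that annihilates the polynomials; the definition of the Beppo-Levi space
      bounds such functionals on its unit ball.\<close>
    define b where "b x = s None * a0 x - s (Some x)" for x
    have split: "err s u = s None * err (case_option 1 a0) u + nodal X b u" for u
      by (simp add: err_def nodal_def b_def algebra_simps sum_subtractf sum_distrib_left)
    have "nodal X b p = 0" if "p \<in> Po" for p
      using split[of p] s a0(1) that by (auto simp: L_def L_eq)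
    note bound = bl_unit_ball_nodal_bound[where \<kappa> = \<kappa>, OF X this[unfolded Po_def]]
    define D where "D = 2 * \<bar>sqrt (\<Sum>y\<in>X. \<Sum>z\<in>X. b y * b z * polyharmonic_kernel \<kappa> m CARD('n) (norm (y - z)))\<bar>"
    have "Q s \<le> ennreal \<bar>s None\<bar> * Q (case_option 1 a0) + ennreal D"
      unfolding Q_def[of s]
    proof (rule SUP_least)
      fix u assume u: "u \<in> U"
      have "\<bar>err s u\<bar> \<le> \<bar>s None\<bar> * \<bar>err (case_option 1 a0) u\<bar> + D"
        using bound[where u = u] u unfolding split by (auto simp: U_def D_def abs_mult intro: order_trans[OF abs_triangle_ineq])
      then have "ennreal \<bar>err s u\<bar> \<le> ennreal (\<bar>s None\<bar> * \<bar>err (case_option 1 a0) u\<bar> + D)" by (rule ennreal_leI)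
      also have "\<dots> = ennreal \<bar>s None\<bar> * ennreal \<bar>err (case_option 1 a0) u\<bar> + ennreal D"
        by (simp add: ennreal_mult D_def)
      also have "\<dots> \<le> ennreal \<bar>s None\<bar> * Q (case_option 1 a0) + ennreal D"
        unfolding Q_def using u by (intro add_mono mult_left_mono SUP_upper) auto
      finally show "ennreal \<bar>err s u\<bar> \<le> ennreal \<bar>s None\<bar> * Q (case_option 1 a0) + ennreal D" .
    qed
    also have "\<dots> < \<infinity>" using a0(2) by (simp add: Q_eq ennreal_mult_less_top)
    finally show ?thesis .
  qed
  define P where "P s = enn2real (Q s)" for s
  have PQ: "Q s = ennreal (P s)" if "s \<in> L" for s using fin[OF that] by (simp add: P_def)
  have P0: "P s \<ge> 0" for s by (simp add: P_def)
  have Ladd: "(\<lambda>i. s i + t i) \<in> L" if "s \<in> L" "t \<in> L" for s t using that by (simp add: L_def err_add)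
  have Lscale: "(\<lambda>i. c * s i) \<in> L" if "s \<in> L" for c s using that by (simp add: L_def err_scale)
  have "\<exists>t\<in>L. t None = 1 \<and> (\<forall>s\<in>L. s None = 1 \<longrightarrow> P t \<le> P s)"
  proof (rule seminorm_minimum[where I = "Some ` X"])
    show "P (\<lambda>i. s i + t i) \<le> P s + P t" if "s \<in> L" "t \<in> L" for s t
    proof -
      have "Q (\<lambda>i. s i + t i) \<le> Q s + Q t"
        unfolding Q_def[of "\<lambda>i. s i + t i"]
      proof (rule SUP_least)
        fix u assume u: "u \<in> U"
        have "ennreal \<bar>err (\<lambda>i. s i + t i) u\<bar> \<le> ennreal (\<bar>err s u\<bar> + \<bar>err t u\<bar>)"
          unfolding err_add by (intro ennreal_leI abs_triangle_ineq)
        also have "\<dots> = ennreal \<bar>err s u\<bar> + ennreal \<bar>err t u\<bar>" by simp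
        also have "\<dots> \<le> Q s + Q t" unfolding Q_def using u by (intro add_mono SUP_upper) auto
        finally show "ennreal \<bar>err (\<lambda>i. s i + t i) u\<bar> \<le> Q s + Q t" .
      qed
      then have "ennreal (P (\<lambda>i. s i + t i)) \<le> ennreal (P s + P t)"
        using PQ that Ladd P0 by simp
      then show ?thesis using P0[of s] P0[of t] by (subst (asm) ennreal_le_iff) auto
    qed
    show "P (\<lambda>i. c * s i) \<le> \<bar>c\<bar> * P s" if "s \<in> L" for c s
    proof -
      have "Q (\<lambda>i. c * s i) \<le> ennreal \<bar>c\<bar> * Q s"
        unfolding Q_def[of "\<lambda>i. c * s i"]
      proof (rule SUP_least)
        fix u assume u: "u \<in> U"
        have "ennreal \<bar>err (\<lambda>i. c * s i) u\<bar> = ennreal \<bar>c\<bar> * ennreal \<bar>err s u\<bar>"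
          by (simp add: err_scale abs_mult ennreal_mult)
        also have "\<dots> \<le> ennreal \<bar>c\<bar> * Q s" unfolding Q_def using u by (intro mult_left_mono SUP_upper) auto
        finally show "ennreal \<bar>err (\<lambda>i. c * s i) u\<bar> \<le> ennreal \<bar>c\<bar> * Q s" .
      qed
      then have "ennreal (P (\<lambda>i. c * s i)) \<le> ennreal (\<bar>c\<bar> * P s)"
        using PQ that Lscale P0 by (simp add: ennreal_mult)
      then show ?thesis using P0[of s] by (subst (asm) ennreal_le_iff) auto
    qed
    show "P s = P t" if "s \<in> L" "t \<in> L" "\<And>i. i \<in> insert None (Some ` X) \<Longrightarrow> s i = t i" for s t
    proof -
      have "err s u = err t u" for u
        using that(3) by (auto simp: err_def nodal_def intro!: sum.cong)
      then show ?thesis by (simp add: P_def Q_def)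
    qed
    show "\<exists>s\<in>L. s None = 1" using a0(1) by (intro bexI[of _ "case_option 1 a0"]) (auto simp: L_eq)
  qed (use X P0 Ladd Lscale in auto)
  then obtain t where t: "t \<in> L" "t None = 1" and min: "\<And>s. s \<in> L \<Longrightarrow> s None = 1 \<Longrightarrow> P t \<le> P s" by blast
  define a where "a x = t (Some x)" for x
  have ta: "case_option 1 a = t" using t(2) by (auto simp: a_def fun_eq_iff split: option.split)
  have "bl_optimal_weights \<kappa> m \<Lambda> X a"
    unfolding bl_optimal_weights_def L_eq Q_eq ta
  proof (intro conjI allI impI t(1))
    fix b assume b: "case_option 1 b \<in> L"
    then have "P t \<le> P (case_option 1 b)" by (intro min) auto
    then show "Q t \<le> Q (case_option 1 b)" using PQ t(1) b by (simp add: ennreal_leI)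
  qed
  then show ?thesis by blast
qed

theorem corollary4:
  fixes \<Omega> X :: "(real^'n::finite) set"
    and m \<mu> s \<kappa> :: real
    and \<Lambda> :: "(real^'n \<Rightarrow> real) \<Rightarrow> real"
  assumes "m > real CARD('n) / 2"
    and "bounded_lipschitz_domain \<Omega>" and "scalable \<Omega>"
    and "finite X" and "X \<subseteq> \<Omega>"
    and "real CARD('n) / 2 < \<mu>" and "\<mu> \<le> real_of_int (\<lfloor>m - real CARD('n) / 2\<rfloor> + 1)" and "\<mu> \<le> m"
    and "continuous_functional_on_sobolev \<Omega> \<mu> \<Lambda>"
    and "has_scaling_order (sobolev_space \<Omega> \<mu>) \<Lambda> s"
    and "\<kappa> > 0"
    and "\<exists>a. poly_exact \<Lambda> X (polyharmonic_order m CARD('n)) a \<and>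
             bl_dual_norm \<kappa> m (\<lambda>u. \<Lambda> u - nodal X a u) < \<infinity>"
  shows "(\<exists>a. bl_optimal_weights \<kappa> m \<Lambda> X a) \<and>
         (\<forall>a. bl_optimal_weights \<kappa> m \<Lambda> X a \<longrightarrow>
            has_convergence_rate \<Omega> m (stencil_error \<Lambda> s X a) (m - s - real CARD('n) / 2))"
proof (intro conjI allI impI)
  show "\<exists>a. bl_optimal_weights \<kappa> m \<Lambda> X a"
    using assms(12) bl_optimal_weights_exist[OF assms(4)] by blast
  fix a assume "bl_optimal_weights \<kappa> m \<Lambda> X a"
  then have "poly_exact \<Lambda> X (polyharmonic_order m CARD('n)) a" by (simp add: bl_optimal_weights_def)
  moreover have "0 \<le> \<mu>" using assms(6) of_nat_0_le_iff[of "CARD('n)"] by linarith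
  ultimately show "has_convergence_rate \<Omega> m (stencil_error \<Lambda> s X a) (m - s - real CARD('n) / 2)"
    using stencil_rate[OF assms(1-5) _ assms(8-10)] by blast
qed

end
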